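(* Let $\phi,\psi\in C^0([0,1],\mathfrak g)$ be such that the pair $(\phi,\psi)$ is admissible. 1) The pair $(\phi,\psi)$ is regular if and only if $$\lim_{h\to0}\ \frac1h\cdot\Xi\big(\mathrm{Evol}(\phi)(t)^{-1}\cdot\mathrm{Evol}(\phi+h\psi)(t)\big)=\int_0^t\big(d_e\Xi\circ\mathrm{Ad}_{\mathrm{Evol}(\phi)(s)^{-1}}\big)(\psi(s))\,ds\in\overline E$$ holds uniformly in $t\in[0,1]$. 2) If $(\phi,\psi)$ is regular, then the map $(-\delta,\delta)\ni h\mapsto\mathrm{evol}(\phi+h\psi)\in G$ (for $\delta>0$ suitably small) is differentiable at $h=0$ if and only if $\int_0^1\mathrm{Ad}_{\mathrm{Evol}(\phi)(s)^{-1}}(\psi(s))\,ds\in\mathfrak g$. In this case, $$\frac{d}{dh}\Big|_{h=0}\mathrm{evol}(\phi+h\psi)=d_eL_{\mathrm{evol}(\phi)}\Big(\int_0^1\mathrm{Ad}_{\mathrm{Evol}(\phi)(s)^{-1}}(\psi(s))\,ds\Big).$$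
   Context: $G$ is a Lie group in Milnor's infinite-dimensional sense: a smooth Hausdorff manifold modelled on a real Hausdorff locally convex vector space $E$ (no completeness assumed) with smooth group operations, where $C^k$ is understood in Bastiani's sense (iterated directional derivatives of order $p\le k$ exist and define continuous maps $(x,v_1,\dots,v_p)\mapsto d^p_xf(v_1,\dots,v_p)$). $e$ is the unit, $\mathfrak g=T_eG$, $L_g(h)=gh$, $R_g(h)=hg$, $\mathrm{Ad}_g=d_e(h\mapsto ghg^{-1})$. $\overline E$ is the completion of $E$; each continuous seminorm $p$ on $E$ extends continuously to $\overline p$ on $\overline E$. $\Xi\colon G\supseteq\mathcal U\to\mathcal V\subseteq E$ is a fixed chart with $e\in\mathcal U$, $\Xi(e)=0$, $\mathcal V$ convex. A curve on a compact interval is $C^1$ if it is the restriction of a $C^1$-curve on an open interval. For $\mu\in C^1([0,1],G)$ let $\delta^r(\mu)(t)=d_{\mu(t)}R_{\mu(t)^{-1}}(\dot\mu(t))\in\mathfrak g$. Let $\mathrm D=\{\delta^r(\mu):\mu\in C^1([0,1],G)\}\subseteq C^0([0,1],\mathfrak g)$. On $\mathrm D$ the maps $\mathrm{Evol}(\delta^r(\mu)):=\mu\cdot\mu(0)^{-1}\in C^1([0,1],G)$ and $\mathrm{evol}(\phi):=\mathrm{Evol}(\phi)(1)$ are well defined. A pair $(\phi,\psi)\in C^0([0,1],\mathfrak g)^2$ is admissible if $\phi+h\psi\in\mathrm D$ for all $h\in(-\delta,\delta)$, for some $\delta>0$. It is regular if it is admissible and $\lim_{h\to0}\Xi(\mathrm{Evol}(\phi)(t)^{-1}\mathrm{Evol}(\phi+h\psi)(t))=0$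 uniformly in $t\in[0,1]$. Uniform limits: for $\alpha\colon((-\delta,0)\cup(0,\delta))\times[0,1]\to E$ and $\beta\colon[0,1]\to\overline E$, $\lim_{h\to0}\alpha(h,t)=\beta(t)$ uniformly means $\lim_{h\to0}\sup_{t\in[0,1]}\overline p(\alpha(h,t)-\beta(t))=0$ for each continuous seminorm $p$ on $E$. A uniform limit of expressions $\Xi(\nu_h(t))$ includes the requirement that $\nu_h(t)\in\mathcal U$ for all $t$ once $|h|$ is small enough. Riemann integrals of continuous curves take values in the completion of the respective space. A map $f\colon(-\delta,\delta)\to G$ is differentiable at $0$ if for some (equivalently, every) chart $\Xi'$ of $G$ around $f(0)$ the limit $\lim_{h\to0}\frac1h(\Xi'(f(h))-\Xi'(f(0)))$ exists in $E$ (in particular $f(h)$ lies in the chart domain for $|h|$ small); $\frac{d}{dh}|_{h=0}f(h)\in T_{f(0)}G$ is the corresponding tangent vector. *)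

theory Defs
  imports
    "HOL-Analysis.Analysis"
    "HOL-Algebra.Group"
    "HOL-Library.Function_Algebras"
    "HOL-Library.Extended_Nat"
begin

section \<open>Locally convex spaces\<close>

text \<open>
  The uniformity of a \<^class>\<open>uniform_topological_group_add\<close> is the translation invariant one
  (\<open>cauchy_seq_finset_iff_vanishing\<close>), so that \<^class>\<open>complete_uniform_space\<close> expresses
  completeness of the topological vector space.  The last two class assumptions are continuity of
  scalar multiplication and local convexity; the latter spells out \<^const>\<open>convex\<close>.
\<close>

class locally_convex_space =
  real_vector + t2_space + topological_ab_group_add + uniform_topological_group_add +
  assumes tendsto_scaleR_nhds:
      "((\<lambda>z. fst z *\<^sub>R snd z) \<longlongrightarrow> r *\<^sub>R x) (nhds r \<times>\<^sub>F nhds x)"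
    and locally_convex:
      "open U \<Longrightarrow> 0 \<in> U \<Longrightarrow>
        \<exists>V. open V \<and> 0 \<in> V \<and> V \<subseteq> U \<and>
          (\<forall>x\<in>V. \<forall>y\<in>V. \<forall>u\<ge>0. \<forall>v\<ge>0. u + v = 1 \<longrightarrow> u *\<^sub>R x + v *\<^sub>R y \<in> V)"

instantiation "fun" :: (type, scaleR) scaleR
begin

definition scaleR_fun_def: "r *\<^sub>R f = (\<lambda>x. r *\<^sub>R f x)"

instance ..

end

instance "fun" :: (type, real_vector) real_vector
  by standard (simp_all add: scaleR_fun_def fun_eq_iff plus_fun_def algebra_simps)

text \<open>
  \<open>is_completion S \<iota>\<close>: the complete Hausdorff locally convex space \<open>'b\<close>, together with \<open>\<iota>\<close>, is a
  completion of the linear subspace \<open>S\<close> of \<open>'a\<close>.  (A linear homeomorphism onto its image is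
  automatically an isomorphism of uniform spaces.)
\<close>

definition is_completion ::
  "'a::{real_vector, topological_space} set \<Rightarrow> ('a \<Rightarrow> 'b::{locally_convex_space, complete_uniform_space}) \<Rightarrow> bool"
  where "is_completion S \<iota> \<longleftrightarrow>
    (\<forall>x\<in>S. \<forall>y\<in>S. \<iota> (x + y) = \<iota> x + \<iota> y) \<and>
    (\<forall>r. \<forall>x\<in>S. \<iota> (r *\<^sub>R x) = r *\<^sub>R \<iota> x) \<and>
    homeomorphism S (\<iota> ` S) \<iota> (inv_into S \<iota>) \<and>
    closure (\<iota> ` S) = UNIV"

definition continuous_seminorm :: "('a::{real_vector, topological_space} \<Rightarrow> real) \<Rightarrow> bool"
  where "continuous_seminorm p \<longleftrightarrow>
    (\<forall>x y. p (x + y) \<le> p x + p y) \<and> (\<forall>r x. p (r *\<^sub>R x) = \<bar>r\<bar> * p x) \<and> continuous_on UNIV p"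

text \<open>
  The unique continuous extension of \<open>p\<close> along a completion \<open>\<iota>\<close>; it is again a seminorm.
\<close>

definition seminorm_extension :: "('a \<Rightarrow> 'b::topological_space) \<Rightarrow> ('a \<Rightarrow> real) \<Rightarrow> 'b \<Rightarrow> real"
  where "seminorm_extension \<iota> p = (THE q. continuous_on UNIV q \<and> (\<forall>x. q (\<iota> x) = p x))"

definition uniform_limit_at_0 ::
  "('a::{real_vector, topological_space} \<Rightarrow> 'b::{real_vector, topological_space}) \<Rightarrow>
    (real \<Rightarrow> real \<Rightarrow> 'a) \<Rightarrow> (real \<Rightarrow> 'b) \<Rightarrow> bool"
  where "uniform_limit_at_0 \<iota> \<alpha> \<beta> \<longleftrightarrow>
    (\<forall>p. continuous_seminorm p \<longrightarrow>
      ((\<lambda>h. SUP t\<in>{0..1}. ennreal (seminorm_extension \<iota> p (\<iota> (\<alpha> h t) - \<beta> t))) \<longlongrightarrow> 0) (at 0))"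

text \<open>
  The Riemann integral: in contrast to \<^const>\<open>division_filter\<close>, only constant gauges are admitted.
\<close>

definition riemann_filter :: "real \<Rightarrow> real \<Rightarrow> (real \<times> real set) set filter"
  where "riemann_filter a b =
    (INF \<delta>\<in>{0<..}. principal {p. p tagged_division_of {a..b} \<and> (\<lambda>x. ball x \<delta>) fine p})"

definition riemann_integral :: "real \<Rightarrow> real \<Rightarrow> (real \<Rightarrow> 'a::{real_vector, t2_space}) \<Rightarrow> 'a"
  where "riemann_integral a b f = Lim (riemann_filter a b) (\<lambda>p. \<Sum>(x, K)\<in>p. measure lborel K *\<^sub>R f x)"


section \<open>Bastiani calculus\<close>

definition diff_quotient ::
  "('a::real_vector \<Rightarrow> 'b::real_vector) \<Rightarrow> 'a \<Rightarrow> 'a \<Rightarrow> real \<Rightarrow> 'b"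
  where "diff_quotient f x v h = (1 / h) *\<^sub>R (f (x + h *\<^sub>R v) - f x)"

definition dir_deriv ::
  "('a::real_vector \<Rightarrow> 'b::{real_vector, t2_space}) \<Rightarrow> 'a \<Rightarrow> 'a \<Rightarrow> 'b"
  where "dir_deriv f x v = Lim (at 0) (diff_quotient f x v)"

text \<open>
  \<open>iter_dir_deriv p f x v\<close> is the \<open>p\<close>-th iterated directional derivative at \<open>x\<close> in the directions
  \<open>v 0, \<dots>, v (p - 1)\<close>; it does not depend on the other entries of the sequence \<open>v\<close>.  Therefore its
  continuity in \<open>(x, v)\<close>, for the product topology on sequences, is the joint continuity in
  \<open>(x, v 0, \<dots>, v (p - 1))\<close>.
\<close>

primrec iter_dir_deriv ::
  "nat \<Rightarrow> ('a::real_vector \<Rightarrow> 'b::{real_vector, t2_space}) \<Rightarrow> 'a \<Rightarrow> (nat \<Rightarrow> 'a) \<Rightarrow> 'b"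
  where
    "iter_dir_deriv 0 f x v = f x"
  | "iter_dir_deriv (Suc p) f x v = dir_deriv (\<lambda>y. iter_dir_deriv p f y v) x (v p)"

definition Ck_on ::
  "enat \<Rightarrow> ('a::{real_vector, topological_space}) set \<Rightarrow> ('a \<Rightarrow> 'b::{real_vector, t2_space}) \<Rightarrow> bool"
  where "Ck_on k S f \<longleftrightarrow> open S \<and>
    (\<forall>p. enat p < k \<longrightarrow> (\<forall>x\<in>S. \<forall>v w. \<exists>l.
      (diff_quotient (\<lambda>y. iter_dir_deriv p f y v) x w \<longlongrightarrow> l) (at 0))) \<and>
    (\<forall>p. enat p \<le> k \<longrightarrow> continuous_on (S \<times> UNIV) (\<lambda>(x, v). iter_dir_deriv p f x v))"


section \<open>Smooth manifolds\<close>

text \<open>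
  A chart is a domain together with a map of which only the values on that domain matter.
\<close>

type_synonym ('m, 'e) chart = "'m set \<times> ('m \<Rightarrow> 'e)"

definition chart_inv :: "('m, 'e) chart \<Rightarrow> 'e \<Rightarrow> 'm"
  where "chart_inv c = inv_into (fst c) (snd c)"

definition topological_chart :: "('m::topological_space, 'e::topological_space) chart \<Rightarrow> bool"
  where "topological_chart c \<longleftrightarrow> open (fst c) \<and> open (snd c ` fst c) \<and>
    homeomorphism (fst c) (snd c ` fst c) (snd c) (chart_inv c)"

definition smooth_transition ::
  "('m, 'e::{real_vector, t2_space}) chart \<Rightarrow> ('m, 'e) chart \<Rightarrow> bool"
  where "smooth_transition c c' \<longleftrightarrow>
    Ck_on \<infinity> (snd c ` (fst c \<inter> fst c')) (snd c' \<circ> chart_inv c)"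

definition smooth_atlas :: "('m::topological_space, 'e::{real_vector, t2_space}) chart set \<Rightarrow> bool"
  where "smooth_atlas A \<longleftrightarrow> (\<forall>c\<in>A. topological_chart c) \<and> (\<Union>c\<in>A. fst c) = UNIV \<and>
    (\<forall>c\<in>A. \<forall>c'\<in>A. smooth_transition c c')"

text \<open>The charts of the manifold, i.e. the maximal atlas determined by \<open>A\<close>.\<close>

definition charts ::
  "('m::topological_space, 'e::{real_vector, t2_space}) chart set \<Rightarrow> ('m, 'e) chart set"
  where "charts A = {c. topological_chart c \<and>
    (\<forall>c'\<in>A. smooth_transition c c' \<and> smooth_transition c' c)}"

definition charts_at ::
  "('m::topological_space, 'e::{real_vector, t2_space}) chart set \<Rightarrow> 'm \<Rightarrow> ('m, 'e) chart set"
  where "charts_at A x = {c \<in> charts A. x \<in> fst c}"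

definition prod_atlas :: "('m, 'e) chart set \<Rightarrow> ('n, 'f) chart set \<Rightarrow> ('m \<times> 'n, 'e \<times> 'f) chart set"
  where "prod_atlas A B = (\<lambda>(c, c'). (fst c \<times> fst c', map_prod (snd c) (snd c'))) ` (A \<times> B)"

definition Ck_map_on ::
  "enat \<Rightarrow> ('m::topological_space, 'e::{real_vector, t2_space}) chart set \<Rightarrow>
    ('n::topological_space, 'f::{real_vector, t2_space}) chart set \<Rightarrow> 'm set \<Rightarrow> ('m \<Rightarrow> 'n) \<Rightarrow> bool"
  where "Ck_map_on k A B D f \<longleftrightarrow> open D \<and> continuous_on D f \<and>
    (\<forall>c\<in>charts A. \<forall>c'\<in>charts B.
      Ck_on k (snd c ` (fst c \<inter> D \<inter> f -` fst c')) (snd c' \<circ> f \<circ> chart_inv c))"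

abbreviation real_atlas :: "(real, real) chart set"
  where "real_atlas \<equiv> {(UNIV, id)}"

definition C1_curve :: "('m::topological_space, 'e::{real_vector, t2_space}) chart set \<Rightarrow> (real \<Rightarrow> 'm) \<Rightarrow> bool"
  where "C1_curve A \<mu> \<longleftrightarrow> (\<exists>a b \<nu>. a < 0 \<and> 1 < b \<and>
    Ck_map_on 1 real_atlas A {a<..<b} \<nu> \<and> (\<forall>t\<in>{0..1}. \<mu> t = \<nu> t))"


section \<open>Tangent spaces\<close>

text \<open>
  A tangent vector at \<open>x\<close> is the family of its coordinates with respect to all charts around \<open>x\<close>;
  the families are subject to the usual transformation rule and are extended by \<open>0\<close> to all other
  arguments.  Vector space operations and topology are those of the function space.  As any one
  coordinate determines the others continuously and linearly, each projection
  \<open>X \<mapsto> X c\<close> with \<open>c \<in> charts_at A x\<close> is a topological isomorphism from the tangent space at \<open>x\<close>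
  onto the modelling space, namely the differential at \<open>x\<close> of the chart \<open>c\<close>.
\<close>

type_synonym ('m, 'e) tangent = "('m, 'e) chart \<Rightarrow> 'e"

definition tangent_space ::
  "('m::topological_space, 'e::{real_vector, t2_space}) chart set \<Rightarrow> 'm \<Rightarrow> ('m, 'e) tangent set"
  where "tangent_space A x = {X. (\<forall>c. c \<notin> charts_at A x \<longrightarrow> X c = 0) \<and>
    (\<forall>c\<in>charts_at A x. \<forall>c'\<in>charts_at A x.
      X c' = dir_deriv (snd c' \<circ> chart_inv c) (snd c x) (X c))}"

definition chart_differential :: "('m, 'e) chart \<Rightarrow> ('m, 'e) tangent \<Rightarrow> 'e"
  where "chart_differential c X = X c"

text \<open>The differential of a map at \<open>x\<close>; the choice of the chart around \<open>x\<close> is immaterial.\<close>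

definition tangent_map ::
  "('m::topological_space, 'e::{real_vector, t2_space}) chart set \<Rightarrow>
    ('n::topological_space, 'f::{real_vector, t2_space}) chart set \<Rightarrow>
    ('m \<Rightarrow> 'n) \<Rightarrow> 'm \<Rightarrow> ('m, 'e) tangent \<Rightarrow> ('n, 'f) tangent"
  where "tangent_map A B f x X =
    (let c = SOME c. c \<in> charts_at A x in
      (\<lambda>c'. if c' \<in> charts_at B (f x)
        then dir_deriv (snd c' \<circ> f \<circ> chart_inv c) (snd c x) (X c) else 0))"

definition curve_quotient :: "('m \<Rightarrow> 'e::real_vector) \<Rightarrow> (real \<Rightarrow> 'm) \<Rightarrow> real \<Rightarrow> real \<Rightarrow> 'e"
  where "curve_quotient \<xi> \<mu> t s = (1 / (s - t)) *\<^sub>R (\<xi> (\<mu> s) - \<xi> (\<mu> t))"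

text \<open>The velocity at \<open>t\<close> of a curve defined on \<open>S\<close>; one-sided at boundary points of an interval.\<close>

definition velocity ::
  "('m::topological_space, 'e::{real_vector, t2_space}) chart set \<Rightarrow>
    real set \<Rightarrow> (real \<Rightarrow> 'm) \<Rightarrow> real \<Rightarrow> ('m, 'e) tangent"
  where "velocity A S \<mu> t =
    (\<lambda>c. if c \<in> charts_at A (\<mu> t) then Lim (at t within S) (curve_quotient (snd c) \<mu> t) else 0)"

definition differentiable_at_0 ::
  "('m::topological_space, 'e::{real_vector, t2_space}) chart set \<Rightarrow> (real \<Rightarrow> 'm) \<Rightarrow> bool"
  where "differentiable_at_0 A f \<longleftrightarrow> (\<exists>c\<in>charts_at A (f 0).
    (\<forall>\<^sub>F h in at 0. f h \<in> fst c) \<and> (\<exists>l. (curve_quotient (snd c) f 0 \<longlongrightarrow> l) (at 0)))"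


section \<open>Lie groups and the evolution map\<close>

record ('g, 'e) lie_group_data = "'g monoid" +
  atlas :: "('g, 'e) chart set"

locale lie_group = group G
  for G :: "('g::t2_space, 'e::locally_convex_space) lie_group_data" (structure) +
  assumes carrier_UNIV: "carrier G = UNIV"
    and smooth_atlas: "smooth_atlas (atlas G)"
    and smooth_mult:
      "Ck_map_on \<infinity> (prod_atlas (atlas G) (atlas G)) (atlas G) UNIV (\<lambda>(x, y). x \<otimes> y)"
    and smooth_inv: "Ck_map_on \<infinity> (atlas G) (atlas G) UNIV (\<lambda>x. inv x)"

context
  fixes G :: "('g::t2_space, 'e::locally_convex_space) lie_group_data" (structure)
begin

definition lie_algebra :: "('g, 'e) tangent set"
  where "lie_algebra = tangent_space (atlas G) \<one>"

definition Ad :: "'g \<Rightarrow> ('g, 'e) tangent \<Rightarrow> ('g, 'e) tangent"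
  where "Ad g = tangent_map (atlas G) (atlas G) (\<lambda>h. g \<otimes> h \<otimes> inv g) \<one>"

definition C0_curves :: "(real \<Rightarrow> ('g, 'e) tangent) set"
  where "C0_curves = {\<phi>. continuous_on {0..1} \<phi> \<and> \<phi> ` {0..1} \<subseteq> lie_algebra}"

definition right_log_deriv :: "(real \<Rightarrow> 'g) \<Rightarrow> real \<Rightarrow> ('g, 'e) tangent"
  where "right_log_deriv \<mu> t =
    tangent_map (atlas G) (atlas G) (\<lambda>h. h \<otimes> inv (\<mu> t)) (\<mu> t) (velocity (atlas G) {0..1} \<mu> t)"

definition primitive :: "(real \<Rightarrow> ('g, 'e) tangent) \<Rightarrow> (real \<Rightarrow> 'g) \<Rightarrow> bool"
  where "primitive \<phi> \<mu> \<longleftrightarrow> C1_curve (atlas G) \<mu> \<and> (\<forall>t\<in>{0..1}. right_log_deriv \<mu> t = \<phi> t)"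

text \<open>Membership depends only on the values on the unit interval.\<close>

definition evol_domain :: "(real \<Rightarrow> ('g, 'e) tangent) set"
  where "evol_domain = {\<phi>. \<exists>\<mu>. primitive \<phi> \<mu>}"

definition Evol :: "(real \<Rightarrow> ('g, 'e) tangent) \<Rightarrow> real \<Rightarrow> 'g"
  where "Evol \<phi> = (let \<mu> = SOME \<mu>. primitive \<phi> \<mu> in (\<lambda>t. \<mu> t \<otimes> inv (\<mu> 0)))"

definition evol :: "(real \<Rightarrow> ('g, 'e) tangent) \<Rightarrow> 'g"
  where "evol \<phi> = Evol \<phi> 1"

definition admissible :: "(real \<Rightarrow> ('g, 'e) tangent) \<Rightarrow> (real \<Rightarrow> ('g, 'e) tangent) \<Rightarrow> bool"
  where "admissible \<phi> \<psi> \<longleftrightarrow> \<phi> \<in> C0_curves \<and> \<psi> \<in> C0_curves \<and>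
    (\<exists>\<delta>>0. \<forall>h\<in>{-\<delta><..<\<delta>}. (\<lambda>t. \<phi> t + h *\<^sub>R \<psi> t) \<in> evol_domain)"

definition Evol_variation ::
  "(real \<Rightarrow> ('g, 'e) tangent) \<Rightarrow> (real \<Rightarrow> ('g, 'e) tangent) \<Rightarrow> real \<Rightarrow> real \<Rightarrow> 'g"
  where "Evol_variation \<phi> \<psi> h t = inv (Evol \<phi> t) \<otimes> Evol (\<lambda>s. \<phi> s + h *\<^sub>R \<psi> s) t"

definition regular_pair ::
  "('e \<Rightarrow> 'f::{locally_convex_space, complete_uniform_space}) \<Rightarrow> ('g, 'e) chart \<Rightarrow>
    (real \<Rightarrow> ('g, 'e) tangent) \<Rightarrow> (real \<Rightarrow> ('g, 'e) tangent) \<Rightarrow> bool"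
  where "regular_pair \<iota> c \<phi> \<psi> \<longleftrightarrow> admissible \<phi> \<psi> \<and>
    (\<forall>\<^sub>F h in at 0. \<forall>t\<in>{0..1}. Evol_variation \<phi> \<psi> h t \<in> fst c) \<and>
    uniform_limit_at_0 \<iota> (\<lambda>h t. snd c (Evol_variation \<phi> \<psi> h t)) (\<lambda>t. 0)"

end

end

theory Submission
  imports Defs
begin

text \<open>
  Let \<open>\<nu>\<^sub>h = Evol(\<phi>)\<^sup>-\<^sup>1 Evol(\<phi> + h\<psi>)\<close>, \<open>\<gamma>\<^sub>h = \<Xi> \<circ> \<nu>\<^sub>h\<close> and \<open>\<eta> = d\<^sub>e\<Xi> (Ad (Evol(\<phi>)\<^sup>-\<^sup>1) \<psi>)\<close>.  With \<open>\<mu> = Evol(\<phi>)\<close> and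
  \<open>\<mu>\<^sub>h = Evol(\<phi> + h\<psi>)\<close>, the identity
  \<open>\<nu>\<^sub>h(s) \<nu>\<^sub>h(t)\<^sup>-\<^sup>1 = \<mu>(t)\<^sup>-\<^sup>1 [\<mu>(s) \<mu>(t)\<^sup>-\<^sup>1]\<^sup>-\<^sup>1 [\<mu>\<^sub>h(s) \<mu>\<^sub>h(t)\<^sup>-\<^sup>1] \<mu>(t)\<close>
  gives \<open>\<gamma>\<^sub>h'(t) = h \<omega>(\<gamma>\<^sub>h(t), \<eta>(t))\<close>, where \<open>\<omega>(y, v)\<close> is the differential at the unit, in the direction
  \<open>v\<close>, of right multiplication by \<open>\<Xi>\<^sup>-\<^sup>1(y)\<close>; in particular \<open>\<omega>(0, v) = v\<close>.  If \<open>\<gamma>\<^sub>h \<rightarrow> 0\<close> uniformly, then by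
  continuity of \<open>\<omega>\<close> the derivative of \<open>\<gamma>\<^sub>h/h\<close> tends to \<open>\<eta>\<close> uniformly, so \<open>\<gamma>\<^sub>h/h\<close> tends to the integral of
  \<open>\<eta>\<close>; the converse holds because this integral is bounded.  The second part is the case \<open>t = 1\<close>, for the
  completion of \<open>E\<close> that \<open>\<kappa>\<close> induces on coordinates: a limit in the completion is a limit in \<open>E\<close> if
  and only if it lies in \<open>E\<close>.
\<close>

section \<open>Topological vector spaces\<close>

text \<open>Two obstacles shape the proof. First, \<open>E\<close> is neither normed nor complete,
  so there is neither a Frechet derivative nor an integral inside \<open>E\<close>. The fundamental
  theorem is avoided: \<open>\<gamma>\<^sub>h / h\<close> is compared directly with Riemann sums of
  \<open>\<eta>\<close>, one seminorm at a time, by a mean value inequality obtained from bisection.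
  One estimate serves twice: for a fixed small \<open>h\<close> it shows that the Riemann sums are
  Cauchy, so that the integral exists in the completion; under refinement of the divisions it then
  bounds the distance to that integral. Second, Bastiani derivatives are directional, whereas chain
  rules along curves need a direction that only converges. Strict differentiability lets base point
  and direction move together with the increment; it follows from \<open>C^1\<close> by the mean
  value inequality and is, together with continuity, all that is used of the smoothness of the group
  operations. In particular, the joint continuity of \<open>\<omega>\<close> and of Ad is recovered
  from strict derivatives at neighbouring points.\<close>

class topological_real_vector = real_vector + topological_ab_group_add +
  assumes tendsto_scaleR_nhds_prod:
    "((\<lambda>z. fst z *\<^sub>R snd z) \<longlongrightarrow> r *\<^sub>R x) (nhds r \<times>\<^sub>F nhds x)"

instance locally_convex_space \<subseteq> topological_real_vector
  by standard (rule tendsto_scaleR_nhds)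

instance prod :: (topological_monoid_add, topological_monoid_add) topological_monoid_add
proof
  fix a b :: "'a \<times> 'b"
  show "((\<lambda>x. fst x + snd x) \<longlongrightarrow> a + b) (nhds a \<times>\<^sub>F nhds b)"
    unfolding plus_prod_def
    by (intro tendsto_Pair tendsto_add tendsto_fst tendsto_snd filterlim_fst filterlim_snd)
qed

instance prod :: (topological_group_add, topological_group_add) topological_group_add
proof
  fix a :: "'a \<times> 'b"
  show "(uminus \<longlongrightarrow> - a) (nhds a)"
    unfolding uminus_prod_def
    by (intro tendsto_Pair tendsto_minus tendsto_fst tendsto_snd filterlim_ident)
qed

instance prod :: (topological_ab_group_add, topological_ab_group_add) topological_ab_group_add ..

lemma tendsto_scaleR_tvs:
  fixes g :: "_ \<Rightarrow> 'a::topological_real_vector"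
  assumes "(f \<longlongrightarrow> r) F" "(g \<longlongrightarrow> x) F"
  shows "((\<lambda>t. f t *\<^sub>R g t) \<longlongrightarrow> r *\<^sub>R x) F"
  using filterlim_compose[OF tendsto_scaleR_nhds_prod filterlim_Pair[OF assms]] by simp

text \<open>The class is made for products such as \<open>E \<times> E\<close>, which model
  \<open>G \<times> G\<close>. It retains from \<open>locally_convex_space\<close> the continuity of
  the vector operations, which suffices for the source of a differentiable map, while seminorm
  estimates take place in the target.\<close>

instance prod :: (topological_real_vector, topological_real_vector) topological_real_vector
proof
  fix r and x :: "'a \<times> 'b"
  show "((\<lambda>z. fst z *\<^sub>R snd z) \<longlongrightarrow> r *\<^sub>R x) (nhds r \<times>\<^sub>F nhds x)"
    unfolding scaleR_prod_def
    by (intro tendsto_Pair tendsto_scaleR_tvs tendsto_fst tendsto_snd filterlim_fst filterlim_snd)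
qed

lemma continuous_on_scaleR_tvs:
  fixes g :: "_ \<Rightarrow> 'a::topological_real_vector"
  assumes "continuous_on S f" "continuous_on S g"
  shows "continuous_on S (\<lambda>t. f t *\<^sub>R g t)"
  using assms by (auto simp: continuous_on_def intro: tendsto_scaleR_tvs)

text \<open>Regularity, used later to keep limits of difference quotients inside an open set. If
  \<open>y\<close> is in the closure of \<open>V = x + A\<close>, then some \<open>z\<close> in
  \<open>V\<close> is close to \<open>y\<close>, and \<open>y = x + (z - x) - (z - y)\<close> is
  \<open>x\<close> plus a difference of two small elements.\<close>

lemma topological_group_closed_neighbourhood:
  fixes x :: "'a::topological_ab_group_add"
  assumes "open W" "x \<in> W"
  obtains V where "open V" "x \<in> V" "closure V \<subseteq> W"
proof -
  have "((\<lambda>z. x + fst z - snd z) \<longlongrightarrow> x) (nhds 0 \<times>\<^sub>F nhds 0)"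
    using tendsto_diff[OF tendsto_add[OF tendsto_const[of x] filterlim_fst] filterlim_snd, of 0 0]
    by simp
  then have "\<forall>\<^sub>F z in nhds 0 \<times>\<^sub>F nhds 0. x + fst z - snd z \<in> W"
    using assms by (auto simp: tendsto_def)
  then obtain P Q where PQ: "\<forall>\<^sub>F a in nhds (0::'a). P a" "\<forall>\<^sub>F b in nhds (0::'a). Q b"
    "\<And>a b. P a \<Longrightarrow> Q b \<Longrightarrow> x + a - b \<in> W"
    by (auto simp: eventually_prod_filter)
  then obtain A B where A: "open A" "0 \<in> A" "\<And>a. a \<in> A \<Longrightarrow> P a"
    and B: "open B" "0 \<in> B" "\<And>a. a \<in> B \<Longrightarrow> Q a"
    by (auto simp: eventually_nhds)
  define V where "V = (\<lambda>y. y - x) -` A"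
  have oV: "open V"
    unfolding V_def by (intro open_vimage A(1) continuous_intros)
  have "y \<in> W" if y: "y \<in> closure V" for y
  proof -
    define N where "N = (\<lambda>z. z - y) -` B"
    have "open N"
      unfolding N_def by (intro open_vimage B(1) continuous_intros)
    moreover have "y \<in> N" using B by (simp add: N_def)
    ultimately have "N \<inter> V \<noteq> {}" using y by (auto simp: closure_iff_nhds_not_empty)
    then obtain z where "z - y \<in> B" "z - x \<in> A" by (auto simp: N_def V_def)
    then have "x + (z - x) - (z - y) \<in> W" using PQ(3) A(3) B(3) by blast
    then show "y \<in> W" by simp
  qed
  then show thesis using that[of V] oV A by (auto simp: V_def)
qed


section \<open>Continuous seminorms\<close>

lemma seminormD:
  assumes "continuous_seminorm p"
  shows seminorm_triangle: "p (x + y) \<le> p x + p y"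
    and seminorm_scaleR: "p (r *\<^sub>R x) = \<bar>r\<bar> * p x"
    and seminorm_continuous: "continuous_on UNIV p"
  using assms by (auto simp: continuous_seminorm_def)

lemma seminorm_0: "continuous_seminorm p \<Longrightarrow> p 0 = 0"
  using seminorm_scaleR[of p 0 0] by simp

lemma seminorm_minus: "continuous_seminorm p \<Longrightarrow> p (- x) = p x"
  using seminorm_scaleR[of p "-1" x] by simp

lemma seminorm_minus_commute: "continuous_seminorm p \<Longrightarrow> p (x - y) = p (y - x)"
  using seminorm_minus[of p "x - y"] by simp

lemma seminorm_nonneg: "continuous_seminorm p \<Longrightarrow> 0 \<le> p x"
  using seminorm_triangle[of p x "- x"] by (simp add: seminorm_0 seminorm_minus)

lemma seminorm_diff_triangle:
  "continuous_seminorm p \<Longrightarrow> p (x - z) \<le> p (x - y) + p (y - z)"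
  using seminorm_triangle[of p "x - y" "y - z"] by simp

lemma seminorm_diff_le: "continuous_seminorm p \<Longrightarrow> p (x - y) \<le> p x + p y"
  using seminorm_triangle[of p x "- y"] by (simp add: seminorm_minus)

lemma seminorm_sum:
  "continuous_seminorm p \<Longrightarrow> p (sum f A) \<le> (\<Sum>x\<in>A. p (f x))"
  by (induction A rule: infinite_finite_induct)
     (auto simp: seminorm_0 intro: order_trans[OF seminorm_triangle])

lemma seminorm_tendsto:
  assumes "continuous_seminorm p" "(f \<longlongrightarrow> l) F"
  shows "((\<lambda>x. p (f x)) \<longlongrightarrow> p l) F"
  using continuous_on_tendsto_compose[OF seminorm_continuous[OF assms(1)] assms(2)] by simp

lemma seminorm_tendsto_diff_less:
  fixes f :: "'b \<Rightarrow> 'a::topological_real_vector"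
  assumes "continuous_seminorm p" "(f \<longlongrightarrow> l) F" "e > 0"
  shows "\<forall>\<^sub>F x in F. p (f x - l) < e"
proof -
  have "((\<lambda>x. p (f x - l)) \<longlongrightarrow> p (l - l)) F"
    by (rule seminorm_tendsto[OF assms(1) tendsto_diff[OF assms(2) tendsto_const]])
  then show ?thesis
    using assms by (simp add: seminorm_0 order_tendstoD)
qed

text \<open>Smallness near the origin suffices, by translation and the reverse triangle
  inequality.\<close>

lemma continuous_seminormI:
  fixes p :: "'a::topological_real_vector \<Rightarrow> real"
  assumes "\<And>x y. p (x + y) \<le> p x + p y" "\<And>r x. p (r *\<^sub>R x) = \<bar>r\<bar> * p x"
    and nbhd: "\<And>e. e > 0 \<Longrightarrow> \<forall>\<^sub>F x in nhds 0. p x < e"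
  shows "continuous_seminorm p"
proof -
  have neg: "p (- x) = p x" for x using assms(2)[of "-1" x] by simp
  have "(p \<longlongrightarrow> p x) (nhds x)" for x
  proof (rule tendstoI)
    fix e :: real assume "e > 0"
    have "((\<lambda>y. y - x) \<longlongrightarrow> x - x) (nhds x)"
      by (intro tendsto_intros filterlim_ident)
    then have "\<forall>\<^sub>F y in nhds x. p (y - x) < e"
      using eventually_compose_filterlim[OF nbhd[OF \<open>e > 0\<close>]] by simp
    then show "\<forall>\<^sub>F y in nhds x. dist (p y) (p x) < e"
    proof eventually_elim
      case (elim y)
      then show ?case
        using assms(1)[of "y - x" x] assms(1)[of "x - y" y] neg[of "y - x"]
        by (simp add: dist_real_def)
    qed
  qed
  then have "continuous_on UNIV p"
    by (simp add: continuous_on_def tendsto_at_iff_tendsto_nhds)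
  then show ?thesis using assms by (simp add: continuous_seminorm_def)
qed

text \<open>The Minkowski functional of a symmetric convex neighbourhood.\<close>

lemma seminorm_below_neighbourhood:
  fixes U :: "'a::locally_convex_space set"
  assumes "open U" "0 \<in> U"
  obtains p where "continuous_seminorm p" "\<And>x. p x < 1 \<Longrightarrow> x \<in> U"
proof -
  from locally_convex[OF assms] obtain V where V: "open V" "0 \<in> V" "V \<subseteq> U" "convex V"
    by (auto simp: convex_def)
  \<comment> \<open>Symmetrising makes the gauge invariant under change of sign, which absolute
    homogeneity requires.\<close>
  define W where "W = V \<inter> uminus ` V"
  have W': "W = V \<inter> uminus -` V" by (force simp: W_def image_iff)
  have "open W"
    unfolding W' by (intro open_Int V open_vimage continuous_intros)
  have W0: "0 \<in> W" using V by (auto simp: W')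
  have "W \<subseteq> U" using V by (auto simp: W')
  have "convex W"
    unfolding W_def using V(4) by (intro convex_Int convex_negations)
  have Wneg: "x \<in> W \<longleftrightarrow> - x \<in> W" for x by (auto simp: W')
  define R where "R x = {r. r > 0 \<and> inverse r *\<^sub>R x \<in> W}" for x
  define p where "p x = Inf (R x)" for x
  have R_ne: "R x \<noteq> {}" for x
  proof -
    have "((\<lambda>t. t *\<^sub>R x) \<longlongrightarrow> 0 *\<^sub>R x) (at_right 0)"
      by (intro tendsto_scaleR_tvs tendsto_const) (simp add: filterlim_def at_le at_within_le_nhds)
    then have "\<forall>\<^sub>F t in at_right 0. t *\<^sub>R x \<in> W"
      using \<open>open W\<close> W0 by (auto simp: tendsto_def)
    then have "\<forall>\<^sub>F t in at_right 0. t *\<^sub>R x \<in> W \<and> t > (0::real)"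
      by (intro eventually_conj eventually_at_right_less)
    then obtain t where "t *\<^sub>R x \<in> W" "t > 0"
      using eventually_happens trivial_limit_at_right_real by blast
    then have "inverse t \<in> R x" by (auto simp: R_def)
    then show ?thesis by auto
  qed
  have R_bdd: "bdd_below (R x)" for x by (rule bdd_belowI[of _ 0]) (auto simp: R_def)
  have p_nonneg: "0 \<le> p x" for x
    unfolding p_def by (intro cInf_greatest R_ne) (auto simp: R_def)
  have p_le: "p x \<le> r" if "r \<in> R x" for r x
    unfolding p_def by (intro cInf_lower that R_bdd)
  have star: "t *\<^sub>R x \<in> W" if "x \<in> W" "0 \<le> t" "t \<le> 1" for x t
    using \<open>convex W\<close> W0 that convexD_alt[of W 0 x t] by simp
  \<comment> \<open>\<open>R x\<close> is an upper set because \<open>W\<close> is star-shaped about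
    0: rescaling by \<open>r / s < 1\<close> stays in \<open>W\<close>.\<close>
  have R_up: "s \<in> R x" if "p x < s" for s x
  proof -
    have "\<exists>r\<in>R x. r < s"
      using that cInf_lessD[OF R_ne] by (auto simp: p_def)
    then obtain r where r: "r \<in> R x" "r < s" by auto
    then have "(r / s) *\<^sub>R (inverse r *\<^sub>R x) \<in> W"
      by (intro star[of "inverse r *\<^sub>R x" "r / s"]) (auto simp: R_def)
    moreover have "(r / s) *\<^sub>R (inverse r *\<^sub>R x) = inverse s *\<^sub>R x"
      using r by (simp add: R_def field_simps)
    ultimately show ?thesis using r by (auto simp: R_def)
  qed
  have tri: "p (x + y) \<le> p x + p y" for x y
  proof (rule field_le_epsilon)
    fix e :: real assume "e > 0"
    define r s where "r = p x + e / 2" and "s = p y + e / 2"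
    have r: "r \<in> R x" "s \<in> R y" using \<open>e > 0\<close> by (auto intro!: R_up simp: r_def s_def)
    have rs: "r > 0" "s > 0" using r by (auto simp: R_def)
    \<comment> \<open>With these weights the convex combination of \<open>x / r\<close> and
      \<open>y / s\<close> becomes \<open>(x + y) / (r + s)\<close>.\<close>
    have "(r / (r + s)) *\<^sub>R (inverse r *\<^sub>R x) + (s / (r + s)) *\<^sub>R (inverse s *\<^sub>R y) \<in> W"
      using r rs by (intro convexD[OF \<open>convex W\<close>])
        (auto simp: R_def simp flip: add_divide_distrib)
    moreover have "(r / (r + s)) *\<^sub>R (inverse r *\<^sub>R x) + (s / (r + s)) *\<^sub>R (inverse s *\<^sub>R y)
      = inverse (r + s) *\<^sub>R (x + y)"
      using rs by (simp add: scaleR_add_right field_simps)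
    ultimately have "r + s \<in> R (x + y)" using rs by (simp add: R_def)
    from p_le[OF this] show "p (x + y) \<le> p x + p y + e" by (simp add: r_def s_def)
  qed
  have p0: "p 0 = 0"
  proof (rule antisym[OF field_le_epsilon p_nonneg])
    fix e :: real assume "e > 0"
    then show "p 0 \<le> 0 + e" using W0 by (intro order_trans[OF p_le[of e]]) (auto simp: R_def)
  qed
  have hom_le: "p (r *\<^sub>R x) \<le> \<bar>r\<bar> * p x" if "r \<noteq> 0" for r x
  proof (rule field_le_epsilon)
    fix e :: real assume "e > 0"
    define s where "s = p x + e / \<bar>r\<bar>"
    have s: "s \<in> R x" using \<open>e > 0\<close> that by (intro R_up) (simp add: s_def)
    then have s0: "s > 0" by (simp add: R_def)
    have "inverse (\<bar>r\<bar> * s) *\<^sub>R (r *\<^sub>R x) = sgn r *\<^sub>R (inverse s *\<^sub>R x)"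
      using that s0 by (cases "r > 0") (auto simp: sgn_if abs_if)
    moreover have "sgn r *\<^sub>R (inverse s *\<^sub>R x) \<in> W"
      using s Wneg[of "inverse s *\<^sub>R x"] that by (auto simp: sgn_if R_def)
    ultimately have "inverse (\<bar>r\<bar> * s) *\<^sub>R (r *\<^sub>R x) \<in> W" by (simp only:)
    then have "\<bar>r\<bar> * s \<in> R (r *\<^sub>R x)"
      unfolding R_def using s0 that by (intro CollectI conjI) simp
    from p_le[OF this] show "p (r *\<^sub>R x) \<le> \<bar>r\<bar> * p x + e"
      using that by (simp add: s_def distrib_left)
  qed
  have hom: "p (r *\<^sub>R x) = \<bar>r\<bar> * p x" for r x
  proof (cases "r = 0")
    case False
    have "p x \<le> \<bar>inverse r\<bar> * p (r *\<^sub>R x)" using hom_le[of "inverse r" "r *\<^sub>R x"] False by simp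
    then show ?thesis using hom_le[OF False, of x] False by (simp add: field_simps abs_inverse)
  qed (simp add: p0)
  have "continuous_seminorm p"
  proof (rule continuous_seminormI[OF tri hom])
    fix e :: real assume "e > 0"
    define s where "s = e / 2"
    have s: "s > 0" "s < e" using \<open>e > 0\<close> by (auto simp: s_def)
    have "((\<lambda>x. inverse s *\<^sub>R x) \<longlongrightarrow> inverse s *\<^sub>R 0) (nhds (0::'a))"
      by (intro tendsto_scaleR_tvs tendsto_const filterlim_ident)
    then have "\<forall>\<^sub>F x in nhds 0. inverse s *\<^sub>R x \<in> W"
      using \<open>open W\<close> W0 by (auto simp: tendsto_def)
    then show "\<forall>\<^sub>F x in nhds 0. p x < e"
    proof eventually_elim
      case (elim x)
      then have "s \<in> R x" using s by (auto simp: R_def)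
      from p_le[OF this] s show ?case by simp
    qed
  qed
  moreover have "x \<in> U" if "p x < 1" for x
    using R_up[OF that] \<open>W \<subseteq> U\<close> by (auto simp: R_def)
  ultimately show thesis using that by blast
qed

lemma tendsto_seminormI:
  fixes f :: "'b \<Rightarrow> 'a::locally_convex_space"
  assumes "\<And>p e. continuous_seminorm p \<Longrightarrow> e > 0 \<Longrightarrow> \<forall>\<^sub>F x in F. p (f x - l) \<le> e"
  shows "(f \<longlongrightarrow> l) F"
proof (rule topological_tendstoI)
  fix S assume S: "open S" "l \<in> S"
  define U where "U = (\<lambda>x. x + l) -` S"
  have "open U" unfolding U_def by (intro open_vimage S continuous_intros)
  moreover have "0 \<in> U" using S by (simp add: U_def)
  ultimately obtain p where p: "continuous_seminorm p" "\<And>x. p x < 1 \<Longrightarrow> x \<in> U"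
    using seminorm_below_neighbourhood by blast
  have "\<forall>\<^sub>F x in F. p (f x - l) \<le> 1 / 2" by (rule assms[OF p(1)]) simp
  then show "\<forall>\<^sub>F x in F. f x \<in> S"
  proof eventually_elim
    case (elim x)
    then have "f x - l \<in> U" by (intro p) simp
    then show ?case by (simp add: U_def)
  qed
qed

text \<open>Uniform continuity of addition splits an entourage \<open>Q\<close> into
  \<open>P1\<close> and \<open>P2\<close>: the pair \<open>(f x, f y)\<close> is the sum of
  \<open>(f x - f y, 0)\<close>, controlled by a seminorm, and the diagonal pair
  \<open>(f y, f y)\<close>, which lies in every entourage.\<close>

lemma cauchy_filter_seminormI:
  fixes f :: "'b \<Rightarrow> 'a::locally_convex_space"
  assumes "\<And>p e. continuous_seminorm p \<Longrightarrow> e > 0 \<Longrightarrow>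
    \<exists>P. eventually P F \<and> (\<forall>x y. P x \<longrightarrow> P y \<longrightarrow> p (f x - f y) \<le> e)"
  shows "cauchy_filter (filtermap f F)"
  unfolding cauchy_filter_def
proof (rule filter_leI)
  fix Q :: "'a \<times> 'a \<Rightarrow> bool" assume Q: "eventually Q uniformity"
  then have "\<forall>\<^sub>F ((a, b), (c, d)) in uniformity \<times>\<^sub>F uniformity. Q (a + c, b + d)"
    using uniformly_continuous_add'[where 'a = 'a] by (auto simp: filterlim_iff case_prod_unfold)
  then obtain P1 P2 where P: "eventually P1 uniformity" "eventually P2 uniformity"
    "\<And>a b c d. P1 (a, b) \<Longrightarrow> P2 (c, d) \<Longrightarrow> Q (a + c, b + d)"
    unfolding eventually_prod_filter by (auto simp: case_prod_unfold)
  \<comment> \<open>The section of \<open>P1\<close> over 0 has to become a neighbourhood of 0.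
    \<open>eventually_nhds_uniformity\<close> fixes the first coordinate of a pair, so the pair is
    swapped first.\<close>
  have "\<forall>\<^sub>F (x', x) in uniformity. x = 0 \<longrightarrow> P1 (x', 0)"
    by (rule eventually_mono[OF P(1)]) auto
  then have "\<forall>\<^sub>F (x', x) in uniformity. x' = 0 \<longrightarrow> P1 (x, 0)"
    by (drule_tac uniformity_sym) (simp add: case_prod_unfold)
  then have "\<forall>\<^sub>F u in nhds 0. P1 (u, 0)"
    by (simp add: eventually_nhds_uniformity)
  then obtain V where V: "open V" "0 \<in> V" "\<And>u. u \<in> V \<Longrightarrow> P1 (u, 0)"
    by (auto simp: eventually_nhds)
  obtain p where p: "continuous_seminorm p" "\<And>x. p x < 1 \<Longrightarrow> x \<in> V"
    using seminorm_below_neighbourhood V by blast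
  obtain R where R: "eventually R F" "\<And>x y. R x \<Longrightarrow> R y \<Longrightarrow> p (f x - f y) \<le> 1 / 2"
    using assms[OF p(1), of "1 / 2"] by auto
  have "Q (f x, f y)" if "R x" "R y" for x y
  proof -
    have "P1 (f x - f y, 0)" using R(2)[OF that] by (intro V p) simp
    moreover have "P2 (f y, f y)" using P(2) by (rule uniformity_refl)
    ultimately have "Q (f x - f y + f y, 0 + f y)" by (rule P(3))
    then show ?thesis by simp
  qed
  then have "Q (u, v)" if "\<exists>x. R x \<and> u = f x" "\<exists>x. R x \<and> v = f x" for u v
    using that by blast
  moreover have "\<forall>\<^sub>F u in filtermap f F. \<exists>x. R x \<and> u = f x"
    unfolding eventually_filtermap by (rule eventually_mono[OF R(1)]) blast
  ultimately show "eventually Q (filtermap f F \<times>\<^sub>F filtermap f F)"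
    unfolding eventually_prod_filter by blast
qed

text \<open>Bisection takes the place of the Hahn-Banach theorem: the estimate is additive over
  adjacent intervals, and it holds on short intervals around \<open>t\<close> because the derivative
  at \<open>t\<close> is bounded. A derivative at each point is enough, one-sided at the
  ends.\<close>

lemma seminorm_mean_value:
  fixes f :: "real \<Rightarrow> 'a::topological_real_vector"
  assumes p: "continuous_seminorm p" and "a \<le> b"
    and deriv: "\<And>t. t \<in> {a..b} \<Longrightarrow>
      \<exists>d. ((\<lambda>s. (1 / (s - t)) *\<^sub>R (f s - f t)) \<longlongrightarrow> d) (at t within {a..b}) \<and> p d \<le> C"
  shows "p (f b - f a) \<le> C * (b - a)"
proof (rule field_le_epsilon)
  fix e :: real assume "e > 0"
  \<comment> \<open>The slack \<open>C' > C\<close> makes the bound on the derivative strict, so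
    that it passes to nearby difference quotients; the summand 1 keeps the denominator positive when
    \<open>a = b\<close>.\<close>
  define C' where "C' = C + e / (b - a + 1)"
  have C': "C < C'" using \<open>e > 0\<close> \<open>a \<le> b\<close> by (simp add: C'_def)
  have "a \<le> a \<longrightarrow> b \<le> b \<longrightarrow> p (f b - f a) \<le> C' * (b - a)"
    using \<open>a \<le> b\<close>
  \<comment> \<open>The guards are there because bisection also tests intervals around
    \<open>t\<close> that leave \<open>{a..b}\<close>.\<close>
  proof (induct rule: Bolzano[where P = "\<lambda>u v. a \<le> u \<longrightarrow> v \<le> b \<longrightarrow> p (f v - f u) \<le> C' * (v - u)"])
    case (trans u v w)
    then show ?case
      using seminorm_diff_triangle[OF p, of "f w" "f u" "f v"] by (auto simp: algebra_simps)
  next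
    case (local t)
    then obtain d where d: "((\<lambda>s. (1 / (s - t)) *\<^sub>R (f s - f t)) \<longlongrightarrow> d) (at t within {a..b})" "p d \<le> C"
      using deriv[of t] by auto
    have "\<forall>\<^sub>F s in at t within {a..b}. p ((1 / (s - t)) *\<^sub>R (f s - f t)) < C'"
      using order_tendstoD(2)[OF seminorm_tendsto[OF p d(1)]] d(2) C' by simp
    then obtain r where r: "r > 0"
      "\<And>s. s \<in> {a..b} \<Longrightarrow> s \<noteq> t \<Longrightarrow> dist s t < r \<Longrightarrow> p ((1 / (s - t)) *\<^sub>R (f s - f t)) < C'"
      by (auto simp: eventually_at)
    have *: "p (f s - f t) \<le> C' * \<bar>s - t\<bar>" if "s \<in> {a..b}" "\<bar>s - t\<bar> < r" for s
    proof (cases "s = t")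
      case False
      have "p (f s - f t) = \<bar>s - t\<bar> * p ((1 / (s - t)) *\<^sub>R (f s - f t))"
        using False by (simp add: seminorm_scaleR[OF p])
      also have "\<dots> \<le> \<bar>s - t\<bar> * C'"
        using r(2)[OF that(1) False] that(2) by (intro mult_left_mono) (auto simp: dist_real_def)
      finally show ?thesis by (simp add: mult.commute)
    qed (simp add: seminorm_0[OF p])
    \<comment> \<open>Splitting at \<open>t\<close> loses nothing because \<open>t\<close> lies
      between \<open>u\<close> and \<open>v\<close>: the two lengths add up to
      \<open>v - u\<close>.\<close>
    have "p (f v - f u) \<le> C' * (v - u)" if "u \<le> t" "t \<le> v" "v - u < r" "a \<le> u" "v \<le> b" for u v
    proof -
      have "p (f v - f u) \<le> p (f v - f t) + p (f u - f t)"
        using seminorm_diff_triangle[OF p, of "f v" "f u" "f t"]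
        by (simp add: seminorm_minus_commute[OF p, of "f t" "f u"])
      also have "\<dots> \<le> C' * \<bar>v - t\<bar> + C' * \<bar>u - t\<bar>"
        using that by (intro add_mono *) auto
      also have "\<dots> = C' * (v - u)" using that by (simp add: algebra_simps)
      finally show ?thesis .
    qed
    then show ?case using r(1) by blast
  qed
  then have "p (f b - f a) \<le> C' * (b - a)" by simp
  also have "\<dots> = C * (b - a) + e * ((b - a) / (b - a + 1))"
    by (simp add: C'_def distrib_right)
  also have "\<dots> \<le> C * (b - a) + e * 1"
    using \<open>a \<le> b\<close> \<open>e > 0\<close> by (intro add_left_mono mult_left_mono) auto
  finally show "p (f b - f a) \<le> C * (b - a) + e" by simp
qed


section \<open>Completions\<close>

lemma is_completionD:
  assumes "is_completion UNIV \<iota>"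
  shows completion_add: "\<iota> (x + y) = \<iota> x + \<iota> y"
    and completion_scaleR: "\<iota> (r *\<^sub>R x) = r *\<^sub>R \<iota> x"
    and completion_continuous: "continuous_on UNIV \<iota>"
    and completion_dense: "closure (range \<iota>) = UNIV"
    and completion_homeomorphism: "homeomorphism UNIV (range \<iota>) \<iota> (inv_into UNIV \<iota>)"
  using assms by (auto simp: is_completion_def homeomorphism_def)

lemma completion_inj:
  assumes "is_completion UNIV \<iota>"
  shows "inj \<iota>"
  by (rule inj_on_inverseI) (rule homeomorphism_apply1[OF completion_homeomorphism[OF assms]])

lemma completion_minus:
  assumes "is_completion UNIV \<iota>"
  shows "\<iota> (- x) = - \<iota> x"
  using completion_scaleR[OF assms, of "-1" x] by simp

lemma completion_diff:
  assumes "is_completion UNIV \<iota>"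
  shows "\<iota> (x - y) = \<iota> x - \<iota> y"
  using completion_add[OF assms, of x "- y"] by (simp add: completion_minus[OF assms])

lemma completion_0:
  assumes "is_completion UNIV \<iota>"
  shows "\<iota> 0 = 0"
  using completion_scaleR[OF assms, of 0 0] by simp

lemma completion_sum:
  assumes "is_completion UNIV \<iota>"
  shows "\<iota> (sum f A) = (\<Sum>x\<in>A. \<iota> (f x))"
  by (induction A rule: infinite_finite_induct)
     (auto simp: completion_0[OF assms] completion_add[OF assms])

lemma completion_tendsto:
  assumes "is_completion UNIV \<iota>" "(f \<longlongrightarrow> l) F"
  shows "((\<lambda>x. \<iota> (f x)) \<longlongrightarrow> \<iota> l) F"
  using continuous_on_tendsto_compose[OF completion_continuous[OF assms(1)] assms(2)] by simp

text \<open>Values and limit lie in the range of \<open>\<iota>\<close>, on which its inverse is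
  continuous.\<close>

lemma completion_tendsto_cancel:
  assumes "is_completion UNIV \<iota>" "((\<lambda>x. \<iota> (f x)) \<longlongrightarrow> \<iota> l) F"
  shows "(f \<longlongrightarrow> l) F"
proof -
  note h = completion_homeomorphism[OF assms(1)]
  have "((\<lambda>x. inv_into UNIV \<iota> (\<iota> (f x))) \<longlongrightarrow> inv_into UNIV \<iota> (\<iota> l)) F"
    by (rule continuous_on_tendsto_compose[OF homeomorphism_cont2[OF h] assms(2)]) auto
  then show ?thesis by (simp add: completion_inj[OF assms(1)])
qed

lemma seminorm_comp_completion:
  fixes \<iota> :: "'a::{real_vector,topological_space} \<Rightarrow> 'b::{locally_convex_space, complete_uniform_space}"
  assumes \<iota>: "is_completion UNIV \<iota>" and q: "continuous_seminorm q"
  shows "continuous_seminorm (\<lambda>x. q (\<iota> x))"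
  unfolding continuous_seminorm_def
proof (intro conjI allI)
  show "continuous_on UNIV (\<lambda>x. q (\<iota> x))"
    by (rule continuous_on_compose2[OF seminorm_continuous[OF q] completion_continuous[OF \<iota>]]) simp
qed (simp_all add: completion_add[OF \<iota>] completion_scaleR[OF \<iota>] seminorm_triangle[OF q] seminorm_scaleR[OF q])

text \<open>\<open>E\<close> has the topology induced by \<open>\<iota>\<close>, so the open unit
  ball of \<open>p\<close> is the trace of an open set, which contains the unit ball of a seminorm
  on the completion. Homogeneity turns the inclusion of balls into an inequality.\<close>

lemma seminorm_le_completion:
  fixes \<iota> :: "'a::locally_convex_space \<Rightarrow> 'b::{locally_convex_space, complete_uniform_space}"
  assumes \<iota>: "is_completion UNIV \<iota>" and p: "continuous_seminorm p"
  obtains q where "continuous_seminorm q" "\<And>x. p x \<le> q (\<iota> x)"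
proof -
  note h = completion_homeomorphism[OF \<iota>]
  have "open (p -` {..<1})"
    by (intro open_vimage seminorm_continuous[OF p]) auto
  then have "openin (top_of_set UNIV) (p -` {..<1})" by simp
  then have "openin (top_of_set (range \<iota>)) (\<iota> ` (p -` {..<1}))"
    using homeomorphism_imp_open_map[OF h] by blast
  then obtain W where W: "open W" "\<iota> ` (p -` {..<1}) = range \<iota> \<inter> W"
    by (auto simp: openin_open)
  have "\<iota> 0 \<in> \<iota> ` (p -` {..<1})" by (simp add: seminorm_0[OF p])
  then have "0 \<in> W" using W by (simp add: completion_0[OF \<iota>])
  then obtain q where q: "continuous_seminorm q" "\<And>x. q x < 1 \<Longrightarrow> x \<in> W"
    using seminorm_below_neighbourhood W by blast
  have small: "p x < 1" if "q (\<iota> x) < 1" for x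
  proof -
    have "\<iota> x \<in> \<iota> ` (p -` {..<1})" using W(2) q(2)[OF that] by blast
    then show ?thesis using completion_inj[OF \<iota>] by (auto dest: injD)
  qed
  have "p x \<le> q (\<iota> x)" for x
  proof (rule ccontr)
    assume "\<not> p x \<le> q (\<iota> x)"
    then have less: "q (\<iota> x) < p x" by simp
    then have pos: "p x > 0" using seminorm_nonneg[OF q(1), of "\<iota> x"] by linarith
    have "q (\<iota> (inverse (p x) *\<^sub>R x)) < 1"
      using less pos by (simp add: completion_scaleR[OF \<iota>] seminorm_scaleR[OF q(1)] field_simps)
    then have "p (inverse (p x) *\<^sub>R x) < 1" by (rule small)
    then show False using pos by (simp add: seminorm_scaleR[OF p])
  qed
  then show thesis using that q by blast
qed

text \<open>If \<open>p \<le> q \<circ> \<iota>\<close>, then \<open>y \<mapsto> inf\<^sub>x (p x + q (y - \<iota> x))\<close> extends \<open>p\<close>.\<close>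

lemma seminorm_extension_exists:
  fixes \<iota> :: "'a::locally_convex_space \<Rightarrow> 'b::{locally_convex_space, complete_uniform_space}"
  assumes \<iota>: "is_completion UNIV \<iota>" and p: "continuous_seminorm p"
  obtains r where "continuous_seminorm r" "\<And>x. r (\<iota> x) = p x"
proof -
  obtain q where q: "continuous_seminorm q" "\<And>x. p x \<le> q (\<iota> x)"
    using seminorm_le_completion[OF \<iota> p] by blast
  define r where "r y = (INF x. p x + q (y - \<iota> x))" for y
  have bdd: "bdd_below (range (\<lambda>x. p x + q (y - \<iota> x)))" for y
    by (rule bdd_belowI2[of _ 0]) (simp add: seminorm_nonneg[OF p] seminorm_nonneg[OF q(1)])
  have le: "r y \<le> p x + q (y - \<iota> x)" for x y
    unfolding r_def by (rule cINF_lower[OF bdd]) simp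
  have appr: "\<exists>x. p x + q (y - \<iota> x) < r y + e" if "e > 0" for y e
    using cINF_less_iff[OF _ bdd, of y "r y + e"] that by (auto simp: r_def)
  \<comment> \<open>The choice \<open>x = 0\<close> bounds \<open>r\<close> by \<open>q\<close>,
    which later yields continuity.\<close>
  have r_q: "r y \<le> q y" for y
    using le[of y 0] by (simp add: completion_0[OF \<iota>] seminorm_0[OF p])
  have r_nonneg: "0 \<le> r y" for y
    unfolding r_def by (rule cINF_greatest) (simp_all add: seminorm_nonneg[OF p] seminorm_nonneg[OF q(1)])
  \<comment> \<open>Here \<open>p \<le> q \<circ> \<iota>\<close> enters: it gives \<open>p z \<le>
    p x + p (z - x) \<le> p x + q (\<iota> z - \<iota> x)\<close>.\<close>
  have r_ext: "r (\<iota> z) = p z" for z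
  proof (rule antisym)
    show "r (\<iota> z) \<le> p z" using le[of "\<iota> z" z] by (simp add: seminorm_0[OF q(1)])
    have "p z \<le> p x + q (\<iota> z - \<iota> x)" for x
      using seminorm_triangle[OF p, of x "z - x"] q(2)[of "z - x"] by (simp add: completion_diff[OF \<iota>])
    then show "p z \<le> r (\<iota> z)" unfolding r_def by (intro cINF_greatest) auto
  qed
  have tri: "r (y + z) \<le> r y + r z" for y z
  proof (rule field_le_epsilon)
    fix e :: real assume "e > 0"
    then obtain u v where u: "p u + q (y - \<iota> u) < r y + e / 2" and v: "p v + q (z - \<iota> v) < r z + e / 2"
      using appr[of "e / 2"] by (metis half_gt_zero)
    have "r (y + z) \<le> p (u + v) + q ((y + z) - \<iota> (u + v))" by (rule le)
    also have "\<dots> \<le> (p u + p v) + (q (y - \<iota> u) + q (z - \<iota> v))"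
      using seminorm_triangle[OF q(1), of "y - \<iota> u" "z - \<iota> v"]
      by (intro add_mono seminorm_triangle[OF p]) (simp add: completion_add[OF \<iota>] algebra_simps)
    finally show "r (y + z) \<le> r y + r z + e" using u v by simp
  qed
  have hom_le: "r (c *\<^sub>R y) \<le> \<bar>c\<bar> * r y" for c y
  proof (cases "c = 0")
    case True
    then show ?thesis using r_q[of 0] by (simp add: seminorm_0[OF q(1)])
  next
    case False
    show ?thesis
    proof (rule field_le_epsilon)
      fix e :: real assume "e > 0"
      then obtain x where x: "p x + q (y - \<iota> x) < r y + e / \<bar>c\<bar>"
        using appr[of "e / \<bar>c\<bar>"] False by auto
      have "r (c *\<^sub>R y) \<le> p (c *\<^sub>R x) + q (c *\<^sub>R y - \<iota> (c *\<^sub>R x))" by (rule le)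
      also have "\<dots> = \<bar>c\<bar> * (p x + q (y - \<iota> x))"
        by (simp add: completion_scaleR[OF \<iota>] seminorm_scaleR[OF p] seminorm_scaleR[OF q(1)]
            algebra_simps flip: scaleR_diff_right)
      also have "\<dots> \<le> \<bar>c\<bar> * (r y + e / \<bar>c\<bar>)" using x by (intro mult_left_mono) auto
      finally show "r (c *\<^sub>R y) \<le> \<bar>c\<bar> * r y + e" using False by (simp add: distrib_left)
    qed
  qed
  have hom: "r (c *\<^sub>R y) = \<bar>c\<bar> * r y" for c y
  proof (cases "c = 0")
    case True
    then show ?thesis using hom_le[of 0 y] r_nonneg[of 0] by simp
  next
    case False
    have "r y \<le> \<bar>inverse c\<bar> * r (c *\<^sub>R y)" using hom_le[of "inverse c" "c *\<^sub>R y"] False by simp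
    then show ?thesis using hom_le[of c y] False by (simp add: field_simps abs_inverse)
  qed
  have "continuous_seminorm r"
  proof (rule continuous_seminormI[OF tri hom])
    fix e :: real assume "e > 0"
    then have "\<forall>\<^sub>F x in nhds 0. q x < e"
      using order_tendstoD(2)[OF seminorm_tendsto[OF q(1) filterlim_ident], of 0 e]
      by (simp add: seminorm_0[OF q(1)])
    then show "\<forall>\<^sub>F x in nhds 0. r x < e"
      by eventually_elim (rule le_less_trans[OF r_q])
  qed
  then show thesis using that r_ext by blast
qed

lemma completion_continuous_unique:
  fixes q r :: "'b::{locally_convex_space, complete_uniform_space} \<Rightarrow> 'c::t2_space"
  assumes \<iota>: "is_completion UNIV \<iota>" and "continuous_on UNIV q" "continuous_on UNIV r"
    and "\<And>x. q (\<iota> x) = r (\<iota> x)"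
  shows "q = r"
proof -
  have "closed {y. q y = r y}" using assms(2,3) by (rule closed_Collect_eq)
  then have "closure (range \<iota>) \<subseteq> {y. q y = r y}"
    by (rule closure_minimal[rotated]) (auto simp: assms(4))
  then show ?thesis by (auto simp: completion_dense[OF \<iota>])
qed

lemma seminorm_extension_eqI:
  assumes \<iota>: "is_completion UNIV \<iota>" and "continuous_seminorm r" and "\<And>x. r (\<iota> x) = p x"
  shows "seminorm_extension \<iota> p = r"
  unfolding seminorm_extension_def
proof (rule the_equality)
  fix q assume "continuous_on UNIV q \<and> (\<forall>x. q (\<iota> x) = p x)"
  then show "q = r"
    using assms(3) by (intro completion_continuous_unique[OF \<iota>] seminorm_continuous[OF assms(2)]) auto
qed (use assms seminorm_continuous in auto)

lemma seminorm_extension: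
  fixes \<iota> :: "'a::locally_convex_space \<Rightarrow> 'b::{locally_convex_space, complete_uniform_space}"
  assumes \<iota>: "is_completion UNIV \<iota>" and p: "continuous_seminorm p"
  shows continuous_seminorm_extension: "continuous_seminorm (seminorm_extension \<iota> p)"
    and seminorm_extension_apply: "seminorm_extension \<iota> p (\<iota> x) = p x"
proof -
  obtain r where r: "continuous_seminorm r" "\<And>x. r (\<iota> x) = p x"
    using seminorm_extension_exists[OF \<iota> p] by blast
  with seminorm_extension_eqI[OF \<iota> r]
  show "continuous_seminorm (seminorm_extension \<iota> p)" "seminorm_extension \<iota> p (\<iota> x) = p x"
    by auto
qed

text \<open>Extension and restriction match the continuous seminorms of \<open>E\<close> with those
  of the completion, so testing with extensions amounts to testing with all continuous seminorms
  there.\<close>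

lemma uniform_limit_at_0_iff:
  fixes \<iota> :: "'a::locally_convex_space \<Rightarrow> 'b::{locally_convex_space, complete_uniform_space}"
  assumes \<iota>: "is_completion UNIV \<iota>"
  shows "uniform_limit_at_0 \<iota> \<alpha> \<beta> \<longleftrightarrow>
    (\<forall>q e. continuous_seminorm q \<longrightarrow> e > 0 \<longrightarrow>
      (\<forall>\<^sub>F h in at 0. \<forall>t\<in>{0..1}. q (\<iota> (\<alpha> h t) - \<beta> t) \<le> e))"
proof -
  have *: "((\<lambda>h. SUP t\<in>{0..1}. ennreal (q (\<iota> (\<alpha> h t) - \<beta> t))) \<longlongrightarrow> 0) (at 0) \<longleftrightarrow>
      (\<forall>e>0. \<forall>\<^sub>F h in at 0. \<forall>t\<in>{0..1}. q (\<iota> (\<alpha> h t) - \<beta> t) \<le> e)"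
    if q: "continuous_seminorm q" for q
  proof (intro iffI allI impI)
    fix e :: real
    assume lim: "((\<lambda>h. SUP t\<in>{0..1}. ennreal (q (\<iota> (\<alpha> h t) - \<beta> t))) \<longlongrightarrow> 0) (at 0)" and "e > 0"
    then have "\<forall>\<^sub>F h in at 0. (SUP t\<in>{0..1}. ennreal (q (\<iota> (\<alpha> h t) - \<beta> t))) < ennreal e"
      by (intro order_tendstoD(2)[OF lim]) simp
    then show "\<forall>\<^sub>F h in at 0. \<forall>t\<in>{0..1}. q (\<iota> (\<alpha> h t) - \<beta> t) \<le> e"
    proof eventually_elim
      case (elim h)
      show ?case
      proof
        fix t :: real assume "t \<in> {0..1}"
        then have "ennreal (q (\<iota> (\<alpha> h t) - \<beta> t)) < ennreal e"
          by (rule le_less_trans[OF SUP_upper elim])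
        then show "q (\<iota> (\<alpha> h t) - \<beta> t) \<le> e"
          using \<open>e > 0\<close> by (simp add: ennreal_less_iff seminorm_nonneg[OF q])
      qed
    qed
  next
    assume R: "\<forall>e>0. \<forall>\<^sub>F h in at 0. \<forall>t\<in>{0..1}. q (\<iota> (\<alpha> h t) - \<beta> t) \<le> e"
    show "((\<lambda>h. SUP t\<in>{0..1}. ennreal (q (\<iota> (\<alpha> h t) - \<beta> t))) \<longlongrightarrow> 0) (at 0)"
    proof (rule order_tendstoI)
      fix a :: ennreal assume "0 < a"
      \<comment> \<open>Going through \<open>b < a\<close> makes the level finite and leaves room
        for the strict inequality.\<close>
      then obtain b where b: "0 < b" "b < a" by (meson dense)
      then obtain e where e: "b = ennreal e" "e > 0" by (cases b) auto
      have "\<forall>\<^sub>F h in at 0. \<forall>t\<in>{0..1}. q (\<iota> (\<alpha> h t) - \<beta> t) \<le> e" using R e by blast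
      then show "\<forall>\<^sub>F h in at 0. (SUP t\<in>{0..1}. ennreal (q (\<iota> (\<alpha> h t) - \<beta> t))) < a"
      proof eventually_elim
        case (elim h)
        then have "(SUP t\<in>{0..1}. ennreal (q (\<iota> (\<alpha> h t) - \<beta> t))) \<le> ennreal e"
          by (intro SUP_least ennreal_leI) auto
        then show ?case using b e by simp
      qed
    qed simp
  qed
  show ?thesis
    unfolding uniform_limit_at_0_def
  proof (intro iffI allI impI)
    fix q :: "'b \<Rightarrow> real" and e :: real
    assume U: "\<forall>p. continuous_seminorm p \<longrightarrow>
      ((\<lambda>h. SUP t\<in>{0..1}. ennreal (seminorm_extension \<iota> p (\<iota> (\<alpha> h t) - \<beta> t))) \<longlongrightarrow> 0) (at 0)"
      and q: "continuous_seminorm q" and e: "0 < e"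
    have "seminorm_extension \<iota> (\<lambda>x. q (\<iota> x)) = q"
      by (rule seminorm_extension_eqI[OF \<iota> q]) simp
    then show "\<forall>\<^sub>F h in at 0. \<forall>t\<in>{0..1}. q (\<iota> (\<alpha> h t) - \<beta> t) \<le> e"
      using U[rule_format, OF seminorm_comp_completion[OF \<iota> q]] *[OF q] e by simp
  qed (use * continuous_seminorm_extension[OF \<iota>] in blast)
qed


section \<open>Riemann sums\<close>

lemma eventually_riemann_filter:
  "eventually P (riemann_filter a b) \<longleftrightarrow>
    (\<exists>d>0. \<forall>D. D tagged_division_of {a..b} \<and> (\<lambda>x. ball x d) fine D \<longrightarrow> P D)"
proof -
  have "\<exists>d\<in>{0<..}. {D. D tagged_division_of {a..b} \<and> (\<lambda>x. ball x d) fine D}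
      \<subseteq> {D. D tagged_division_of {a..b} \<and> (\<lambda>x. ball x d1) fine D} \<inter>
        {D. D tagged_division_of {a..b} \<and> (\<lambda>x. ball x d2) fine D}"
    if "d1 \<in> {0<..}" "d2 \<in> {0<..}" for d1 d2 :: real
  proof (intro bexI[of _ "min d1 d2"] subsetI)
    fix D assume D: "D \<in> {D. D tagged_division_of {a..b} \<and> (\<lambda>x. ball x (min d1 d2)) fine D}"
    have "ball x (min d1 d2) \<subseteq> ball x d1" "ball x (min d1 d2) \<subseteq> ball x d2" for x :: real
      by (auto simp: subset_ball)
    with D show "D \<in> {D. D tagged_division_of {a..b} \<and> (\<lambda>x. ball x d1) fine D} \<inter>
        {D. D tagged_division_of {a..b} \<and> (\<lambda>x. ball x d2) fine D}"
      unfolding fine_def by blast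
  qed (use that in auto)
  then show ?thesis
    unfolding riemann_filter_def
    by (subst eventually_INF_base) (auto simp: eventually_principal Bex_def)
qed

text \<open>Cousin's lemma: every gauge admits a fine tagged division.\<close>

lemma riemann_filter_not_bot: "riemann_filter a b \<noteq> bot"
proof
  assume "riemann_filter a b = bot"
  then have "eventually (\<lambda>_. False) (riemann_filter a b)" by simp
  then obtain d where "d > 0" "\<And>D. D tagged_division_of {a..b} \<Longrightarrow> \<not> (\<lambda>x. ball x d) fine D"
    by (auto simp: eventually_riemann_filter)
  then show False
    using fine_division_exists_real[of "\<lambda>x. ball x d" a b] gauge_ball by metis
qed

text \<open>Telescoping. It is applied to the curve, and to the identity, where it yields the total
  length of the division.\<close>

lemma sum_endpoints_tagged_division:
  fixes f :: "real \<Rightarrow> 'a::ab_group_add"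
  assumes "a \<le> b" and D: "D tagged_division_of {a..b}"
  shows "(\<Sum>(x, K)\<in>D. f (Sup K) - f (Inf K)) = f b - f a"
proof -
  \<comment> \<open>The empty box has no end points; the value 0 makes the assignment
    operative.\<close>
  let ?f = "\<lambda>K::real set. if K = {} then 0 else f (interval_upperbound K) - f (interval_lowerbound K)"
  interpret operative_real plus 0 ?f
    rewrites "comm_monoid_set.F (+) 0 = sum"
    by standard[1] (auto simp add: sum_def)
  have "f b - f a = (\<Sum>(x, l)\<in>D. if l = {} then 0 else f (interval_upperbound l) - f (interval_lowerbound l))"
    using tagged_division[OF D] \<open>a \<le> b\<close> by simp
  then show ?thesis
    using assms by (auto intro!: sum.cong)
qed

text \<open>On an interval with tag \<open>x\<close> the curve \<open>f\<close> is compared with the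
  affine curve of slope \<open>\<eta> x\<close>: their difference has derivative
  \<open>f' s - \<eta> x\<close>, to which the mean value inequality applies. The errors are
  \<open>e\<close> times the lengths and add up.\<close>

lemma riemann_sum_close:
  fixes f \<eta> :: "real \<Rightarrow> 'a::topological_real_vector"
  assumes p: "continuous_seminorm p" and "a \<le> b"
    and D: "D tagged_division_of {a..b}" "(\<lambda>x. ball x d) fine D"
    and deriv: "\<And>t. t \<in> {a..b} \<Longrightarrow> ((\<lambda>s. (1 / (s - t)) *\<^sub>R (f s - f t)) \<longlongrightarrow> f' t) (at t within {a..b})"
    and close: "\<And>s x. s \<in> {a..b} \<Longrightarrow> x \<in> {a..b} \<Longrightarrow> \<bar>s - x\<bar> < d \<Longrightarrow> p (f' s - \<eta> x) \<le> e"
  shows "p (f b - f a - (\<Sum>(x, K)\<in>D. measure lborel K *\<^sub>R \<eta> x)) \<le> e * (b - a)"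
proof -
  have est: "p ((f (Sup K) - f (Inf K)) - measure lborel K *\<^sub>R \<eta> x) \<le> e * (Sup K - Inf K)"
    if xK: "(x, K) \<in> D" for x K
  proof -
    have "\<exists>u v. K = cbox u v" and K: "x \<in> K" "K \<subseteq> {a..b}" "K \<subseteq> ball x d"
      using xK D by (auto simp: tagged_division_of fine_def)
    then obtain u v where uv: "K = {u..v}" by auto
    with K have "u \<le> v" by auto
    define g where "g s = f s - s *\<^sub>R \<eta> x" for s
    have "p (g v - g u) \<le> e * (v - u)"
    proof (rule seminorm_mean_value[OF p \<open>u \<le> v\<close>])
      fix t assume t: "t \<in> {u..v}"
      then have tab: "t \<in> {a..b}" using K uv by auto
      have "((\<lambda>s. (1 / (s - t)) *\<^sub>R (f s - f t) - \<eta> x) \<longlongrightarrow> f' t - \<eta> x) (at t within {u..v})"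
        using K uv by (intro tendsto_diff tendsto_const tendsto_within_subset[OF deriv[OF tab]]) auto
      then have "((\<lambda>s. (1 / (s - t)) *\<^sub>R (g s - g t)) \<longlongrightarrow> f' t - \<eta> x) (at t within {u..v})"
      proof (rule Lim_transform_eventually)
        have "(1 / (s - t)) *\<^sub>R (f s - f t) - \<eta> x = (1 / (s - t)) *\<^sub>R (g s - g t)" if "s \<noteq> t" for s
        proof -
          have "g s - g t = (f s - f t) - (s - t) *\<^sub>R \<eta> x" by (simp add: g_def algebra_simps)
          then show ?thesis using that by (simp add: scaleR_diff_right)
        qed
        then show "\<forall>\<^sub>F s in at t within {u..v}.
            (1 / (s - t)) *\<^sub>R (f s - f t) - \<eta> x = (1 / (s - t)) *\<^sub>R (g s - g t)"
          by (auto simp: eventually_at intro!: exI[of _ 1])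
      qed
      moreover have "p (f' t - \<eta> x) \<le> e"
        using K uv t tab by (intro close) (auto simp: dist_real_def subset_iff)
      ultimately show "\<exists>d. ((\<lambda>s. (1 / (s - t)) *\<^sub>R (g s - g t)) \<longlongrightarrow> d) (at t within {u..v}) \<and> p d \<le> e"
        by blast
    qed
    moreover have "g v - g u = (f v - f u) - (v - u) *\<^sub>R \<eta> x" by (simp add: g_def algebra_simps)
    ultimately show ?thesis using uv \<open>u \<le> v\<close> by simp
  qed
  have "f b - f a - (\<Sum>(x, K)\<in>D. measure lborel K *\<^sub>R \<eta> x)
      = (\<Sum>(x, K)\<in>D. (f (Sup K) - f (Inf K)) - measure lborel K *\<^sub>R \<eta> x)"
    unfolding sum_endpoints_tagged_division[OF \<open>a \<le> b\<close> D(1), of f, symmetric]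
    by (simp add: case_prod_unfold sum_subtractf)
  also have "p \<dots> \<le> (\<Sum>(x, K)\<in>D. e * (Sup K - Inf K))"
    using est by (intro order_trans[OF seminorm_sum[OF p] sum_mono]) auto
  also have "\<dots> = e * (\<Sum>(x, K)\<in>D. Sup K - Inf K)"
    by (simp add: case_prod_unfold sum_distrib_left)
  also have "\<dots> = e * (b - a)"
    using sum_endpoints_tagged_division[OF \<open>a \<le> b\<close> D(1), of "\<lambda>x. x"] by simp
  finally show ?thesis .
qed

text \<open>The approximate value \<open>y\<close> may depend on the seminorm and on
  \<open>e\<close>, which is all that the Cauchy property requires. It will be supplied by the
  quotient curve at a single small \<open>h\<close>.\<close>

lemma riemann_integral_tendsto:
  fixes f :: "real \<Rightarrow> 'b::{locally_convex_space, complete_uniform_space}"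
  assumes "\<And>q e. continuous_seminorm q \<Longrightarrow> e > 0 \<Longrightarrow>
    \<exists>y. \<forall>\<^sub>F D in riemann_filter a b. q (y - (\<Sum>(x, K)\<in>D. measure lborel K *\<^sub>R f x)) \<le> e"
  shows "((\<lambda>D. \<Sum>(x, K)\<in>D. measure lborel K *\<^sub>R f x) \<longlongrightarrow> riemann_integral a b f) (riemann_filter a b)"
proof -
  define S where "S D = (\<Sum>(x, K)\<in>D. measure lborel K *\<^sub>R f x)" for D :: "(real \<times> real set) set"
  have "cauchy_filter (filtermap S (riemann_filter a b))"
  proof (rule cauchy_filter_seminormI)
    fix q :: "'b \<Rightarrow> real" and e :: real
    assume q: "continuous_seminorm q" and "e > 0"
    then obtain y where y: "\<forall>\<^sub>F D in riemann_filter a b. q (y - S D) \<le> e / 2"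
      using assms[OF q, of "e / 2"] by (auto simp: S_def)
    moreover have "q (S D - S D') \<le> e" if "q (y - S D) \<le> e / 2" "q (y - S D') \<le> e / 2" for D D'
      using seminorm_diff_triangle[OF q, of "S D" "S D'" y] that
      by (simp add: seminorm_minus_commute[OF q, of "S D" y])
    ultimately show "\<exists>P. eventually P (riemann_filter a b) \<and>
        (\<forall>D D'. P D \<longrightarrow> P D' \<longrightarrow> q (S D - S D') \<le> e)"
      by blast
  qed
  then have "convergent_filter (filtermap S (riemann_filter a b))"
    by (rule cauchy_filter_convergent') (simp add: filtermap_bot_iff riemann_filter_not_bot)
  then obtain I where I: "(S \<longlongrightarrow> I) (riemann_filter a b)"
    by (auto simp: convergent_filter_iff filterlim_def)
  then have "riemann_integral a b f = I"
    unfolding riemann_integral_def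
    using tendsto_Lim[OF riemann_filter_not_bot I] by (simp add: S_def[abs_def])
  then show ?thesis using I by (simp add: S_def[abs_def])
qed


section \<open>Strict derivatives\<close>

text \<open>
  A form of differentiability at a point that is implied by \<open>C\<^sup>1\<close>, composes by mere composition of
  limits, and forces the derivative to be linear and to depend continuously on the point.
\<close>

definition has_strict_derivative ::
  "('a::topological_real_vector \<Rightarrow> 'b::{real_vector, topological_space}) \<Rightarrow> ('a \<Rightarrow> 'b) \<Rightarrow> 'a \<Rightarrow> bool"
  where "has_strict_derivative f f' x \<longleftrightarrow>
    (\<forall>w. ((\<lambda>(y, \<tau>, z). (1 / \<tau>) *\<^sub>R (f (y + \<tau> *\<^sub>R z) - f y)) \<longlongrightarrow> f' w)
      (nhds x \<times>\<^sub>F (at 0 \<times>\<^sub>F nhds w)))"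

lemma has_strict_derivativeD:
  assumes "has_strict_derivative f f' x"
    and "(y \<longlongrightarrow> x) F" "filterlim \<tau> (at 0) F" "(z \<longlongrightarrow> w) F"
  shows "((\<lambda>s. (1 / \<tau> s) *\<^sub>R (f (y s + \<tau> s *\<^sub>R z s) - f (y s))) \<longlongrightarrow> f' w) F"
  using filterlim_compose[OF assms(1)[unfolded has_strict_derivative_def, rule_format]
      filterlim_Pair[OF assms(2) filterlim_Pair[OF assms(3,4)]]]
  by simp

context
  fixes x w :: "'a::topological_real_vector"
begin

lemma tendsto_strict_filter:
  defines "F \<equiv> nhds x \<times>\<^sub>F (at (0::real) \<times>\<^sub>F nhds w)"
  shows "((\<lambda>u. fst u) \<longlongrightarrow> x) F" "filterlim (\<lambda>u. fst (snd u)) (at 0) F" "((\<lambda>u. snd (snd u)) \<longlongrightarrow> w) F"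
    and "((\<lambda>u. fst u + fst (snd u) *\<^sub>R snd (snd u)) \<longlongrightarrow> x) F"
proof -
  show 1: "((\<lambda>u. fst u) \<longlongrightarrow> x) F"
    unfolding F_def by (rule filterlim_fst)
  show 2: "filterlim (\<lambda>u. fst (snd u)) (at 0) F"
    unfolding F_def by (rule filterlim_compose[OF filterlim_fst filterlim_snd])
  show 3: "((\<lambda>u. snd (snd u)) \<longlongrightarrow> w) F"
    unfolding F_def by (rule filterlim_compose[OF filterlim_snd filterlim_snd])
  have "((\<lambda>u. fst (snd u)) \<longlongrightarrow> 0) F" using 2 by (simp add: filterlim_at)
  from tendsto_add[OF 1 tendsto_scaleR_tvs[OF this 3]]
  show "((\<lambda>u. fst u + fst (snd u) *\<^sub>R snd (snd u)) \<longlongrightarrow> x) F" by simp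
qed

lemma eventually_strict_filter_nonzero:
  "\<forall>\<^sub>F u in nhds x \<times>\<^sub>F (at (0::real) \<times>\<^sub>F nhds w). fst (snd u) \<noteq> 0"
  using tendsto_strict_filter(2) by (simp add: filterlim_at)

end

text \<open>The difference quotient \<open>q\<close> of \<open>f\<close> serves as the moving
  direction for \<open>g\<close>, since \<open>f (y + \<tau> *\<^sub>R z)\<close> is
  \<open>f y\<close> plus \<open>\<tau>\<close> times \<open>q\<close>. This is why the definition
  lets the direction vary.\<close>

lemma has_strict_derivative_compose:
  fixes f :: "'a::topological_real_vector \<Rightarrow> _"
  assumes f: "has_strict_derivative f f' x" and cont: "(f \<longlongrightarrow> f x) (nhds x)"
    and g: "has_strict_derivative g g' (f x)"
  shows "has_strict_derivative (g \<circ> f) (g' \<circ> f') x"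
  unfolding has_strict_derivative_def
proof
  fix w :: 'a
  let ?F = "nhds x \<times>\<^sub>F (at (0::real) \<times>\<^sub>F nhds w)"
  define q where "q u = (1 / fst (snd u)) *\<^sub>R (f (fst u + fst (snd u) *\<^sub>R snd (snd u)) - f (fst u))" for u
  have "(q \<longlongrightarrow> f' w) ?F"
    unfolding q_def by (intro has_strict_derivativeD[OF f] tendsto_strict_filter)
  moreover have "((\<lambda>u. f (fst u)) \<longlongrightarrow> f x) ?F"
    by (rule filterlim_compose[OF cont tendsto_strict_filter(1)])
  ultimately have "((\<lambda>u. (1 / fst (snd u)) *\<^sub>R (g (f (fst u) + fst (snd u) *\<^sub>R q u) - g (f (fst u))))
      \<longlongrightarrow> g' (f' w)) ?F"
    by (intro has_strict_derivativeD[OF g] tendsto_strict_filter)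
  then show "((\<lambda>(y, \<tau>, z). (1 / \<tau>) *\<^sub>R ((g \<circ> f) (y + \<tau> *\<^sub>R z) - (g \<circ> f) y)) \<longlongrightarrow> (g' \<circ> f') w) ?F"
    unfolding comp_apply case_prod_unfold
    by (rule Lim_transform_eventually, intro eventually_mono[OF eventually_strict_filter_nonzero])
      (simp add: q_def)
qed

lemma has_strict_derivative_transform:
  fixes f :: "'a::topological_real_vector \<Rightarrow> _"
  assumes f: "has_strict_derivative f f' x" and eq: "\<forall>\<^sub>F y in nhds x. f y = g y"
  shows "has_strict_derivative g f' x"
  unfolding has_strict_derivative_def
proof
  fix w :: 'a
  let ?F = "nhds x \<times>\<^sub>F (at (0::real) \<times>\<^sub>F nhds w)"
  have "\<forall>\<^sub>F u in ?F. f (fst u) = g (fst u)"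
    "\<forall>\<^sub>F u in ?F. f (fst u + fst (snd u) *\<^sub>R snd (snd u)) = g (fst u + fst (snd u) *\<^sub>R snd (snd u))"
    by (rule eventually_compose_filterlim[OF eq], rule tendsto_strict_filter)+
  then have "\<forall>\<^sub>F u in ?F. (\<lambda>(y, \<tau>, z). (1 / \<tau>) *\<^sub>R (f (y + \<tau> *\<^sub>R z) - f y)) u
      = (\<lambda>(y, \<tau>, z). (1 / \<tau>) *\<^sub>R (g (y + \<tau> *\<^sub>R z) - g y)) u"
    by eventually_elim (simp add: case_prod_unfold)
  then show "((\<lambda>(y, \<tau>, z). (1 / \<tau>) *\<^sub>R (g (y + \<tau> *\<^sub>R z) - g y)) \<longlongrightarrow> f' w) ?F"
    using f[unfolded has_strict_derivative_def, rule_format, of w]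
    by (rule Lim_transform_eventually[rotated])
qed

lemma has_strict_derivative_Pair:
  fixes f :: "'a::topological_real_vector \<Rightarrow> _"
  assumes "has_strict_derivative f f' x" "has_strict_derivative g g' x"
  shows "has_strict_derivative (\<lambda>x. (f x, g x)) (\<lambda>w. (f' w, g' w)) x"
  unfolding has_strict_derivative_def
proof
  fix w :: 'a
  show "((\<lambda>(y, \<tau>, z). (1 / \<tau>) *\<^sub>R ((f (y + \<tau> *\<^sub>R z), g (y + \<tau> *\<^sub>R z)) - (f y, g y))) \<longlongrightarrow> (f' w, g' w))
      (nhds x \<times>\<^sub>F (at 0 \<times>\<^sub>F nhds w))"
    using tendsto_Pair[OF assms[unfolded has_strict_derivative_def, rule_format, of w]]
    by (simp add: case_prod_unfold)
qed

lemma has_strict_derivative_linear: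
  fixes f :: "'a::topological_real_vector \<Rightarrow> 'b::{real_vector, topological_space}"
  assumes add: "\<And>x y. f (x + y) = f x + f y" and scale: "\<And>r x. f (r *\<^sub>R x) = r *\<^sub>R f x"
    and cont: "continuous_on UNIV f"
  shows "has_strict_derivative f f x"
  unfolding has_strict_derivative_def
proof
  fix w :: 'a
  let ?F = "nhds x \<times>\<^sub>F (at (0::real) \<times>\<^sub>F nhds w)"
  have "((\<lambda>u. f (snd (snd u))) \<longlongrightarrow> f w) ?F"
    by (rule continuous_on_tendsto_compose[OF cont tendsto_strict_filter(3)]) auto
  then show "((\<lambda>(y, \<tau>, z). (1 / \<tau>) *\<^sub>R (f (y + \<tau> *\<^sub>R z) - f y)) \<longlongrightarrow> f w) ?F"
    unfolding case_prod_unfold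
    by (rule Lim_transform_eventually, intro eventually_mono[OF eventually_strict_filter_nonzero])
      (simp add: add scale)
qed

lemma has_strict_derivative_const: "has_strict_derivative (\<lambda>_. c) (\<lambda>_. 0) x"
  by (simp add: has_strict_derivative_def case_prod_unfold)

lemma tendsto_diff_quotient_strict:
  assumes "has_strict_derivative f f' x"
  shows "(diff_quotient f x w \<longlongrightarrow> f' w) (at 0)"
  using has_strict_derivativeD[OF assms tendsto_const filterlim_ident tendsto_const]
  by (simp add: diff_quotient_def[abs_def])

lemma dir_deriv_eqI:
  fixes f :: "'a::real_vector \<Rightarrow> 'b::{real_vector, t2_space}"
  shows "(diff_quotient f x w \<longlongrightarrow> l) (at 0) \<Longrightarrow> dir_deriv f x w = l"
  unfolding dir_deriv_def by (rule tendsto_Lim) simp_all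

lemma dir_deriv_strict:
  fixes f :: "'a::topological_real_vector \<Rightarrow> 'b::{real_vector, t2_space}"
  assumes "has_strict_derivative f f' x"
  shows "dir_deriv f x w = f' w"
  by (rule dir_deriv_eqI[OF tendsto_diff_quotient_strict[OF assms]])

lemma strict_derivative_0:
  fixes f :: "'a::topological_real_vector \<Rightarrow> 'b::{real_vector, t2_space}"
  assumes "has_strict_derivative f f' x"
  shows "f' 0 = 0"
proof -
  have "((\<lambda>_::real. 0) \<longlongrightarrow> f' 0) (at 0)"
    using tendsto_diff_quotient_strict[OF assms, of 0] by (simp add: diff_quotient_def[abs_def])
  then show ?thesis using tendsto_unique[OF trivial_limit_at _ tendsto_const] by blast
qed

lemma strict_derivative_scaleR:
  fixes f :: "'a::topological_real_vector \<Rightarrow> 'b::{topological_real_vector, t2_space}"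
  assumes "has_strict_derivative f f' x"
  shows "f' (c *\<^sub>R w) = c *\<^sub>R f' w"
proof (cases "c = 0")
  case False
  have "filterlim (\<lambda>\<tau>. c * \<tau>) (at 0) (at (0::real))"
    using False by (auto simp: filterlim_at eventually_at_filter intro!: tendsto_eq_intros)
  from has_strict_derivativeD[OF assms tendsto_const this tendsto_const]
  have "((\<lambda>\<tau>. c *\<^sub>R ((1 / (c * \<tau>)) *\<^sub>R (f (x + (c * \<tau>) *\<^sub>R w) - f x))) \<longlongrightarrow> c *\<^sub>R f' w) (at 0)"
    by (intro tendsto_scaleR_tvs tendsto_const) simp
  then have "((\<lambda>\<tau>. (1 / \<tau>) *\<^sub>R (f (x + (c * \<tau>) *\<^sub>R w) - f x)) \<longlongrightarrow> c *\<^sub>R f' w) (at 0)"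
    using False by simp
  moreover have "((\<lambda>\<tau>. (1 / \<tau>) *\<^sub>R (f (x + (c * \<tau>) *\<^sub>R w) - f x)) \<longlongrightarrow> f' (c *\<^sub>R w)) (at 0)"
    using tendsto_diff_quotient_strict[OF assms, of "c *\<^sub>R w"]
    by (simp add: diff_quotient_def[abs_def] mult.commute)
  ultimately show ?thesis using tendsto_unique[OF trivial_limit_at] by blast
qed (simp add: strict_derivative_0[OF assms])

text \<open>Strictness enters through the moving base point: the increment along
  \<open>v + w\<close> is a step along \<open>v\<close> from \<open>x\<close> followed by a step
  along \<open>w\<close> from there.\<close>

lemma strict_derivative_add:
  fixes f :: "'a::topological_real_vector \<Rightarrow> 'b::{topological_real_vector, t2_space}"
  assumes "has_strict_derivative f f' x"
  shows "f' (v + w) = f' v + f' w"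
proof -
  have "((\<lambda>\<tau>. x + \<tau> *\<^sub>R v) \<longlongrightarrow> x + 0 *\<^sub>R v) (at 0)"
    by (intro tendsto_add tendsto_const tendsto_scaleR_tvs tendsto_ident_at)
  then have "((\<lambda>\<tau>. (1 / \<tau>) *\<^sub>R (f ((x + \<tau> *\<^sub>R v) + \<tau> *\<^sub>R w) - f (x + \<tau> *\<^sub>R v))) \<longlongrightarrow> f' w) (at 0)"
    by (intro has_strict_derivativeD[OF assms] filterlim_ident tendsto_const) simp
  from tendsto_add[OF tendsto_diff_quotient_strict[OF assms, of v] this]
  have "(diff_quotient f x (v + w) \<longlongrightarrow> f' v + f' w) (at 0)"
    by (simp add: diff_quotient_def[abs_def] algebra_simps)
  then show ?thesis
    using tendsto_unique[OF trivial_limit_at tendsto_diff_quotient_strict[OF assms]] by blast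
qed

text \<open>Strict differentiability at \<open>x\<close> confines the difference quotients at all
  nearby points and directions to \<open>V\<close>. Their limits, the derivatives at these points,
  lie in \<open>closure V\<close>, hence in \<open>W\<close>.\<close>

lemma tendsto_strict_derivative:
  fixes f :: "'a::topological_real_vector \<Rightarrow> 'b::topological_real_vector"
  assumes "\<forall>\<^sub>F y in nhds x. has_strict_derivative f (f' y) y"
  shows "((\<lambda>u. f' (fst u) (snd u)) \<longlongrightarrow> f' x w) (nhds x \<times>\<^sub>F nhds w)"
proof (rule topological_tendstoI)
  fix W assume "open W" "f' x w \<in> W"
  then obtain V where V: "open V" "f' x w \<in> V" "closure V \<subseteq> W"
    by (rule topological_group_closed_neighbourhood)
  have "has_strict_derivative f (f' x) x" using assms by (rule eventually_nhds_x_imp_x)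
  then have "\<forall>\<^sub>F u in nhds x \<times>\<^sub>F (at 0 \<times>\<^sub>F nhds w).
      (\<lambda>(y, \<tau>, z). (1 / \<tau>) *\<^sub>R (f (y + \<tau> *\<^sub>R z) - f y)) u \<in> V"
    using V by (auto simp: has_strict_derivative_def tendsto_def)
  then obtain P Q where P: "eventually P (nhds x)" and Q: "eventually Q (at (0::real) \<times>\<^sub>F nhds w)"
    and PQ: "\<And>y \<tau> z. P y \<Longrightarrow> Q (\<tau>, z) \<Longrightarrow> (1 / \<tau>) *\<^sub>R (f (y + \<tau> *\<^sub>R z) - f y) \<in> V"
    unfolding eventually_prod_filter[of _ "nhds x"] by auto
  from Q obtain R S where R: "eventually R (at (0::real))" and S: "eventually S (nhds w)"
    and RS: "\<And>\<tau> z. R \<tau> \<Longrightarrow> S z \<Longrightarrow> Q (\<tau>, z)"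
    unfolding eventually_prod_filter by auto
  have "f' y z \<in> W" if "P y" "has_strict_derivative f (f' y) y" "S z" for y z
  proof -
    have "\<forall>\<^sub>F \<tau> in at 0. diff_quotient f y z \<tau> \<in> closure V"
      using R by eventually_elim
        (use that RS PQ closure_subset in \<open>force simp: diff_quotient_def\<close>)
    then have "f' y z \<in> closure V"
      using Lim_in_closed_set[OF closed_closure _ trivial_limit_at tendsto_diff_quotient_strict[OF that(2)]]
      by blast
    then show ?thesis using V by blast
  qed
  moreover have "\<forall>\<^sub>F y in nhds x. P y \<and> has_strict_derivative f (f' y) y"
    using P assms by (rule eventually_conj)
  ultimately show "\<forall>\<^sub>F u in nhds x \<times>\<^sub>F nhds w. f' (fst u) (snd u) \<in> W"
    using S unfolding eventually_prod_filter by auto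
qed


section \<open>Bastiani calculus\<close>

lemma Ck_on_open: "Ck_on k S f \<Longrightarrow> open S"
  by (simp add: Ck_on_def)

lemma Ck_on_tendsto_dir_deriv:
  fixes f :: "'a::{real_vector,topological_space} \<Rightarrow> 'b::{real_vector,t2_space}"
  assumes "Ck_on k S f" "1 \<le> k" "x \<in> S"
  shows "(diff_quotient f x w \<longlongrightarrow> dir_deriv f x w) (at 0)"
proof -
  have "enat 0 < k" using assms(2) by (metis less_le_trans one_enat_def enat_ord_simps(2) zero_less_one)
  then have "\<forall>x\<in>S. \<forall>v w. \<exists>l. (diff_quotient (\<lambda>y. iter_dir_deriv 0 f y v) x w \<longlongrightarrow> l) (at 0)"
    using assms(1) unfolding Ck_on_def by blast
  then obtain l where "(diff_quotient f x w \<longlongrightarrow> l) (at 0)" using assms(3) by auto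
  then show ?thesis using dir_deriv_eqI by fastforce
qed

lemma Ck_on_continuous_dir_deriv:
  fixes f :: "'a::{real_vector,topological_space} \<Rightarrow> 'b::{real_vector,t2_space}"
  assumes "Ck_on k S f" "1 \<le> k"
  shows "continuous_on (S \<times> UNIV) (\<lambda>u. dir_deriv f (fst u) (snd u))"
proof -
  have c: "continuous_on (S \<times> UNIV) (\<lambda>(x, v). iter_dir_deriv 1 f x v)"
    using assms unfolding Ck_on_def by (metis one_enat_def)
  \<comment> \<open>\<open>iter_dir_deriv\<close> takes a sequence of directions, of which order one
    reads entry 0; a single direction is fed in as a constant sequence.\<close>
  have "continuous_on (S \<times> UNIV) (\<lambda>u::'a \<times> 'a. (fst u, (\<lambda>_::nat. snd u)))"
    by (intro continuous_intros continuous_on_coordinatewise_then_product)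
  then have "continuous_on (S \<times> UNIV)
      (\<lambda>u. (\<lambda>(x, v). iter_dir_deriv 1 f x v) (fst u, (\<lambda>_::nat. snd u)))"
    by (rule continuous_on_compose2[OF c]) auto
  then show ?thesis by simp
qed

text \<open>For \<open>y\<close> near \<open>x\<close> the mean value inequality is applied on the
  segment from \<open>y\<close> to \<open>y + \<tau> *\<^sub>R z\<close>, after subtracting the
  linear part with slope \<open>D0\<close>. Joint continuity of the directional derivative at
  \<open>(x, w0)\<close> bounds the derivative of the remainder.\<close>

lemma Ck_on_has_strict_derivative:
  fixes f :: "'a::topological_real_vector \<Rightarrow> 'b::locally_convex_space"
  assumes C: "Ck_on k S f" "1 \<le> k" and x: "x \<in> S"
  shows "has_strict_derivative f (dir_deriv f x) x"
  unfolding has_strict_derivative_def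
proof (intro allI tendsto_seminormI)
  fix w0 and p :: "'b \<Rightarrow> real" and e :: real
  assume p: "continuous_seminorm p" and "e > 0"
  define D0 where "D0 = dir_deriv f x w0"
  have oS: "open (S \<times> (UNIV :: 'a set))" using Ck_on_open[OF C(1)] by (intro open_Times) auto
  define d where "d u = dir_deriv f (fst u) (snd u)" for u
  have "continuous_on (S \<times> UNIV) d"
    using Ck_on_continuous_dir_deriv[OF C] by (simp add: d_def[abs_def])
  then have "(d \<longlongrightarrow> d (x, w0)) (at (x, w0) within S \<times> UNIV)"
    using x by (simp add: continuous_on_def)
  then have "(d \<longlongrightarrow> d (x, w0)) (nhds (x, w0))"
    using at_within_open[OF _ oS, of "(x, w0)"] x by (simp add: tendsto_at_iff_tendsto_nhds)
  then have "((\<lambda>u. dir_deriv f (fst u) (snd u)) \<longlongrightarrow> D0) (nhds (x, w0))"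
    by (simp add: d_def[abs_def] D0_def)
  from seminorm_tendsto_diff_less[OF p this \<open>e > 0\<close>] eventually_nhds_in_open[OF oS, of "(x, w0)"] x
  have "\<forall>\<^sub>F u in nhds x \<times>\<^sub>F nhds w0. p (dir_deriv f (fst u) (snd u) - D0) < e \<and> fst u \<in> S"
    by (auto simp: nhds_prod elim: eventually_elim2)
  \<comment> \<open>\<open>nhds 0\<close> takes the place of \<open>at 0\<close> because the segment
    uses all increments \<open>t * \<tau>\<close>, including the one for
    \<open>t = 0\<close>.\<close>
  moreover have "filterlim (\<lambda>u. (fst u + fst (snd u) *\<^sub>R snd (snd u), snd (snd u)))
      (nhds x \<times>\<^sub>F nhds w0) (nhds x \<times>\<^sub>F (nhds 0 \<times>\<^sub>F nhds w0))"
  proof (rule filterlim_Pair)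
    have "((\<lambda>u. fst u + fst (snd u) *\<^sub>R snd (snd u)) \<longlongrightarrow> x + 0 *\<^sub>R w0) (nhds x \<times>\<^sub>F (nhds 0 \<times>\<^sub>F nhds w0))"
      by (intro tendsto_add tendsto_scaleR_tvs filterlim_fst
          filterlim_compose[OF filterlim_fst filterlim_snd] filterlim_compose[OF filterlim_snd filterlim_snd])
    then show "((\<lambda>u. fst u + fst (snd u) *\<^sub>R snd (snd u)) \<longlongrightarrow> x) (nhds x \<times>\<^sub>F (nhds 0 \<times>\<^sub>F nhds w0))"
      by simp
    show "((\<lambda>u. snd (snd u)) \<longlongrightarrow> w0) (nhds x \<times>\<^sub>F (nhds 0 \<times>\<^sub>F nhds w0))"
      by (rule filterlim_compose[OF filterlim_snd filterlim_snd])
  qed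
  ultimately have "\<forall>\<^sub>F u in nhds x \<times>\<^sub>F (nhds 0 \<times>\<^sub>F nhds w0).
      p (dir_deriv f (fst u + fst (snd u) *\<^sub>R snd (snd u)) (snd (snd u)) - D0) < e \<and>
      fst u + fst (snd u) *\<^sub>R snd (snd u) \<in> S"
    by (drule_tac eventually_compose_filterlim) auto
  then obtain P Q where P: "eventually P (nhds x)" and Q: "eventually Q (nhds (0::real) \<times>\<^sub>F nhds w0)"
    and PQ: "\<And>y \<sigma> z. P y \<Longrightarrow> Q (\<sigma>, z) \<Longrightarrow>
      p (dir_deriv f (y + \<sigma> *\<^sub>R z) z - D0) < e \<and> y + \<sigma> *\<^sub>R z \<in> S"
    unfolding eventually_prod_filter[of _ "nhds x"] by auto
  from Q obtain R Z where R: "eventually R (nhds (0::real))" and Z: "eventually Z (nhds w0)"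
    and RZ: "\<And>\<sigma> z. R \<sigma> \<Longrightarrow> Z z \<Longrightarrow> Q (\<sigma>, z)"
    unfolding eventually_prod_filter by auto
  from R obtain r where r: "r > 0" "\<And>\<sigma>. \<bar>\<sigma>\<bar> < r \<Longrightarrow> R \<sigma>"
    by (auto simp: eventually_nhds_metric dist_real_def)
  have est: "p ((1 / \<tau>) *\<^sub>R (f (y + \<tau> *\<^sub>R z) - f y) - D0) \<le> e"
    if "P y" "Z z" "\<tau> \<noteq> 0" "\<bar>\<tau>\<bar> < r" for y z \<tau>
  proof -
    \<comment> \<open>\<open>g\<close> runs along the segment for parameters in
      \<open>{0..1}\<close>; its derivative carries the factor \<open>\<tau>\<close>, which division
      by \<open>\<tau>\<close> removes again.\<close>
    define g where "g s = f (y + (s * \<tau>) *\<^sub>R z) - (s * \<tau>) *\<^sub>R D0" for s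
    have "p (g 1 - g 0) \<le> (\<bar>\<tau>\<bar> * e) * (1 - 0)"
    proof (rule seminorm_mean_value[OF p])
      fix t :: real assume t: "t \<in> {0..1}"
      have "\<bar>t * \<tau>\<bar> \<le> 1 * \<bar>\<tau>\<bar>" using t by (simp add: abs_mult mult_left_le_one_le)
      with that have "\<bar>t * \<tau>\<bar> < r" by simp
      define u where "u = y + (t * \<tau>) *\<^sub>R z"
      have u: "p (dir_deriv f u z - D0) < e" "u \<in> S"
        using PQ[OF that(1) RZ[OF r(2)[OF \<open>\<bar>t * \<tau>\<bar> < r\<close>] that(2)]] by (auto simp: u_def)
      have "filterlim (\<lambda>s. (s - t) * \<tau>) (at 0) (at t within {0..1})"
        using that by (auto simp: filterlim_at eventually_at_filter intro!: tendsto_eq_intros)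
      from filterlim_compose[OF Ck_on_tendsto_dir_deriv[OF C u(2), of z] this]
      have "((\<lambda>s. \<tau> *\<^sub>R (diff_quotient f u z ((s - t) * \<tau>) - D0)) \<longlongrightarrow> \<tau> *\<^sub>R (dir_deriv f u z - D0))
          (at t within {0..1})"
        by (intro tendsto_scaleR_tvs tendsto_diff tendsto_const)
      then have "((\<lambda>s. (1 / (s - t)) *\<^sub>R (g s - g t)) \<longlongrightarrow> \<tau> *\<^sub>R (dir_deriv f u z - D0)) (at t within {0..1})"
      proof (rule Lim_transform_eventually)
        have "\<tau> *\<^sub>R (diff_quotient f u z ((s - t) * \<tau>) - D0) = (1 / (s - t)) *\<^sub>R (g s - g t)"
          if "s \<noteq> t" for s
        proof -
          have "u + ((s - t) * \<tau>) *\<^sub>R z = y + (s * \<tau>) *\<^sub>R z" by (simp add: u_def algebra_simps)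
          moreover have "g s - g t = f (y + (s * \<tau>) *\<^sub>R z) - f u - ((s - t) * \<tau>) *\<^sub>R D0"
            by (simp add: g_def u_def algebra_simps)
          ultimately show ?thesis
            using that \<open>\<tau> \<noteq> 0\<close> by (simp add: diff_quotient_def scaleR_diff_right)
        qed
        then show "\<forall>\<^sub>F s in at t within {0..1}.
            \<tau> *\<^sub>R (diff_quotient f u z ((s - t) * \<tau>) - D0) = (1 / (s - t)) *\<^sub>R (g s - g t)"
          by (auto simp: eventually_at intro!: exI[of _ 1])
      qed
      moreover have "p (\<tau> *\<^sub>R (dir_deriv f u z - D0)) \<le> \<bar>\<tau>\<bar> * e"
        unfolding seminorm_scaleR[OF p] using u by (intro mult_left_mono) auto
      ultimately show "\<exists>d. ((\<lambda>s. (1 / (s - t)) *\<^sub>R (g s - g t)) \<longlongrightarrow> d) (at t within {0..1}) \<and> p d \<le> \<bar>\<tau>\<bar> * e"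
        by blast
    qed simp
    moreover have "(1 / \<tau>) *\<^sub>R (f (y + \<tau> *\<^sub>R z) - f y) - D0 = (1 / \<tau>) *\<^sub>R (g 1 - g 0)"
      using \<open>\<tau> \<noteq> 0\<close> by (simp add: g_def scaleR_diff_right)
    moreover have "p ((1 / \<tau>) *\<^sub>R (g 1 - g 0)) = p (g 1 - g 0) / \<bar>\<tau>\<bar>"
      by (simp only: seminorm_scaleR[OF p] abs_divide abs_one times_divide_eq_left mult_1)
    ultimately show ?thesis
      using \<open>\<tau> \<noteq> 0\<close> by (simp only: divide_le_eq zero_less_abs_iff) (simp add: mult.commute)
  qed
  have "\<forall>\<^sub>F \<tau> in at (0::real). \<tau> \<noteq> 0 \<and> \<bar>\<tau>\<bar> < r"
    using r(1) by (auto simp: eventually_at dist_real_def intro!: exI[of _ r])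
  then have "\<forall>\<^sub>F u in at (0::real) \<times>\<^sub>F nhds w0. fst u \<noteq> 0 \<and> \<bar>fst u\<bar> < r \<and> Z (snd u)"
    using Z unfolding eventually_prod_filter by fastforce
  then show "\<forall>\<^sub>F u in nhds x \<times>\<^sub>F (at 0 \<times>\<^sub>F nhds w0).
      p ((\<lambda>(y, \<tau>, z). (1 / \<tau>) *\<^sub>R (f (y + \<tau> *\<^sub>R z) - f y)) u - dir_deriv f x w0) \<le> e"
    using P unfolding eventually_prod_filter[of _ "nhds x"] D0_def[symmetric]
    using est by fastforce
qed

section \<open>Locality of iterated directional derivatives, and \<open>C^k\<close> maps on
  products\<close>

lemma eventually_line_in_open:
  fixes x :: "'a::topological_real_vector"
  assumes "open S" "x \<in> S"
  shows "\<forall>\<^sub>F h in at 0. x + h *\<^sub>R v \<in> S"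
proof -
  have "((\<lambda>h. x + h *\<^sub>R v) \<longlongrightarrow> x + 0 *\<^sub>R v) (at 0)"
    by (intro tendsto_add tendsto_const tendsto_scaleR_tvs tendsto_ident_at)
  then show ?thesis using assms by (auto simp: tendsto_def)
qed

lemma eventually_diff_quotient_eq:
  fixes x :: "'a::topological_real_vector"
  assumes "open S" "x \<in> S" "\<And>y. y \<in> S \<Longrightarrow> f y = g y"
  shows "\<forall>\<^sub>F h in at 0. diff_quotient f x v h = diff_quotient g x v h"
  using eventually_line_in_open[OF assms(1,2), of v]
  by eventually_elim (simp add: diff_quotient_def assms)

lemma tendsto_diff_quotient_cong:
  fixes x :: "'a::topological_real_vector"
  assumes "open S" "x \<in> S" "\<And>y. y \<in> S \<Longrightarrow> f y = g y"
  shows "(diff_quotient f x v \<longlongrightarrow> l) (at 0) \<longleftrightarrow> (diff_quotient g x v \<longlongrightarrow> l) (at 0)"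
  by (rule tendsto_cong[OF eventually_diff_quotient_eq[OF assms]])

text \<open>\<open>dir_deriv\<close> is a \<open>Lim\<close>, defined even where no limit exists;
  the two sides are therefore identified through their whole sets of limits.\<close>

lemma dir_deriv_cong:
  fixes x :: "'a::topological_real_vector"
  assumes "open S" "x \<in> S" "\<And>y. y \<in> S \<Longrightarrow> f y = g y"
  shows "dir_deriv f x v = dir_deriv g x v"
proof -
  have "(\<lambda>l. (diff_quotient f x v \<longlongrightarrow> l) (at 0)) = (\<lambda>l. (diff_quotient g x v \<longlongrightarrow> l) (at 0))"
    by (intro ext tendsto_diff_quotient_cong[OF assms])
  then show ?thesis by (simp only: dir_deriv_def Topological_Spaces.Lim_def)
qed

lemma iter_dir_deriv_cong:
  fixes f g :: "'a::topological_real_vector \<Rightarrow> 'b::{real_vector,t2_space}"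
  assumes "open S" "\<And>y. y \<in> S \<Longrightarrow> f y = g y"
  shows "x \<in> S \<Longrightarrow> iter_dir_deriv p f x v = iter_dir_deriv p g x v"
proof (induction p arbitrary: x v)
  case (Suc p)
  show ?case using Suc.IH by (simp, intro dir_deriv_cong[OF assms(1) Suc.prems])
qed (simp add: assms)

lemma Ck_on_cong:
  fixes f g :: "'a::topological_real_vector \<Rightarrow> 'b::{real_vector,t2_space}"
  assumes "Ck_on k S f" and eq: "\<And>y. y \<in> S \<Longrightarrow> f y = g y"
  shows "Ck_on k S g"
proof -
  note S = Ck_on_open[OF assms(1)]
  have it: "iter_dir_deriv p f x v = iter_dir_deriv p g x v" if "x \<in> S" for p x v
    by (rule iter_dir_deriv_cong[OF S eq that])
  show ?thesis
    unfolding Ck_on_def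
  proof (intro conjI S allI impI ballI)
    fix p x v w assume "enat p < k" "x \<in> S"
    moreover from this obtain l where
      "(diff_quotient (\<lambda>y. iter_dir_deriv p f y v) x w \<longlongrightarrow> l) (at 0)"
      using assms(1) unfolding Ck_on_def by blast
    ultimately show "\<exists>l. (diff_quotient (\<lambda>y. iter_dir_deriv p g y v) x w \<longlongrightarrow> l) (at 0)"
      using tendsto_diff_quotient_cong[OF S \<open>x \<in> S\<close>, of "\<lambda>y. iter_dir_deriv p f y v" "\<lambda>y. iter_dir_deriv p g y v"] it by blast
  next
    fix p assume "enat p \<le> k"
    then have "continuous_on (S \<times> UNIV) (\<lambda>(x, v). iter_dir_deriv p f x v)"
      using assms(1) unfolding Ck_on_def by blast
    then show "continuous_on (S \<times> UNIV) (\<lambda>(x, v). iter_dir_deriv p g x v)"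
      by (rule continuous_on_eq) (auto simp: it)
  qed
qed

text \<open>Iterated derivatives act componentwise, with the sequence of directions split into its
  two component sequences. The induction carries the existence of the limits along, because the
  derivative of a pair is computed from both component limits.\<close>

lemma Ck_on_map_prod:
  fixes f :: "'a::topological_real_vector \<Rightarrow> 'b::{real_vector,t2_space}"
    and g :: "'c::topological_real_vector \<Rightarrow> 'd::{real_vector,t2_space}"
  assumes f: "Ck_on k S f" and g: "Ck_on k T g"
  shows "Ck_on k (S \<times> T) (map_prod f g)"
proof -
  let ?m = "\<lambda>p x v. (iter_dir_deriv p f (fst x) (fst \<circ> v), iter_dir_deriv p g (snd x) (snd \<circ> v))"
  have oST: "open (S \<times> T)" by (intro open_Times Ck_on_open[OF f] Ck_on_open[OF g])
  have lim: "(diff_quotient (\<lambda>y. ?m p y v) x w \<longlongrightarrow>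
      (dir_deriv (\<lambda>y. iter_dir_deriv p f y (fst \<circ> v)) (fst x) (fst w),
       dir_deriv (\<lambda>y. iter_dir_deriv p g y (snd \<circ> v)) (snd x) (snd w))) (at 0)"
    if p: "enat p < k" and x: "x \<in> S \<times> T" for p x w and v :: "nat \<Rightarrow> 'a \<times> 'c"
  proof -
    obtain l where l: "(diff_quotient (\<lambda>y. iter_dir_deriv p f y (fst \<circ> v)) (fst x) (fst w) \<longlongrightarrow> l) (at 0)"
      using f p x unfolding Ck_on_def by (metis mem_Times_iff)
    obtain m where m: "(diff_quotient (\<lambda>y. iter_dir_deriv p g y (snd \<circ> v)) (snd x) (snd w) \<longlongrightarrow> m) (at 0)"
      using g p x unfolding Ck_on_def by (metis mem_Times_iff)
    show ?thesis
      unfolding dir_deriv_eqI[OF l] dir_deriv_eqI[OF m]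
      using tendsto_Pair[OF l m] by (simp add: diff_quotient_def[abs_def])
  qed
  have it: "iter_dir_deriv p (map_prod f g) x v = ?m p x v" if "enat p \<le> k" "x \<in> S \<times> T" for p x v
    using that
  proof (induction p arbitrary: x v)
    case (Suc p)
    \<comment> \<open>Order \<open>Suc p\<close> at most \<open>k\<close> makes order
      \<open>p\<close> strictly less than \<open>k\<close>, which is where the definition grants
      limits.\<close>
    then have p: "enat p < k" "enat p \<le> k" by (simp_all add: Suc_ile_eq order_less_imp_le)
    have "dir_deriv (\<lambda>y. iter_dir_deriv p (map_prod f g) y v) x (v p) = dir_deriv (\<lambda>y. ?m p y v) x (v p)"
      by (rule dir_deriv_cong[OF oST Suc.prems(2)]) (rule Suc.IH[OF p(2)])
    also have "\<dots> = ?m (Suc p) x v"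
      using dir_deriv_eqI[OF lim[OF p(1) Suc.prems(2), of v "v p"]]
      by (simp only: iter_dir_deriv.simps comp_def)
    finally show ?case by (simp only: iter_dir_deriv.simps)
  qed (simp add: map_prod_def case_prod_unfold)
  show ?thesis
    unfolding Ck_on_def
  proof (intro conjI oST allI impI ballI)
    fix p x v w assume p: "enat p < k" and x: "x \<in> S \<times> T"
    show "\<exists>l. (diff_quotient (\<lambda>y. iter_dir_deriv p (map_prod f g) y v) x w \<longlongrightarrow> l) (at 0)"
      using lim[OF p x] it[OF less_imp_le[OF p]]
        tendsto_diff_quotient_cong[OF oST x, of "\<lambda>y. iter_dir_deriv p (map_prod f g) y v" "\<lambda>y. ?m p y v"]
      by blast
  next
    fix p assume p: "enat p \<le> k"
    have coord: "continuous_on A (\<lambda>u. snd u i)"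
      for A :: "(('a \<times> 'c) \<times> (nat \<Rightarrow> 'a \<times> 'c)) set" and i
      by (rule continuous_on_compose2[OF continuous_on_product_coordinates continuous_on_snd[OF continuous_on_id]]) auto
    have c1: "continuous_on ((S \<times> T) \<times> UNIV) (\<lambda>u :: ('a \<times> 'c) \<times> (nat \<Rightarrow> 'a \<times> 'c). (fst (fst u), \<lambda>i. fst (snd u i)))"
      and c2: "continuous_on ((S \<times> T) \<times> UNIV) (\<lambda>u :: ('a \<times> 'c) \<times> (nat \<Rightarrow> 'a \<times> 'c). (snd (fst u), \<lambda>i. snd (snd u i)))"
      by (intro continuous_on_Pair continuous_on_coordinatewise_then_product
          continuous_on_fst[OF coord] continuous_on_snd[OF coord]
          continuous_on_fst[OF continuous_on_fst[OF continuous_on_id]]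
          continuous_on_snd[OF continuous_on_fst[OF continuous_on_id]])+
    have d1: "continuous_on (S \<times> UNIV) (\<lambda>u. iter_dir_deriv p f (fst u) (snd u))"
      and d2: "continuous_on (T \<times> UNIV) (\<lambda>u. iter_dir_deriv p g (fst u) (snd u))"
      using f g p by (auto simp: Ck_on_def case_prod_unfold)
    have "continuous_on ((S \<times> T) \<times> UNIV)
        (\<lambda>u :: ('a \<times> 'c) \<times> (nat \<Rightarrow> 'a \<times> 'c). iter_dir_deriv p f (fst (fst u)) (\<lambda>i. fst (snd u i)))"
      using continuous_on_compose2[OF d1 c1] by (auto simp: image_subset_iff)
    moreover have "continuous_on ((S \<times> T) \<times> UNIV)
        (\<lambda>u :: ('a \<times> 'c) \<times> (nat \<Rightarrow> 'a \<times> 'c). iter_dir_deriv p g (snd (fst u)) (\<lambda>i. snd (snd u i)))"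
      using continuous_on_compose2[OF d2 c2] by (auto simp: image_subset_iff)
    ultimately have "continuous_on ((S \<times> T) \<times> UNIV) (\<lambda>u. ?m p (fst u) (snd u))"
      unfolding comp_def by (rule continuous_on_Pair)
    then show "continuous_on ((S \<times> T) \<times> UNIV) (\<lambda>(x, v). iter_dir_deriv p (map_prod f g) x v)"
      by (rule continuous_on_eq) (auto simp: it[OF p])
  qed
qed

text \<open>Needed to recognise the standard chart of the real line in its own maximal atlas; all
  derivatives beyond the first vanish.\<close>

lemma Ck_on_real_id: "Ck_on k UNIV (\<lambda>x::real. x)"
proof -
  have lim: "(diff_quotient (\<lambda>x::real. x) x w \<longlongrightarrow> w) (at 0)" for x w
    by (rule tendsto_eventually) (auto simp: eventually_at_filter diff_quotient_def)
  have lim0: "(diff_quotient (\<lambda>x::real. c::real) x w \<longlongrightarrow> 0) (at 0)" for x w c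
    by (simp add: diff_quotient_def[abs_def])
  have it: "iter_dir_deriv p (\<lambda>x::real. x) x v = (if p = 0 then x else if p = 1 then v 0 else 0)" for p x v
    by (induction p arbitrary: x v)
       (auto simp: dir_deriv_eqI[OF lim] dir_deriv_eqI[OF lim0])
  have "continuous_on UNIV (\<lambda>u::real \<times> (nat \<Rightarrow> real). snd u 0)"
    by (rule continuous_on_compose2[OF continuous_on_product_coordinates continuous_on_snd[OF continuous_on_id]]) auto
  then have "continuous_on UNIV (\<lambda>u. iter_dir_deriv p (\<lambda>x::real. x) (fst u) (snd u))" for p
    unfolding it by (cases "p = 0"; cases "p = 1") (simp_all add: continuous_on_fst continuous_on_id)
  moreover have "\<exists>l. (diff_quotient (\<lambda>x. iter_dir_deriv p (\<lambda>x::real. x) x v) x w \<longlongrightarrow> l) (at 0)" for p x v w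
    unfolding it using lim[of x w] lim0[of _ x w] by (cases "p = 0"; cases "p = 1") (simp_all, blast+)
  ultimately show ?thesis
    by (auto simp: Ck_on_def case_prod_unfold)
qed


section \<open>Charts\<close>

instance real :: topological_real_vector
proof
  fix r x :: real
  show "((\<lambda>z. fst z *\<^sub>R snd z) \<longlongrightarrow> r *\<^sub>R x) (nhds r \<times>\<^sub>F nhds x)"
    by (intro tendsto_scaleR filterlim_fst filterlim_snd)
qed

context
  fixes c :: "('m::topological_space, 'a::topological_space) chart"
  assumes c: "topological_chart c"
begin

lemma topological_chart_open: "open (fst c)" "open (snd c ` fst c)"
  using c by (auto simp: topological_chart_def)

lemma topological_chart_homeomorphism: "homeomorphism (fst c) (snd c ` fst c) (snd c) (chart_inv c)"
  using c by (simp add: topological_chart_def)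

lemma chart_inv_chart: "x \<in> fst c \<Longrightarrow> chart_inv c (snd c x) = x"
  by (rule homeomorphism_apply1[OF topological_chart_homeomorphism])

lemma eventually_in_chart: "x \<in> fst c \<Longrightarrow> \<forall>\<^sub>F y in nhds x. y \<in> fst c"
  by (rule eventually_nhds_in_open[OF topological_chart_open(1)])

lemma eventually_in_chart_image: "x \<in> fst c \<Longrightarrow> \<forall>\<^sub>F y in nhds (snd c x). y \<in> snd c ` fst c"
  by (rule eventually_nhds_in_open[OF topological_chart_open(2)]) simp

lemma tendsto_chart:
  assumes "x \<in> fst c"
  shows "(snd c \<longlongrightarrow> snd c x) (nhds x)"
proof -
  have "(snd c \<longlongrightarrow> snd c x) (at x within fst c)"
    using homeomorphism_cont1[OF topological_chart_homeomorphism] assms by (simp add: continuous_on_def)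
  then show ?thesis
    by (simp add: at_within_open[OF assms topological_chart_open(1)] tendsto_at_iff_tendsto_nhds)
qed

lemma tendsto_chart_inv:
  assumes "x \<in> fst c"
  shows "(chart_inv c \<longlongrightarrow> x) (nhds (snd c x))"
proof -
  have "(chart_inv c \<longlongrightarrow> chart_inv c (snd c x)) (at (snd c x) within snd c ` fst c)"
    using homeomorphism_cont2[OF topological_chart_homeomorphism] assms unfolding continuous_on_def by blast
  then have "(chart_inv c \<longlongrightarrow> chart_inv c (snd c x)) (nhds (snd c x))"
    using at_within_open[OF _ topological_chart_open(2), of "snd c x"] assms
    by (simp add: tendsto_at_iff_tendsto_nhds)
  then show ?thesis by (simp add: chart_inv_chart assms)
qed

end

lemma chart_chart_inv: "y \<in> snd c ` fst c \<Longrightarrow> snd c (chart_inv c y) = y"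
  unfolding chart_inv_def by (rule f_inv_into_f)

lemma chart_inv_in_chart: "y \<in> snd c ` fst c \<Longrightarrow> chart_inv c y \<in> fst c"
  unfolding chart_inv_def by (rule inv_into_into)

lemma charts_topological: "c \<in> charts A \<Longrightarrow> topological_chart c"
  by (simp add: charts_def)

lemma charts_atD: "c \<in> charts_at A x \<Longrightarrow> c \<in> charts A \<and> topological_chart c \<and> x \<in> fst c"
  by (auto simp: charts_at_def charts_topological)

lemma smooth_atlas_subset_charts: "smooth_atlas A \<Longrightarrow> A \<subseteq> charts A"
  by (auto simp: smooth_atlas_def charts_def)

lemma charts_at_nonempty:
  assumes "smooth_atlas A"
  obtains c where "c \<in> A" "c \<in> charts_at A x"
proof -
  have "x \<in> (\<Union>c\<in>A. fst c)" using assms by (simp add: smooth_atlas_def)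
  then show thesis using that smooth_atlas_subset_charts[OF assms] by (auto simp: charts_at_def)
qed


section \<open>Derivatives in charts\<close>

text \<open>Continuity of \<open>f\<close> is a separate clause because the values of
  \<open>snd c'\<close> outside \<open>fst c'\<close> are arbitrary, so the coordinate expression
  alone does not keep \<open>f\<close> near \<open>f x\<close>. The derivative is a parameter so
  that the chain rule can compute it.\<close>

definition has_chart_derivative ::
  "('m::topological_space, 'a::topological_real_vector) chart \<Rightarrow>
    ('n::topological_space, 'b::{real_vector, topological_space}) chart \<Rightarrow>
    ('m \<Rightarrow> 'n) \<Rightarrow> 'm \<Rightarrow> ('a \<Rightarrow> 'b) \<Rightarrow> bool"
  where "has_chart_derivative c c' f x D \<longleftrightarrow> x \<in> fst c \<and> f x \<in> fst c' \<and> (f \<longlongrightarrow> f x) (nhds x) \<and>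
    has_strict_derivative (snd c' \<circ> f \<circ> chart_inv c) D (snd c x)"

text \<open>The two coordinate expressions agree where \<open>f\<close> takes values in the chart
  \<open>c'\<close>, that is near \<open>x\<close> by continuity.\<close>

lemma has_chart_derivative_compose:
  assumes c: "topological_chart c" and c': "topological_chart c'"
    and f: "has_chart_derivative c c' f x D" and g: "has_chart_derivative c' c'' g (f x) D'"
  shows "has_chart_derivative c c'' (g \<circ> f) x (D' \<circ> D)"
proof -
  let ?F = "snd c' \<circ> f \<circ> chart_inv c" and ?G = "snd c'' \<circ> g \<circ> chart_inv c'"
  have x: "x \<in> fst c" "f x \<in> fst c'" "g (f x) \<in> fst c''"
    and F: "has_strict_derivative ?F D (snd c x)"
    and G: "has_strict_derivative ?G D' (snd c' (f x))"
    and fl: "(f \<longlongrightarrow> f x) (nhds x)" and gl: "(g \<longlongrightarrow> g (f x)) (nhds (f x))"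
    using f g by (auto simp: has_chart_derivative_def)
  have Fx: "?F (snd c x) = snd c' (f x)" by (simp add: chart_inv_chart[OF c x(1)])
  have fl': "((\<lambda>y. f (chart_inv c y)) \<longlongrightarrow> f x) (nhds (snd c x))"
    by (rule filterlim_compose[OF fl tendsto_chart_inv[OF c x(1)]])
  have "(?F \<longlongrightarrow> ?F (snd c x)) (nhds (snd c x))"
    using filterlim_compose[OF tendsto_chart[OF c' x(2)] fl'] by (simp only: Fx) (simp add: comp_def)
  then have "has_strict_derivative (?G \<circ> ?F) (D' \<circ> D) (snd c x)"
    by (rule has_strict_derivative_compose[OF F]) (simp only: Fx G)
  moreover have "\<forall>\<^sub>F y in nhds (snd c x). (?G \<circ> ?F) y = (snd c'' \<circ> (g \<circ> f) \<circ> chart_inv c) y"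
    using eventually_compose_filterlim[OF eventually_in_chart[OF c' x(2)] fl']
    by eventually_elim (simp add: chart_inv_chart[OF c'])
  ultimately have "has_strict_derivative (snd c'' \<circ> (g \<circ> f) \<circ> chart_inv c) (D' \<circ> D) (snd c x)"
    by (rule has_strict_derivative_transform)
  moreover have "((g \<circ> f) \<longlongrightarrow> (g \<circ> f) x) (nhds x)"
    using filterlim_compose[OF gl fl] by (simp add: comp_def)
  ultimately show ?thesis
    using x by (simp add: has_chart_derivative_def)
qed

definition prod_chart :: "('m, 'a) chart \<Rightarrow> ('n, 'b) chart \<Rightarrow> ('m \<times> 'n, 'a \<times> 'b) chart"
  where "prod_chart c c' = (fst c \<times> fst c', map_prod (snd c) (snd c'))"

lemma prod_chart_simps [simp]:
  "fst (prod_chart c c') = fst c \<times> fst c'" "snd (prod_chart c c') = map_prod (snd c) (snd c')"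
  by (simp_all add: prod_chart_def)

lemma chart_inv_prod_chart:
  assumes c: "topological_chart c" and c': "topological_chart c'"
    and y: "fst y \<in> snd c ` fst c" "snd y \<in> snd c' ` fst c'"
  shows "chart_inv (prod_chart c c') y = (chart_inv c (fst y), chart_inv c' (snd y))"
proof -
  have inj: "inj_on (snd (prod_chart c c')) (fst (prod_chart c c'))"
    using chart_inv_chart[OF c] chart_inv_chart[OF c'] by (auto simp: inj_on_def) metis+
  have "inv_into (fst (prod_chart c c')) (snd (prod_chart c c'))
      (snd (prod_chart c c') (chart_inv c (fst y), chart_inv c' (snd y))) = (chart_inv c (fst y), chart_inv c' (snd y))"
    using y by (intro inv_into_f_f[OF inj]) (simp add: chart_inv_in_chart)
  moreover have "snd (prod_chart c c') (chart_inv c (fst y), chart_inv c' (snd y)) = y"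
    using y by (simp add: chart_chart_inv)
  ultimately show ?thesis by (simp only: chart_inv_def)
qed

lemma topological_prod_chart:
  assumes c: "topological_chart c" and c': "topological_chart c'"
  shows "topological_chart (prod_chart c c')"
proof -
  have img: "map_prod (snd c) (snd c') ` (fst c \<times> fst c') = (snd c ` fst c) \<times> (snd c' ` fst c')"
    by (auto simp: image_iff)
  note h = topological_chart_homeomorphism[OF c] and h' = topological_chart_homeomorphism[OF c']
  have "homeomorphism (fst c \<times> fst c') ((snd c ` fst c) \<times> (snd c' ` fst c'))
      (map_prod (snd c) (snd c')) (chart_inv (prod_chart c c'))"
    unfolding homeomorphism_def
  proof (intro conjI ballI)
    fix x assume "x \<in> fst c \<times> fst c'"
    then show "chart_inv (prod_chart c c') (map_prod (snd c) (snd c') x) = x"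
      by (auto simp: chart_inv_prod_chart[OF c c'] chart_inv_chart[OF c] chart_inv_chart[OF c'])
  next
    fix y assume "y \<in> (snd c ` fst c) \<times> (snd c' ` fst c')"
    then show "map_prod (snd c) (snd c') (chart_inv (prod_chart c c') y) = y"
      by (auto simp: chart_inv_prod_chart[OF c c'] chart_inv_chart[OF c] chart_inv_chart[OF c'])
  next
    show "map_prod (snd c) (snd c') ` (fst c \<times> fst c') = (snd c ` fst c) \<times> (snd c' ` fst c')"
      by (rule img)
    show "chart_inv (prod_chart c c') ` ((snd c ` fst c) \<times> (snd c' ` fst c')) = fst c \<times> fst c'"
    proof
      show "chart_inv (prod_chart c c') ` ((snd c ` fst c) \<times> (snd c' ` fst c')) \<subseteq> fst c \<times> fst c'"
        by (auto simp: chart_inv_prod_chart[OF c c'] chart_inv_chart[OF c] chart_inv_chart[OF c'])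
      show "fst c \<times> fst c' \<subseteq> chart_inv (prod_chart c c') ` ((snd c ` fst c) \<times> (snd c' ` fst c'))"
      proof
        fix x assume "x \<in> fst c \<times> fst c'"
        then show "x \<in> chart_inv (prod_chart c c') ` ((snd c ` fst c) \<times> (snd c' ` fst c'))"
          by (intro image_eqI[of _ _ "map_prod (snd c) (snd c') x"])
             (auto simp: chart_inv_prod_chart[OF c c'] chart_inv_chart[OF c] chart_inv_chart[OF c'])
      qed
    qed
    show "continuous_on (fst c \<times> fst c') (map_prod (snd c) (snd c'))"
      unfolding map_prod_def case_prod_unfold
      by (intro continuous_on_Pair continuous_on_compose2[OF homeomorphism_cont1[OF h]]
          continuous_on_compose2[OF homeomorphism_cont1[OF h']] continuous_intros) auto
    have "continuous_on ((snd c ` fst c) \<times> (snd c' ` fst c')) (\<lambda>y. (chart_inv c (fst y), chart_inv c' (snd y)))"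
      by (intro continuous_on_Pair continuous_on_compose2[OF homeomorphism_cont2[OF h]]
          continuous_on_compose2[OF homeomorphism_cont2[OF h']] continuous_intros) auto
    then show "continuous_on ((snd c ` fst c) \<times> (snd c' ` fst c')) (chart_inv (prod_chart c c'))"
      by (rule continuous_on_eq) (auto simp: chart_inv_prod_chart[OF c c'])
  qed
  then show ?thesis
    unfolding topological_chart_def prod_chart_simps img
    by (intro conjI open_Times topological_chart_open[OF c] topological_chart_open[OF c'])
qed

lemma has_chart_derivative_Pair:
  assumes "has_chart_derivative c c1 f x D1" "has_chart_derivative c c2 g x D2"
  shows "has_chart_derivative c (prod_chart c1 c2) (\<lambda>x. (f x, g x)) x (\<lambda>w. (D1 w, D2 w))"
  using assms has_strict_derivative_Pair[of "snd c1 \<circ> f \<circ> chart_inv c" D1 _ "snd c2 \<circ> g \<circ> chart_inv c" D2]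
  by (auto simp: has_chart_derivative_def comp_def intro: tendsto_Pair)

lemma has_chart_derivative_const:
  "x \<in> fst c \<Longrightarrow> y \<in> fst c' \<Longrightarrow> has_chart_derivative c c' (\<lambda>_. y) x (\<lambda>_. 0)"
  by (simp add: has_chart_derivative_def comp_def has_strict_derivative_const)

context
  fixes c :: "('m::topological_space, 'a::topological_real_vector) chart"
    and c' :: "('n::topological_space, 'b::topological_real_vector) chart"
  assumes c: "topological_chart c" and c': "topological_chart c'"
begin

lemma
  assumes "fst z \<in> fst c" "snd z \<in> fst c'"
  shows has_chart_derivative_fst: "has_chart_derivative (prod_chart c c') c fst z fst"
    and has_chart_derivative_snd: "has_chart_derivative (prod_chart c c') c' snd z snd"
proof -
  have z: "z \<in> fst (prod_chart c c')" using assms by (cases z) auto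
  have ev: "\<forall>\<^sub>F y in nhds (snd (prod_chart c c') z). fst y = (snd c \<circ> fst \<circ> chart_inv (prod_chart c c')) y"
    "\<forall>\<^sub>F y in nhds (snd (prod_chart c c') z). snd y = (snd c' \<circ> snd \<circ> chart_inv (prod_chart c c')) y"
    by (rule eventually_mono[OF eventually_in_chart_image[OF topological_prod_chart[OF c c'] z]];
      auto simp: chart_inv_prod_chart[OF c c'] chart_inv_chart[OF c] chart_inv_chart[OF c'])+
  have "has_strict_derivative (snd c \<circ> fst \<circ> chart_inv (prod_chart c c')) fst (snd (prod_chart c c') z)"
    by (rule has_strict_derivative_transform[OF _ ev(1)], rule has_strict_derivative_linear)
       (auto intro: continuous_intros)
  then show "has_chart_derivative (prod_chart c c') c fst z fst"
    unfolding has_chart_derivative_def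
    using z assms by (auto intro: tendsto_fst filterlim_ident)
  have "has_strict_derivative (snd c' \<circ> snd \<circ> chart_inv (prod_chart c c')) snd (snd (prod_chart c c') z)"
    by (rule has_strict_derivative_transform[OF _ ev(2)], rule has_strict_derivative_linear)
       (auto intro: continuous_intros)
  then show "has_chart_derivative (prod_chart c c') c' snd z snd"
    unfolding has_chart_derivative_def
    using z assms by (auto intro: tendsto_snd filterlim_ident)
qed

end

lemma has_chart_derivative_id:
  assumes "topological_chart c" "x \<in> fst c"
  shows "has_chart_derivative c c (\<lambda>y. y) x (\<lambda>w. w)"
proof -
  have "\<forall>\<^sub>F y in nhds (snd c x). y = (snd c \<circ> (\<lambda>y. y) \<circ> chart_inv c) y"
    by (rule eventually_mono[OF eventually_in_chart_image[OF assms]]) (auto simp: chart_inv_chart[OF assms(1)])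
  then have "has_strict_derivative (snd c \<circ> (\<lambda>y. y) \<circ> chart_inv c) (\<lambda>w. w) (snd c x)"
    by (rule has_strict_derivative_transform[rotated], intro has_strict_derivative_linear) auto
  then show ?thesis using assms by (simp add: has_chart_derivative_def filterlim_ident)
qed

lemma dir_deriv_chart:
  fixes c :: "('m::topological_space, 'a::topological_real_vector) chart"
    and c' :: "('n::topological_space, 'b::{real_vector, t2_space}) chart"
  assumes "has_chart_derivative c c' f x D"
  shows "dir_deriv (snd c' \<circ> f \<circ> chart_inv c) (snd c x) w = D w"
  using assms dir_deriv_strict by (auto simp: has_chart_derivative_def)

text \<open>Membership in the maximal atlas gives compatibility with the charts of \<open>A\<close>;
  two arbitrary charts are linked through a chart of \<open>A\<close> around
  \<open>x\<close>.\<close>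

lemma has_chart_derivative_transition:
  fixes A :: "('m::topological_space, 'e::locally_convex_space) chart set"
  assumes A: "smooth_atlas A" and c: "c \<in> charts_at A x" and c': "c' \<in> charts_at A x"
  obtains D where "has_chart_derivative c c' (\<lambda>y. y) x D"
proof -
  obtain a where a: "a \<in> A" "a \<in> charts_at A x" using charts_at_nonempty[OF A] by blast
  have trans: "has_chart_derivative b b' (\<lambda>y. y) x (dir_deriv (snd b' \<circ> chart_inv b) (snd b x))"
    if "smooth_transition b b'" "b \<in> charts_at A x" "b' \<in> charts_at A x" for b b'
  proof -
    have "has_strict_derivative (snd b' \<circ> chart_inv b) (dir_deriv (snd b' \<circ> chart_inv b) (snd b x)) (snd b x)"
      using that by (intro Ck_on_has_strict_derivative[of \<infinity>]) (auto simp: smooth_transition_def dest: charts_atD)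
    then show ?thesis
      using that by (auto simp: has_chart_derivative_def comp_def filterlim_ident dest: charts_atD)
  qed
  have "smooth_transition c a" "smooth_transition a c'"
    using a c c' by (auto simp: charts_at_def charts_def)
  then have "has_chart_derivative c c' ((\<lambda>y. y) \<circ> (\<lambda>y. y)) x
      (dir_deriv (snd c' \<circ> chart_inv a) (snd a x) \<circ> dir_deriv (snd a \<circ> chart_inv c) (snd c x))"
    using a c c' by (intro has_chart_derivative_compose[of c a] trans) (auto dest: charts_atD)
  then show thesis using that by (simp add: comp_def)
qed

lemma Ck_map_has_chart_derivative:
  fixes A :: "('m::topological_space, 'a::{topological_real_vector, t2_space}) chart set"
    and B :: "('n::topological_space, 'e::locally_convex_space) chart set"
  assumes f: "Ck_map_on k A B S f" "1 \<le> k" and "x \<in> S"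
    and c: "c \<in> charts_at A x" and c': "c' \<in> charts_at B (f x)"
  obtains D where "has_chart_derivative c c' f x D"
proof -
  have C: "Ck_on k (snd c ` (fst c \<inter> S \<inter> f -` fst c')) (snd c' \<circ> f \<circ> chart_inv c)"
    and S: "open S" and cont: "continuous_on S f"
    using f c c' by (auto simp: Ck_map_on_def charts_at_def)
  have x: "x \<in> fst c" "f x \<in> fst c'" using c c' by (auto dest: charts_atD)
  then have "snd c x \<in> snd c ` (fst c \<inter> S \<inter> f -` fst c')" using \<open>x \<in> S\<close> by auto
  note Ck_on_has_strict_derivative[OF C f(2) this]
  moreover have "(f \<longlongrightarrow> f x) (nhds x)"
    using cont \<open>x \<in> S\<close> at_within_open[OF \<open>x \<in> S\<close> S]
    by (auto simp: continuous_on_def tendsto_at_iff_tendsto_nhds)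
  ultimately show thesis
    using x that unfolding has_chart_derivative_def by blast
qed

text \<open>Smoothness of multiplication is tested in the maximal atlas of the product. This makes
  products of arbitrary charts of \<open>G\<close> available, not only those of charts in the given
  atlas.\<close>

lemma prod_chart_in_charts:
  fixes A :: "('m::topological_space, 'a::{topological_real_vector, t2_space}) chart set"
    and B :: "('n::topological_space, 'b::{topological_real_vector, t2_space}) chart set"
  assumes A: "smooth_atlas A" and B: "smooth_atlas B" and c: "c \<in> charts A" and c': "c' \<in> charts B"
  shows "prod_chart c c' \<in> charts (prod_atlas A B)"
proof -
  have trans: "smooth_transition (prod_chart a a') (prod_chart b b')"
    if s: "smooth_transition a b" "smooth_transition a' b'"
      and t: "topological_chart a" "topological_chart a'"
    for a b :: "('m, 'a) chart" and a' b' :: "('n, 'b) chart"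
  proof -
    have eq: "snd (prod_chart a a') ` (fst (prod_chart a a') \<inter> fst (prod_chart b b'))
        = (snd a ` (fst a \<inter> fst b)) \<times> (snd a' ` (fst a' \<inter> fst b'))"
      by (auto simp: image_iff)
    show ?thesis
      unfolding smooth_transition_def eq
      by (rule Ck_on_cong[OF Ck_on_map_prod[OF s[unfolded smooth_transition_def]]])
         (auto simp: chart_inv_prod_chart[OF t])
  qed
  have "smooth_transition (prod_chart c c') d \<and> smooth_transition d (prod_chart c c')"
    if "d \<in> prod_atlas A B" for d
  proof -
    obtain a a' where a: "a \<in> A" "a' \<in> B" "d = prod_chart a a'"
      using \<open>d \<in> _\<close> by (auto simp: prod_atlas_def prod_chart_def)
    then have "topological_chart a" "topological_chart a'"
      using A B unfolding smooth_atlas_def by blast+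
    then show ?thesis
      using a c c' by (auto simp: charts_def intro!: trans)
  qed
  then show ?thesis
    using topological_prod_chart[of c c'] c c' unfolding charts_def by blast
qed

lemma real_chart_in_charts: "(UNIV, id) \<in> charts real_atlas"
proof -
  have "chart_inv (UNIV, id :: real \<Rightarrow> real) = id"
    by (auto simp: chart_inv_def fun_eq_iff)
  then show ?thesis
    using Ck_on_real_id[of \<infinity>] homeomorphism_ident[of "UNIV :: real set"]
    by (auto simp: charts_def topological_chart_def smooth_transition_def id_def comp_def)
qed


section \<open>Tangent vectors and velocities\<close>

text \<open>\<open>tangent_map\<close> reads its argument in a chart picked by \<open>SOME\<close>.
  The transformation rule for \<open>X\<close> and the chain rule show that any other chart gives
  the same value.\<close>

lemma tangent_map_apply:
  fixes A :: "('m::topological_space, 'a::locally_convex_space) chart set"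
    and B :: "('n::topological_space, 'b::{real_vector, t2_space}) chart set"
  assumes A: "smooth_atlas A" and X: "X \<in> tangent_space A x"
    and c: "c \<in> charts_at A x" and c': "c' \<in> charts_at B (f x)"
    and f: "has_chart_derivative c c' f x D"
  shows "tangent_map A B f x X c' = D (X c)"
proof -
  define d where "d = (SOME c. c \<in> charts_at A x)"
  have d: "d \<in> charts_at A x" unfolding d_def using c by (rule someI)
  obtain E where E: "has_chart_derivative d c (\<lambda>y. y) x E"
    using has_chart_derivative_transition[OF A d c] by blast
  have "has_chart_derivative d c' (f \<circ> (\<lambda>y. y)) x (D \<circ> E)"
    using d c by (intro has_chart_derivative_compose[OF _ _ E f]) (auto dest: charts_atD)
  then have "dir_deriv (snd c' \<circ> f \<circ> chart_inv d) (snd d x) (X d) = D (E (X d))"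
    using dir_deriv_chart[of d c' "f \<circ> (\<lambda>y. y)"] by (simp add: comp_def)
  moreover have "X c = dir_deriv (snd c \<circ> chart_inv d) (snd d x) (X d)"
    using X d c unfolding tangent_space_def by blast
  then have "X c = E (X d)"
    using dir_deriv_chart[OF E] by (simp add: comp_def)
  ultimately show ?thesis
    using c' by (simp add: tangent_map_def d_def[symmetric] Let_def)
qed

lemma tangent_map_in_tangent_space:
  fixes A :: "('m::topological_space, 'a::locally_convex_space) chart set"
    and B :: "('n::topological_space, 'b::locally_convex_space) chart set"
  assumes A: "smooth_atlas A" and B: "smooth_atlas B" and X: "X \<in> tangent_space A x"
    and f: "\<And>c c'. c \<in> charts_at A x \<Longrightarrow> c' \<in> charts_at B (f x) \<Longrightarrow> \<exists>D. has_chart_derivative c c' f x D"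
  shows "tangent_map A B f x X \<in> tangent_space B (f x)"
proof -
  obtain c where c: "c \<in> charts_at A x" using charts_at_nonempty[OF A] by blast
  have "tangent_map A B f x X c2 = dir_deriv (snd c2 \<circ> chart_inv c1) (snd c1 (f x)) (tangent_map A B f x X c1)"
    if c12: "c1 \<in> charts_at B (f x)" "c2 \<in> charts_at B (f x)" for c1 c2
  proof -
    obtain D where D: "has_chart_derivative c c1 f x D" using f[OF c c12(1)] by blast
    obtain E where E: "has_chart_derivative c1 c2 (\<lambda>y. y) (f x) E"
      using has_chart_derivative_transition[OF B c12] by blast
    have "has_chart_derivative c c2 ((\<lambda>y. y) \<circ> f) x (E \<circ> D)"
      using c c12 by (intro has_chart_derivative_compose[OF _ _ D E]) (auto dest: charts_atD)
    then have "tangent_map A B f x X c2 = E (D (X c))"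
      using tangent_map_apply[where f = f and D = "E \<circ> D", OF A X c c12(2)] by (simp add: comp_def)
    then show ?thesis
      using tangent_map_apply[where f = f, OF A X c c12(1) D] dir_deriv_chart[OF E] by (simp add: comp_def)
  qed
  moreover have "tangent_map A B f x X c = 0" if "c \<notin> charts_at B (f x)" for c
    using that by (simp add: tangent_map_def Let_def)
  ultimately show ?thesis unfolding tangent_space_def by blast
qed

text \<open>One notion for two purposes: with \<open>{0..1}\<close> for velocities along curves,
  one-sided at the ends, and with \<open>UNIV\<close> for the derivative in \<open>h\<close>. The
  clause on nearby values keeps the quotient meaningful, as charts are total functions.\<close>

definition chart_velocity ::
  "('m, 'e::{real_vector, topological_space}) chart \<Rightarrow> (real \<Rightarrow> 'm) \<Rightarrow> real \<Rightarrow> real set \<Rightarrow> 'e \<Rightarrow> bool"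
  where "chart_velocity c \<mu> t S v \<longleftrightarrow> \<mu> t \<in> fst c \<and> (\<forall>\<^sub>F s in at t within S. \<mu> s \<in> fst c) \<and>
    (curve_quotient (snd c) \<mu> t \<longlongrightarrow> v) (at t within S)"

text \<open>Multiplying the quotient by \<open>s - t\<close> shows that the coordinates converge;
  the inverse chart carries this back to the manifold.\<close>

lemma chart_velocity_tendsto:
  fixes c :: "('m::topological_space, 'e::topological_real_vector) chart"
  assumes "topological_chart c" "chart_velocity c \<mu> t S v"
  shows "(\<mu> \<longlongrightarrow> \<mu> t) (at t within S)"
proof -
  have v: "\<mu> t \<in> fst c" "\<forall>\<^sub>F s in at t within S. \<mu> s \<in> fst c"
    "(curve_quotient (snd c) \<mu> t \<longlongrightarrow> v) (at t within S)"
    using assms by (auto simp: chart_velocity_def)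
  have "((\<lambda>s. s - t) \<longlongrightarrow> t - t) (at t within S)" by (intro tendsto_intros)
  then have "((\<lambda>s. (s - t) *\<^sub>R curve_quotient (snd c) \<mu> t s + snd c (\<mu> t)) \<longlongrightarrow> (t - t) *\<^sub>R v + snd c (\<mu> t))
      (at t within S)"
    by (intro tendsto_add tendsto_scaleR_tvs tendsto_const v)
  then have "((\<lambda>s. snd c (\<mu> s)) \<longlongrightarrow> snd c (\<mu> t)) (at t within S)"
    by (simp, elim Lim_transform_eventually) (auto simp: curve_quotient_def eventually_at_filter)
  then have "((\<lambda>s. chart_inv c (snd c (\<mu> s))) \<longlongrightarrow> \<mu> t) (at t within S)"
    by (rule filterlim_compose[OF tendsto_chart_inv[OF assms(1) v(1)]])
  then show ?thesis
    by (rule Lim_transform_eventually)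
      (use v(2) in \<open>eventually_elim, simp add: chart_inv_chart[OF assms(1)]\<close>)
qed

text \<open>The coordinates at \<open>s\<close> are those at \<open>t\<close> plus
  \<open>s - t\<close> times the difference quotient, which tends to \<open>v\<close>: this is the
  moving direction that strict derivatives allow.\<close>

lemma chart_velocity_compose:
  fixes c :: "('m::topological_space, 'a::topological_real_vector) chart"
  assumes c: "topological_chart c" and c': "topological_chart c'"
    and \<mu>: "chart_velocity c \<mu> t S v" and f: "has_chart_derivative c c' f (\<mu> t) D"
  shows "chart_velocity c' (\<lambda>s. f (\<mu> s)) t S (D v)"
proof -
  let ?F = "snd c' \<circ> f \<circ> chart_inv c"
  have v: "\<mu> t \<in> fst c" "\<forall>\<^sub>F s in at t within S. \<mu> s \<in> fst c"
    "(curve_quotient (snd c) \<mu> t \<longlongrightarrow> v) (at t within S)"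
    using \<mu> by (auto simp: chart_velocity_def)
  have F: "f (\<mu> t) \<in> fst c'" "(f \<longlongrightarrow> f (\<mu> t)) (nhds (\<mu> t))"
    "has_strict_derivative ?F D (snd c (\<mu> t))"
    using f by (auto simp: has_chart_derivative_def)
  have ft: "((\<lambda>s. f (\<mu> s)) \<longlongrightarrow> f (\<mu> t)) (at t within S)"
    by (rule filterlim_compose[OF F(2) chart_velocity_tendsto[OF c \<mu>]])
  have "filterlim (\<lambda>s. s - t) (at 0) (at t within S)"
    by (auto simp: filterlim_at eventually_at_filter intro!: tendsto_eq_intros)
  from has_strict_derivativeD[OF F(3) tendsto_const this v(3)]
  have "(curve_quotient (snd c') (\<lambda>s. f (\<mu> s)) t \<longlongrightarrow> D v) (at t within S)"
  proof (rule Lim_transform_eventually)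
    have "\<forall>\<^sub>F s in at t within S. s \<noteq> t" by (simp add: eventually_at_filter)
    with v(2) show "\<forall>\<^sub>F s in at t within S.
        (1 / (s - t)) *\<^sub>R (?F (snd c (\<mu> t) + (s - t) *\<^sub>R curve_quotient (snd c) \<mu> t s) - ?F (snd c (\<mu> t))) =
        curve_quotient (snd c') (\<lambda>s. f (\<mu> s)) t s"
      by eventually_elim (simp add: curve_quotient_def chart_inv_chart[OF c] v(1))
  qed
  then show ?thesis
    using F(1) topological_tendstoD[OF ft topological_chart_open(1)[OF c'] F(1)]
    by (simp add: chart_velocity_def)
qed

lemma chart_velocity_Pair:
  assumes "chart_velocity c \<mu> t S v" "chart_velocity c' \<nu> t S w"
  shows "chart_velocity (prod_chart c c') (\<lambda>s. (\<mu> s, \<nu> s)) t S (v, w)"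
  using assms tendsto_Pair[of "curve_quotient (snd c) \<mu> t" v "at t within S" "curve_quotient (snd c') \<nu> t" w]
  by (auto simp: chart_velocity_def curve_quotient_def[abs_def] elim: eventually_elim2)

lemma chart_velocity_const: "x \<in> fst c \<Longrightarrow> chart_velocity c (\<lambda>_. x) t S 0"
  by (simp add: chart_velocity_def curve_quotient_def[abs_def])

lemma chart_velocity_cong:
  assumes "chart_velocity c \<mu> t S v" "\<And>s. s \<in> S \<Longrightarrow> \<mu> s = \<nu> s" "t \<in> S"
  shows "chart_velocity c \<nu> t S v"
proof -
  have ev: "\<forall>\<^sub>F s in at t within S. \<mu> s = \<nu> s"
    using assms(2) by (simp add: eventually_at_filter)
  have "\<forall>\<^sub>F s in at t within S. \<nu> s \<in> fst c"
    using assms(1) ev unfolding chart_velocity_def by (auto elim: eventually_elim2)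
  moreover have "\<forall>\<^sub>F s in at t within S. curve_quotient (snd c) \<mu> t s = curve_quotient (snd c) \<nu> t s"
    using ev by eventually_elim (simp add: curve_quotient_def assms(2)[OF assms(3)])
  then have "(curve_quotient (snd c) \<nu> t \<longlongrightarrow> v) (at t within S)"
    using assms(1) by (auto simp: chart_velocity_def intro: Lim_transform_eventually)
  ultimately show ?thesis using assms by (auto simp: chart_velocity_def)
qed

lemma velocity_apply:
  assumes "chart_velocity c \<mu> t S v" "c \<in> charts_at A (\<mu> t)" "at t within S \<noteq> bot"
  shows "velocity A S \<mu> t c = v"
  using assms by (auto simp: velocity_def chart_velocity_def intro: tendsto_Lim)

text \<open>The velocity is the derivative of an extension \<open>\<nu>\<close> to an open interval,
  applied to the velocity 1 of the identity curve.\<close>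

lemma C1_curve_chart_velocity:
  fixes A :: "('m::topological_space, 'e::locally_convex_space) chart set"
  assumes "C1_curve A \<mu>" and t: "t \<in> {0..1}" and c: "c \<in> charts_at A (\<mu> t)"
  obtains v where "chart_velocity c \<mu> t {0..1} v"
proof -
  obtain a b \<nu> where ab: "a < 0" "1 < b" and \<nu>: "Ck_map_on 1 real_atlas A {a<..<b} \<nu>"
    and eq: "\<And>t. t \<in> {0..1} \<Longrightarrow> \<mu> t = \<nu> t"
    using assms(1) unfolding C1_curve_def by metis
  have r: "(UNIV, id) \<in> charts_at real_atlas t"
    using real_chart_in_charts by (simp add: charts_at_def)
  obtain D where D: "has_chart_derivative (UNIV, id) c \<nu> t D"
    by (rule Ck_map_has_chart_derivative[OF \<nu> _ _ r, of c]) (use c t ab eq in auto)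
  have "(curve_quotient (id :: real \<Rightarrow> real) (\<lambda>s. s) t \<longlongrightarrow> 1) (at t within {0..1})"
    by (rule tendsto_eventually) (auto simp: curve_quotient_def eventually_at_filter)
  then have "chart_velocity (UNIV, id) (\<lambda>s. s) t {0..1} (1::real)"
    by (simp add: chart_velocity_def)
  then have "chart_velocity c (\<lambda>s. \<nu> s) t {0..1} (D 1)"
    using r c by (intro chart_velocity_compose[where f = \<nu> and \<mu> = "\<lambda>s. s", OF _ _ _ D]) (auto dest: charts_atD)
  then show thesis
    using that chart_velocity_cong[of c \<nu> t "{0..1}" _ \<mu>] eq t by auto
qed


text \<open>Chart derivatives at all nearby points already force joint continuity of the coordinate
  derivative. This is used for chart changes, for multiplication and for conjugation.\<close>

lemma tendsto_chart_dir_deriv: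
  fixes a :: "('m::topological_space, 'a::topological_real_vector) chart"
    and c :: "('n::topological_space, 'b::{topological_real_vector, t2_space}) chart"
  assumes a: "topological_chart a" and c: "topological_chart c"
    and x: "x \<in> fst a" "f x \<in> fst c" and f: "(f \<longlongrightarrow> f x) (nhds x)"
    and deriv: "\<And>z. z \<in> fst a \<Longrightarrow> f z \<in> fst c \<Longrightarrow> \<exists>D. has_chart_derivative a c f z D"
  shows "((\<lambda>u. dir_deriv (snd c \<circ> f \<circ> chart_inv a) (fst u) (snd u)) \<longlongrightarrow>
    dir_deriv (snd c \<circ> f \<circ> chart_inv a) (snd a x) w) (nhds (snd a x) \<times>\<^sub>F nhds w)"
proof (rule tendsto_strict_derivative)
  let ?F = "snd c \<circ> f \<circ> chart_inv a"
  have "\<forall>\<^sub>F z in nhds x. f z \<in> fst c"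
    by (rule eventually_compose_filterlim[OF eventually_in_chart[OF c x(2)] f])
  then have "\<forall>\<^sub>F y in nhds (snd a x). f (chart_inv a y) \<in> fst c"
    by (rule eventually_compose_filterlim[OF _ tendsto_chart_inv[OF a x(1)]])
  moreover have "\<forall>\<^sub>F y in nhds (snd a x). y \<in> snd a ` fst a"
    by (rule eventually_in_chart_image[OF a x(1)])
  ultimately show "\<forall>\<^sub>F y in nhds (snd a x). has_strict_derivative ?F (dir_deriv ?F y) y"
  proof eventually_elim
    case (elim y)
    then obtain z where z: "z \<in> fst a" "y = snd a z" "f z \<in> fst c"
      by (auto simp: chart_inv_chart[OF a])
    then obtain D where D: "has_chart_derivative a c f z D" using deriv by blast
    then have "dir_deriv ?F y = D" using dir_deriv_chart[OF D] z by auto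
    then show ?case using D z by (simp add: has_chart_derivative_def)
  qed
qed

text \<open>The inverse of the coordinate isomorphism \<open>X \<mapsto> X c\<close> of the tangent space at \<open>x\<close>.\<close>

definition tangent_of ::
  "('m::topological_space, 'e::{real_vector, t2_space}) chart set \<Rightarrow> 'm \<Rightarrow> ('m, 'e) chart \<Rightarrow> 'e \<Rightarrow> ('m, 'e) tangent"
  where "tangent_of A x c v =
    (\<lambda>c'. if c' \<in> charts_at A x then dir_deriv (snd c' \<circ> chart_inv c) (snd c x) v else 0)"

context
  fixes A :: "('m::topological_space, 'e::locally_convex_space) chart set" and x c
  assumes A: "smooth_atlas A" and c: "c \<in> charts_at A x"
begin

lemma tangent_of_eq:
  assumes "c' \<in> charts_at A x" "has_chart_derivative c c' (\<lambda>y. y) x D"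
  shows "tangent_of A x c v c' = D v"
  using assms dir_deriv_chart[OF assms(2)] by (simp add: tangent_of_def comp_def)

lemma tangent_of_apply: "tangent_of A x c v c = v"
  using c by (intro tangent_of_eq[where D = "\<lambda>w. w"] has_chart_derivative_id) (auto dest: charts_atD)

lemma tangent_of_in_tangent_space: "tangent_of A x c v \<in> tangent_space A x"
proof -
  have "tangent_of A x c v c2 = dir_deriv (snd c2 \<circ> chart_inv c1) (snd c1 x) (tangent_of A x c v c1)"
    if c12: "c1 \<in> charts_at A x" "c2 \<in> charts_at A x" for c1 c2
  proof -
    obtain D where D: "has_chart_derivative c c1 (\<lambda>y. y) x D"
      using has_chart_derivative_transition[OF A c c12(1)] by blast
    obtain E where E: "has_chart_derivative c1 c2 (\<lambda>y. y) x E"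
      using has_chart_derivative_transition[OF A c12] by blast
    have "has_chart_derivative c c2 ((\<lambda>y. y) \<circ> (\<lambda>y. y)) x (E \<circ> D)"
      using c c12 by (intro has_chart_derivative_compose[OF _ _ D E]) (auto dest: charts_atD)
    then have "tangent_of A x c v c2 = E (D v)"
      using tangent_of_eq[OF c12(2), of "E \<circ> D"] by (simp add: comp_def)
    then show ?thesis
      using tangent_of_eq[OF c12(1) D] dir_deriv_chart[OF E] by (simp add: comp_def)
  qed
  moreover have "tangent_of A x c v c' = 0" if "c' \<notin> charts_at A x" for c'
    using that by (simp add: tangent_of_def)
  ultimately show ?thesis unfolding tangent_space_def by blast
qed

lemma tangent_of_coordinate:
  assumes "X \<in> tangent_space A x"
  shows "tangent_of A x c (X c) = X"
proof
  fix c'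
  show "tangent_of A x c (X c) c' = X c'"
  proof (cases "c' \<in> charts_at A x")
    case True
    then have "X c' = dir_deriv (snd c' \<circ> chart_inv c) (snd c x) (X c)"
      using assms c unfolding tangent_space_def by blast
    then show ?thesis using True by (simp add: tangent_of_def)
  next
    case False
    then have "X c' = 0" using assms unfolding tangent_space_def by blast
    then show ?thesis using False by (simp add: tangent_of_def)
  qed
qed

text \<open>Tangent vectors are families of coordinates with pointwise operations and the product
  topology, so all three claims are checked in each coordinate \<open>c'\<close>, where the map is
  the derivative of a chart change.\<close>

lemma tangent_of_linear:
  shows tangent_of_add: "tangent_of A x c (v + w) = tangent_of A x c v + tangent_of A x c w"
    and tangent_of_scaleR: "tangent_of A x c (r *\<^sub>R v) = r *\<^sub>R tangent_of A x c v"
    and tangent_of_continuous: "continuous_on UNIV (tangent_of A x c)"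
proof -
  have lin: "(\<forall>v w. tangent_of A x c (v + w) c' = tangent_of A x c v c' + tangent_of A x c w c') \<and>
      (\<forall>r v. tangent_of A x c (r *\<^sub>R v) c' = r *\<^sub>R tangent_of A x c v c') \<and>
      continuous_on UNIV (\<lambda>v. tangent_of A x c v c')" for c'
  proof (cases "c' \<in> charts_at A x")
    case True
    obtain D where D: "has_chart_derivative c c' (\<lambda>y. y) x D"
      using has_chart_derivative_transition[OF A c True] by blast
    then have s: "has_strict_derivative (snd c' \<circ> (\<lambda>y. y) \<circ> chart_inv c) D (snd c x)"
      by (simp add: has_chart_derivative_def)
    have "((\<lambda>u. dir_deriv (snd c' \<circ> (\<lambda>y. y) \<circ> chart_inv c) (fst u) (snd u)) \<longlongrightarrow>
      dir_deriv (snd c' \<circ> (\<lambda>y. y) \<circ> chart_inv c) (snd c x) w) (nhds (snd c x) \<times>\<^sub>F nhds w)" for w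
    proof (rule tendsto_chart_dir_deriv)
      fix z assume "z \<in> fst c" "z \<in> fst c'"
      then have "c \<in> charts_at A z" "c' \<in> charts_at A z"
        using c True by (auto simp: charts_at_def)
      then show "\<exists>D. has_chart_derivative c c' (\<lambda>y. y) z D"
        using has_chart_derivative_transition[OF A] by blast
    qed (use c True in \<open>auto dest: charts_atD intro: filterlim_ident\<close>)
    \<comment> \<open>Freezing the base point in the joint limit leaves continuity in the
      direction.\<close>
    from filterlim_compose[OF this filterlim_Pair[OF tendsto_const filterlim_ident]]
    have "(D \<longlongrightarrow> D w) (nhds w)" for w
      by (simp add: dir_deriv_chart[OF D, simplified])
    then have "continuous_on UNIV D"
      by (simp add: continuous_on_def tendsto_at_iff_tendsto_nhds)
    then show ?thesis
      unfolding tangent_of_eq[OF True D]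
      using strict_derivative_add[OF s] strict_derivative_scaleR[OF s] by simp
  qed (simp add: tangent_of_def)
  show "tangent_of A x c (v + w) = tangent_of A x c v + tangent_of A x c w"
    using lin by (simp add: fun_eq_iff)
  show "tangent_of A x c (r *\<^sub>R v) = r *\<^sub>R tangent_of A x c v"
    using lin by (simp add: fun_eq_iff scaleR_fun_def)
  show "continuous_on UNIV (tangent_of A x c)"
    using lin by (intro continuous_on_coordinatewise_then_product) blast
qed

text \<open>The coordinate \<open>c\<close> identifies the tangent space with \<open>E\<close>, so a
  completion of one is a completion of the other. The inverse is that of \<open>\<kappa>\<close>
  followed by evaluation at \<open>c\<close>, a continuous projection.\<close>

lemma is_completion_tangent_of:
  assumes \<kappa>: "is_completion (tangent_space A x) \<kappa>"
  shows "is_completion UNIV (\<lambda>v. \<kappa> (tangent_of A x c v))"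
proof -
  let ?T = "tangent_of A x c" and ?S = "tangent_space A x"
  have range_T: "range ?T = ?S"
    using tangent_of_in_tangent_space tangent_of_coordinate by (auto intro: range_eqI[OF sym])
  then have range_\<kappa>: "range (\<lambda>v. \<kappa> (?T v)) = \<kappa> ` ?S"
    by (simp add: range_T[symmetric] image_image)
  have h: "homeomorphism ?S (\<kappa> ` ?S) \<kappa> (inv_into ?S \<kappa>)"
    using \<kappa> by (simp add: is_completion_def)
  have left: "inv_into ?S \<kappa> (\<kappa> (?T v)) c = v" for v
    by (simp add: homeomorphism_apply1[OF h] tangent_of_in_tangent_space tangent_of_apply)
  then have inj: "inj (\<lambda>v. \<kappa> (?T v))" by (rule inj_on_inverseI)
  have "homeomorphism UNIV (\<kappa> ` ?S) (\<lambda>v. \<kappa> (?T v)) (inv_into UNIV (\<lambda>v. \<kappa> (?T v)))"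
    unfolding homeomorphism_def
  proof (intro conjI ballI)
    show "continuous_on UNIV (\<lambda>v. \<kappa> (?T v))"
      by (rule continuous_on_compose2[OF homeomorphism_cont1[OF h] tangent_of_continuous])
        (simp add: range_T)
    have "continuous_on (\<kappa> ` ?S) (\<lambda>y. inv_into ?S \<kappa> y c)"
      by (rule continuous_on_product_then_coordinatewise[OF homeomorphism_cont2[OF h]])
    then show "continuous_on (\<kappa> ` ?S) (inv_into UNIV (\<lambda>v. \<kappa> (?T v)))"
      by (rule continuous_on_eq) (use inv_into_f_f[OF inj] left in \<open>auto simp flip: range_\<kappa>\<close>)
    show "\<kappa> (?T (inv_into UNIV (\<lambda>v. \<kappa> (?T v)) y)) = y" if "y \<in> \<kappa> ` ?S" for y
      using f_inv_into_f[of y "\<lambda>v. \<kappa> (?T v)" UNIV] that by (simp add: range_\<kappa>)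
    show retract: "inv_into UNIV (\<lambda>v. \<kappa> (?T v)) (\<kappa> (?T v)) = v" for v
      using inv_into_f_f[OF inj, of v] by simp
    show "inv_into UNIV (\<lambda>v. \<kappa> (?T v)) ` \<kappa> ` ?S = UNIV"
      by (simp add: range_\<kappa>[symmetric] image_image retract)
  qed (rule range_\<kappa>)
  then show ?thesis
    using \<kappa> unfolding is_completion_def range_\<kappa>
    by (simp add: tangent_of_add tangent_of_scaleR tangent_of_in_tangent_space)
qed

end


section \<open>Lie groups\<close>

context lie_group
begin

section \<open>Differentiability and continuity of the group operations in charts\<close>

lemma in_carrier [simp]: "g \<in> carrier G"
  by (simp add: carrier_UNIV)

lemma mult_cancel: "x \<otimes> (inv x \<otimes> y) = y" "inv x \<otimes> (x \<otimes> y) = y"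
  by (simp_all flip: m_assoc)

definition differentiable_in where
  "differentiable_in a f x \<longleftrightarrow> (\<forall>c\<in>charts_at (atlas G) (f x). \<exists>D. has_chart_derivative a c f x D)"

lemma differentiable_inE:
  assumes "differentiable_in a f x"
  obtains c D where "c \<in> charts_at (atlas G) (f x)" "has_chart_derivative a c f x D"
  using assms charts_at_nonempty[OF smooth_atlas] unfolding differentiable_in_def by metis

lemma differentiable_in_tendsto: "differentiable_in a f x \<Longrightarrow> (f \<longlongrightarrow> f x) (nhds x)"
  by (erule differentiable_inE) (simp add: has_chart_derivative_def)

lemma mult_has_chart_derivative:
  assumes "c1 \<in> charts_at (atlas G) (fst z)" "c2 \<in> charts_at (atlas G) (snd z)"
    "c3 \<in> charts_at (atlas G) (fst z \<otimes> snd z)"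
  obtains D where "has_chart_derivative (prod_chart c1 c2) c3 (\<lambda>z. fst z \<otimes> snd z) z D"
proof (rule Ck_map_has_chart_derivative)
  show "Ck_map_on \<infinity> (prod_atlas (atlas G) (atlas G)) (atlas G) UNIV (\<lambda>z. fst z \<otimes> snd z)"
    using smooth_mult by (simp add: case_prod_unfold)
  show "prod_chart c1 c2 \<in> charts_at (prod_atlas (atlas G) (atlas G)) z"
    using assms prod_chart_in_charts[OF smooth_atlas smooth_atlas, of c1 c2]
    by (cases z) (auto simp: charts_at_def)
qed (use assms that in auto)

lemma differentiable_in_mult:
  assumes a: "topological_chart a" and f: "differentiable_in a f x" and g: "differentiable_in a g x"
  shows "differentiable_in a (\<lambda>x. f x \<otimes> g x) x"
  unfolding differentiable_in_def
proof
  fix c assume c: "c \<in> charts_at (atlas G) (f x \<otimes> g x)"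
  obtain c1 D1 where 1: "c1 \<in> charts_at (atlas G) (f x)" "has_chart_derivative a c1 f x D1"
    using differentiable_inE[OF f] by blast
  obtain c2 D2 where 2: "c2 \<in> charts_at (atlas G) (g x)" "has_chart_derivative a c2 g x D2"
    using differentiable_inE[OF g] by blast
  obtain D where "has_chart_derivative (prod_chart c1 c2) c (\<lambda>z. fst z \<otimes> snd z) (f x, g x) D"
    using mult_has_chart_derivative[of c1 "(f x, g x)" c2 c] 1 2 c by auto
  from has_chart_derivative_compose[OF a topological_prod_chart has_chart_derivative_Pair[OF 1(2) 2(2)] this] 1 2
  show "\<exists>D. has_chart_derivative a c (\<lambda>x. f x \<otimes> g x) x D"
    by (auto simp: comp_def dest: charts_atD)
qed

lemma differentiable_in_inv:
  assumes a: "topological_chart a" and f: "differentiable_in a f x"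
  shows "differentiable_in a (\<lambda>x. inv (f x)) x"
  unfolding differentiable_in_def
proof
  fix c assume c: "c \<in> charts_at (atlas G) (inv (f x))"
  obtain c1 D1 where 1: "c1 \<in> charts_at (atlas G) (f x)" "has_chart_derivative a c1 f x D1"
    using differentiable_inE[OF f] by blast
  obtain D where "has_chart_derivative c1 c (\<lambda>x. inv x) (f x) D"
    by (rule Ck_map_has_chart_derivative[OF smooth_inv _ _ 1(1) c]) auto
  from has_chart_derivative_compose[OF a _ 1(2) this] 1
  show "\<exists>D. has_chart_derivative a c (\<lambda>x. inv (f x)) x D"
    by (auto simp: comp_def dest: charts_atD)
qed

lemma differentiable_in_const: "x \<in> fst a \<Longrightarrow> differentiable_in a (\<lambda>_. g) x"
  unfolding differentiable_in_def using has_chart_derivative_const charts_atD by blast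

lemma differentiable_in_id: "a \<in> charts_at (atlas G) x \<Longrightarrow> differentiable_in a (\<lambda>x. x) x"
  unfolding differentiable_in_def using has_chart_derivative_transition[OF smooth_atlas] by metis

lemma differentiable_in_chartI:
  assumes "topological_chart a" "has_chart_derivative a c f x D" "c \<in> charts_at (atlas G) (f x)"
  shows "differentiable_in a f x"
  unfolding differentiable_in_def
proof
  fix c' assume c': "c' \<in> charts_at (atlas G) (f x)"
  obtain E where "has_chart_derivative c c' (\<lambda>y. y) (f x) E"
    using has_chart_derivative_transition[OF smooth_atlas assms(3) c'] by blast
  from has_chart_derivative_compose[OF assms(1) _ assms(2) this] assms(3)
  show "\<exists>D. has_chart_derivative a c' f x D"
    by (auto simp: comp_def dest: charts_atD)
qed

lemma differentiable_in_fst_snd: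
  assumes "a \<in> charts_at (atlas G) (fst z)" "b \<in> charts_at (atlas G) (snd z)"
  shows differentiable_in_fst: "differentiable_in (prod_chart a b) fst z"
    and differentiable_in_snd: "differentiable_in (prod_chart a b) snd z"
proof -
  have t: "topological_chart a" "topological_chart b" and z: "fst z \<in> fst a" "snd z \<in> fst b"
    using assms by (auto dest: charts_atD)
  show "differentiable_in (prod_chart a b) fst z"
    by (rule differentiable_in_chartI[OF topological_prod_chart[OF t] has_chart_derivative_fst[OF t z] assms(1)])
  show "differentiable_in (prod_chart a b) snd z"
    by (rule differentiable_in_chartI[OF topological_prod_chart[OF t] has_chart_derivative_snd[OF t z] assms(2)])
qed

lemma differentiable_right_mult:
  "a \<in> charts_at (atlas G) x \<Longrightarrow> differentiable_in a (\<lambda>h. h \<otimes> g) x"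
  by (intro differentiable_in_mult differentiable_in_id differentiable_in_const) (auto dest: charts_atD)

lemma differentiable_left_mult:
  "a \<in> charts_at (atlas G) x \<Longrightarrow> differentiable_in a (\<lambda>h. g \<otimes> h) x"
  by (intro differentiable_in_mult differentiable_in_id differentiable_in_const) (auto dest: charts_atD)

lemma differentiable_conjugation:
  "a \<in> charts_at (atlas G) x \<Longrightarrow> differentiable_in a (\<lambda>h. g \<otimes> h \<otimes> inv g) x"
  by (intro differentiable_in_mult differentiable_in_id differentiable_in_const) (auto dest: charts_atD)

lemma tendsto_inverse_mult:
  assumes "((\<lambda>s. f s \<otimes> inv g) \<longlongrightarrow> \<one>) F"
  shows "(f \<longlongrightarrow> g) F"
proof -
  obtain a where a: "a \<in> charts_at (atlas G) \<one>" using charts_at_nonempty[OF smooth_atlas] by blast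
  have "((\<lambda>h. h \<otimes> g) \<longlongrightarrow> \<one> \<otimes> g) (nhds \<one>)"
    by (rule differentiable_in_tendsto[OF differentiable_right_mult[OF a]])
  from filterlim_compose[OF this assms] show ?thesis by (simp add: m_assoc)
qed

lemma tendsto_inv:
  assumes "(f \<longlongrightarrow> g) F"
  shows "((\<lambda>s. inv (f s)) \<longlongrightarrow> inv g) F"
proof -
  obtain a where a: "a \<in> charts_at (atlas G) g" using charts_at_nonempty[OF smooth_atlas] by blast
  have "differentiable_in a (\<lambda>h. inv h) g"
    using a charts_atD[OF a] by (intro differentiable_in_inv differentiable_in_id) auto
  then have "((\<lambda>h. inv h) \<longlongrightarrow> inv g) (nhds g)" by (rule differentiable_in_tendsto)
  from filterlim_compose[OF this assms] show ?thesis .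
qed

end

section \<open>First order behaviour of the group operations at the unit, in a fixed chart\<close>

locale lie_group_chart = lie_group G
  for G :: "('g::t2_space, 'e::locally_convex_space) lie_group_data" (structure) +
  fixes c :: "('g, 'e) chart"
  assumes chart_at_one: "c \<in> charts_at (atlas G) \<one>" and chart_one: "snd c \<one> = 0"
begin

lemma chart_topological: "topological_chart c" and one_in_chart: "\<one> \<in> fst c"
  using charts_atD[OF chart_at_one] by auto

lemma chart_at: "k \<in> fst c \<Longrightarrow> c \<in> charts_at (atlas G) k"
  using chart_at_one by (simp add: charts_at_def)

definition mult_chart where
  "mult_chart = snd c \<circ> (\<lambda>z. fst z \<otimes> snd z) \<circ> chart_inv (prod_chart c c)"

text \<open>The differential of right multiplication by \<open>\<Xi>\<^sup>-\<^sup>1(y)\<close> at the unit, read in the chart \<open>\<Xi>\<close>.\<close>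

definition rmult_deriv where
  "rmult_deriv y v = dir_deriv mult_chart (0, y) (v, 0)"

text \<open>Writing the derivative as \<open>dir_deriv mult_chart\<close> makes it a function of the
  base point, so that its continuity can be stated.\<close>

lemma mult_one_chart_derivative:
  assumes k: "k \<in> fst c"
  shows "has_chart_derivative (prod_chart c c) c (\<lambda>z. fst z \<otimes> snd z) (\<one>, k) (dir_deriv mult_chart (0, snd c k))"
proof -
  obtain D where D: "has_chart_derivative (prod_chart c c) c (\<lambda>z. fst z \<otimes> snd z) (\<one>, k) D"
    using mult_has_chart_derivative[of c "(\<one>, k)" c c] chart_at[OF one_in_chart] chart_at[OF k] by auto
  have "dir_deriv mult_chart (0, snd c k) = D"
    using dir_deriv_chart[OF D] by (auto simp: mult_chart_def chart_one)
  then show ?thesis using D by simp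
qed

lemma rmult_deriv_scaleR: "k \<in> fst c \<Longrightarrow> rmult_deriv (snd c k) (r *\<^sub>R v) = r *\<^sub>R rmult_deriv (snd c k) v"
  using strict_derivative_scaleR[of mult_chart "dir_deriv mult_chart (0, snd c k)" "(0, snd c k)" r "(v, 0)"]
    mult_one_chart_derivative[of k]
  by (simp add: rmult_deriv_def has_chart_derivative_def mult_chart_def chart_one)

lemma chart_derivative_unique:
  assumes "has_chart_derivative c c f x D" "has_chart_derivative c c f x D'"
  shows "D w = D' w"
  using dir_deriv_chart[OF assms(1), of w] dir_deriv_chart[OF assms(2), of w] by simp

lemma one_chart_derivative_id: "has_chart_derivative c c (\<lambda>x. x) \<one> (\<lambda>w. w)"
  by (rule has_chart_derivative_id[OF chart_topological one_in_chart])

text \<open>The two partial derivatives come from \<open>x \<otimes> \<one> = x\<close> and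
  \<open>\<one> \<otimes> x = x\<close>; additivity combines them.\<close>

lemma mult_deriv_one: "dir_deriv mult_chart (0, 0) (v, w) = v + w"
proof -
  let ?D = "dir_deriv mult_chart (0, 0)"
  have D: "has_chart_derivative (prod_chart c c) c (\<lambda>z. fst z \<otimes> snd z) (\<one>, \<one>) ?D"
    using mult_one_chart_derivative[OF one_in_chart] by (simp add: chart_one)
  note comp = has_chart_derivative_compose[OF chart_topological
      topological_prod_chart[OF chart_topological chart_topological]]
  note const = has_chart_derivative_const[OF one_in_chart one_in_chart]
  have "has_chart_derivative c c ((\<lambda>z. fst z \<otimes> snd z) \<circ> (\<lambda>x. (x, \<one>))) \<one> (?D \<circ> (\<lambda>w. (w, 0)))"
    by (rule comp[OF has_chart_derivative_Pair[OF one_chart_derivative_id const] D])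
  then have 1: "?D (v, 0) = v" for v
    using chart_derivative_unique[OF _ one_chart_derivative_id, of "?D \<circ> (\<lambda>w. (w, 0))"] by (simp add: comp_def)
  have "has_chart_derivative c c ((\<lambda>z. fst z \<otimes> snd z) \<circ> (\<lambda>x. (\<one>, x))) \<one> (?D \<circ> (\<lambda>w. (0, w)))"
    by (rule comp[OF has_chart_derivative_Pair[OF const one_chart_derivative_id] D])
  then have 2: "?D (0, w) = w" for w
    using chart_derivative_unique[OF _ one_chart_derivative_id, of "?D \<circ> (\<lambda>w. (0, w))"] by (simp add: comp_def)
  have "has_strict_derivative mult_chart ?D (0, 0)"
    using D by (simp only: has_chart_derivative_def mult_chart_def prod_chart_simps map_prod_simp chart_one)
  then have "?D ((v, 0) + (0, w)) = ?D (v, 0) + ?D (0, w)"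
    by (rule strict_derivative_add)
  then show ?thesis by (simp add: 1 2)
qed

text \<open>In the joint limit for the derivative of multiplication only the second base coordinate
  and the first direction vary; the limiting value is that of the pair \<open>(v, 0)\<close> at the
  unit.\<close>

lemma tendsto_rmult_deriv:
  "((\<lambda>u. rmult_deriv (fst u) (snd u)) \<longlongrightarrow> v) (nhds 0 \<times>\<^sub>F nhds v)"
proof -
  have D: "has_chart_derivative (prod_chart c c) c (\<lambda>z. fst z \<otimes> snd z) (\<one>, \<one>) (dir_deriv mult_chart (0, 0))"
    using mult_one_chart_derivative[OF one_in_chart] by (simp add: chart_one)
  have "((\<lambda>u. dir_deriv mult_chart (fst u) (snd u)) \<longlongrightarrow> dir_deriv mult_chart (snd (prod_chart c c) (\<one>, \<one>)) (v, 0))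
      (nhds (snd (prod_chart c c) (\<one>, \<one>)) \<times>\<^sub>F nhds (v, 0))"
    unfolding mult_chart_def
  proof (rule tendsto_chart_dir_deriv)
    fix z :: "'g \<times> 'g"
    assume "z \<in> fst (prod_chart c c)" "fst z \<otimes> snd z \<in> fst c"
    then show "\<exists>D. has_chart_derivative (prod_chart c c) c (\<lambda>z. fst z \<otimes> snd z) z D"
      using mult_has_chart_derivative[of c z c c] chart_at by (cases z) auto
  qed (use D chart_topological topological_prod_chart[OF chart_topological chart_topological] one_in_chart in \<open>auto simp: has_chart_derivative_def\<close>)
  then have "((\<lambda>u. dir_deriv mult_chart (fst u) (snd u)) \<longlongrightarrow> v) (nhds (0, 0) \<times>\<^sub>F nhds (v, 0))"
    by (simp add: chart_one mult_deriv_one)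
  moreover have "filterlim (\<lambda>u. ((0, fst u), (snd u, 0))) (nhds (0, 0) \<times>\<^sub>F nhds (v, 0)) (nhds 0 \<times>\<^sub>F nhds v)"
    by (intro filterlim_Pair tendsto_Pair tendsto_const filterlim_fst filterlim_snd)
  ultimately show ?thesis
    unfolding rmult_deriv_def by (auto dest: filterlim_compose)
qed

lemma chart_velocity_rmult:
  assumes \<mu>: "chart_velocity c \<mu> t S v" "\<mu> t = \<one>" and k: "k \<in> fst c"
  shows "chart_velocity c (\<lambda>s. \<mu> s \<otimes> k) t S (rmult_deriv (snd c k) v)"
  using chart_velocity_compose[OF topological_prod_chart[OF chart_topological chart_topological] chart_topological
      chart_velocity_Pair[OF \<mu>(1) chart_velocity_const[OF k]], of "\<lambda>z. fst z \<otimes> snd z"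
      "dir_deriv mult_chart (0, snd c k)"]
    mult_one_chart_derivative[OF k] \<mu>(2)
  by (simp add: rmult_deriv_def)

lemma chart_velocity_mult_one:
  assumes "chart_velocity c \<mu> t S v" "\<mu> t = \<one>" "chart_velocity c \<nu> t S w" "\<nu> t = \<one>"
  shows "chart_velocity c (\<lambda>s. \<mu> s \<otimes> \<nu> s) t S (v + w)"
  using chart_velocity_compose[OF topological_prod_chart[OF chart_topological chart_topological] chart_topological
      chart_velocity_Pair[OF assms(1,3)], of "\<lambda>z. fst z \<otimes> snd z" "dir_deriv mult_chart (0, 0)"]
    mult_one_chart_derivative[OF one_in_chart] assms(2,4)
  by (simp add: mult_deriv_one chart_one)

text \<open>Differentiating the constant \<open>x \<otimes> inv x\<close> at the unit gives
  \<open>w + D w = 0\<close>.\<close>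

lemma chart_velocity_inv_one:
  assumes "chart_velocity c \<mu> t S v" "\<mu> t = \<one>"
  shows "chart_velocity c (\<lambda>s. inv (\<mu> s)) t S (- v)"
proof -
  obtain D where D: "has_chart_derivative c c (\<lambda>x. inv x) \<one> D"
    using differentiable_in_inv[OF chart_topological differentiable_in_id[OF chart_at_one]] chart_at_one
    by (auto simp: differentiable_in_def)
  have M: "has_chart_derivative (prod_chart c c) c (\<lambda>z. fst z \<otimes> snd z) (\<one>, inv \<one>) (dir_deriv mult_chart (0, 0))"
    using mult_one_chart_derivative[OF one_in_chart] by (simp add: chart_one)
  have "has_chart_derivative c c ((\<lambda>z. fst z \<otimes> snd z) \<circ> (\<lambda>x. (x, inv x))) \<one>
      (dir_deriv mult_chart (0, 0) \<circ> (\<lambda>w. (w, D w)))"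
    by (rule has_chart_derivative_compose[OF chart_topological
          topological_prod_chart[OF chart_topological chart_topological]
          has_chart_derivative_Pair[OF one_chart_derivative_id D] M])
  then have "has_chart_derivative c c (\<lambda>x. \<one>) \<one> (\<lambda>w. w + D w)"
    by (simp add: comp_def mult_deriv_one)
  from chart_derivative_unique[OF this has_chart_derivative_const[OF one_in_chart one_in_chart], of v]
  have "D v = - v" by (simp add: eq_neg_iff_add_eq_0 add.commute)
  then show ?thesis
    using chart_velocity_compose[OF chart_topological chart_topological assms(1), of "\<lambda>x. inv x" D] D assms(2)
    by simp
qed

section \<open>The adjoint action in coordinates\<close>

definition Ad_chart where
  "Ad_chart g v = dir_deriv (snd c \<circ> (\<lambda>h. g \<otimes> h \<otimes> inv g) \<circ> chart_inv c) 0 v"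

lemma conjugation_chart_derivative:
  "has_chart_derivative c c (\<lambda>h. g \<otimes> h \<otimes> inv g) \<one> (Ad_chart g)"
proof -
  obtain D where D: "has_chart_derivative c c (\<lambda>h. g \<otimes> h \<otimes> inv g) \<one> D"
    using differentiable_conjugation[OF chart_at_one, of g] chart_at_one by (auto simp: differentiable_in_def)
  have "Ad_chart g = D"
    using dir_deriv_chart[OF D] by (auto simp: Ad_chart_def chart_one)
  then show ?thesis using D by simp
qed

lemma Ad_chart_scaleR: "Ad_chart g (r *\<^sub>R v) = r *\<^sub>R Ad_chart g v"
  using conjugation_chart_derivative[of g] by (auto simp: has_chart_derivative_def intro: strict_derivative_scaleR)

lemma Ad_apply:
  assumes "X \<in> lie_algebra G"
  shows "Ad G g X c = Ad_chart g (X c)"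
  using tangent_map_apply[where f = "\<lambda>h. g \<otimes> h \<otimes> inv g", OF smooth_atlas _ chart_at_one _ conjugation_chart_derivative]
    assms chart_at_one
  by (simp add: Ad_def lie_algebra_def)

lemma Ad_in_lie_algebra:
  assumes "X \<in> lie_algebra G"
  shows "Ad G g X \<in> lie_algebra G"
  using tangent_map_in_tangent_space[where f = "\<lambda>h. g \<otimes> h \<otimes> inv g", OF smooth_atlas smooth_atlas, of X \<one>]
    assms differentiable_conjugation[of _ \<one> g]
  by (simp add: Ad_def lie_algebra_def differentiable_in_def)

lemma chart_velocity_conjugation:
  assumes "chart_velocity c \<mu> t S v" "\<mu> t = \<one>"
  shows "chart_velocity c (\<lambda>s. g \<otimes> \<mu> s \<otimes> inv g) t S (Ad_chart g v)"
  using chart_velocity_compose[OF chart_topological chart_topological assms(1), of "\<lambda>h. g \<otimes> h \<otimes> inv g" "Ad_chart g"]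
    conjugation_chart_derivative assms(2)
  by simp

text \<open>\<open>Ad_chart h w\<close> is the partial derivative of
  \<open>h \<otimes> x \<otimes> inv h\<close> in the variable \<open>x\<close> at the unit.
  Treating \<open>h\<close> as a variable in a chart \<open>a\<close> of its own turns joint
  continuity of Ad into that of one derivative on a product chart.\<close>

lemma tendsto_Ad_chart:
  assumes g: "(g \<longlongrightarrow> g0) F" and v: "(v \<longlongrightarrow> v0) F"
  shows "((\<lambda>s. Ad_chart (g s) (v s)) \<longlongrightarrow> Ad_chart g0 v0) F"
proof -
  obtain a where a: "a \<in> charts_at (atlas G) g0" using charts_at_nonempty[OF smooth_atlas] by blast
  have ta: "topological_chart a" and g0: "g0 \<in> fst a" using charts_atD[OF a] by auto
  let ?J = "\<lambda>z. fst z \<otimes> snd z \<otimes> inv (fst z)"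
  let ?a = "prod_chart a c"
  note tac = topological_prod_chart[OF ta chart_topological]
  have J: "\<exists>D. has_chart_derivative ?a c ?J z D" if "z \<in> fst ?a" "?J z \<in> fst c" for z
  proof -
    have "a \<in> charts_at (atlas G) (fst z)" "c \<in> charts_at (atlas G) (snd z)"
      using that(1) a chart_at by (cases z; auto simp: charts_at_def)+
    then have "differentiable_in ?a ?J z"
      by (intro differentiable_in_mult differentiable_in_inv tac differentiable_in_fst differentiable_in_snd)
    then show ?thesis using chart_at[OF that(2)] by (simp add: differentiable_in_def)
  qed
  have deriv: "dir_deriv (snd c \<circ> ?J \<circ> chart_inv ?a) (snd a h, 0) (0, w) = Ad_chart h w"
    if h: "h \<in> fst a" for h w
  proof -
    obtain D where D: "has_chart_derivative ?a c ?J (h, \<one>) D"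
      using J[of "(h, \<one>)"] h one_in_chart by auto
    have "has_chart_derivative c c (?J \<circ> (\<lambda>x. (h, x))) \<one> (D \<circ> (\<lambda>w. (0, w)))"
      by (rule has_chart_derivative_compose[where f = "\<lambda>x. (h, x)", OF chart_topological tac _ D])
        (rule has_chart_derivative_Pair[OF has_chart_derivative_const[OF one_in_chart h] one_chart_derivative_id])
    then have "D (0, w) = Ad_chart h w"
      using chart_derivative_unique[OF _ conjugation_chart_derivative[of h], of "D \<circ> (\<lambda>w. (0, w))"]
      by (simp add: comp_def)
    then show ?thesis
      using dir_deriv_chart[OF D, of "(0, w)"] by (simp add: chart_one)
  qed
  have "((\<lambda>u. dir_deriv (snd c \<circ> ?J \<circ> chart_inv ?a) (fst u) (snd u)) \<longlongrightarrow>
      dir_deriv (snd c \<circ> ?J \<circ> chart_inv ?a) (snd ?a (g0, \<one>)) (0, v0)) (nhds (snd ?a (g0, \<one>)) \<times>\<^sub>F nhds (0, v0))"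
  proof (rule tendsto_chart_dir_deriv[OF tac chart_topological])
    show "(?J \<longlongrightarrow> ?J (g0, \<one>)) (nhds (g0, \<one>))"
      using J[of "(g0, \<one>)"] g0 one_in_chart by (auto simp: has_chart_derivative_def)
  qed (use g0 one_in_chart J in auto)
  then have lim: "((\<lambda>u. dir_deriv (snd c \<circ> ?J \<circ> chart_inv ?a) (fst u) (snd u)) \<longlongrightarrow> Ad_chart g0 v0)
      (nhds (snd a g0, 0) \<times>\<^sub>F nhds (0, v0))"
    by (simp only: deriv[OF g0] prod_chart_simps map_prod_simp chart_one)
  have "filterlim (\<lambda>s. ((snd a (g s), 0), (0, v s))) (nhds (snd a g0, 0) \<times>\<^sub>F nhds (0, v0)) F"
    by (intro filterlim_Pair tendsto_Pair tendsto_const v filterlim_compose[OF tendsto_chart[OF ta g0] g])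
  from filterlim_compose[OF lim this]
  show ?thesis
  proof (rule Lim_transform_eventually)
    have "\<forall>\<^sub>F s in F. g s \<in> fst a"
      by (rule eventually_compose_filterlim[OF eventually_in_chart[OF ta g0] g])
    then show "\<forall>\<^sub>F s in F. dir_deriv (snd c \<circ> ?J \<circ> chart_inv ?a) (fst ((snd a (g s), 0), (0, v s)))
        (snd ((snd a (g s), 0), (0, v s))) = Ad_chart (g s) (v s)"
      by eventually_elim (simp only: fst_conv snd_conv deriv)
  qed
qed


subsection \<open>The evolution map\<close>

lemma at_within_unit_interval: "t \<in> {0..1::real} \<Longrightarrow> at t within {0..1} \<noteq> bot"
  unfolding trivial_limit_within by simp

lemma primitive_chart_velocity:
  assumes \<mu>: "primitive G \<phi> \<mu>" and t: "t \<in> {0..1}"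
  shows "chart_velocity c (\<lambda>s. \<mu> s \<otimes> inv (\<mu> t)) t {0..1} (\<phi> t c)"
proof -
  have C1: "C1_curve (atlas G) \<mu>" and eq: "right_log_deriv G \<mu> t = \<phi> t"
    using \<mu> t by (auto simp: primitive_def)
  \<comment> \<open>The same \<open>SOME\<close> as in \<open>tangent_map\<close>, so that its
    definition unfolds to this chart and only the velocity in \<open>d\<close> has to be
    known.\<close>
  define d where "d = (SOME d. d \<in> charts_at (atlas G) (\<mu> t))"
  have d: "d \<in> charts_at (atlas G) (\<mu> t)"
    unfolding d_def by (rule someI_ex) (metis charts_at_nonempty[OF smooth_atlas])
  obtain v where v: "chart_velocity d \<mu> t {0..1} v"
    using C1_curve_chart_velocity[OF C1 t d] by blast
  obtain D where D: "has_chart_derivative d c (\<lambda>h. h \<otimes> inv (\<mu> t)) (\<mu> t) D"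
    using differentiable_right_mult[OF d, of "inv (\<mu> t)"] chart_at_one by (auto simp: differentiable_in_def)
  have "\<phi> t c = D v"
    using chart_at_one dir_deriv_chart[OF D]
    by (simp add: eq[symmetric] right_log_deriv_def tangent_map_def d_def[symmetric] Let_def
        velocity_apply[OF v d at_within_unit_interval[OF t]])
  then show ?thesis
    using chart_velocity_compose[OF _ chart_topological v D] charts_atD[OF d] by simp
qed

text \<open>Whichever primitive \<open>SOME\<close> selects, the normalising factor
  \<open>inv (\<mu> 0)\<close> cancels from the quotient of the values at \<open>s\<close> and
  \<open>t\<close>, whose velocity at \<open>s = t\<close> is the logarithmic derivative.\<close>

lemma Evol_facts:
  assumes "\<phi> \<in> evol_domain G"
  shows Evol_chart_velocity: "t \<in> {0..1} \<Longrightarrow>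
      chart_velocity c (\<lambda>s. Evol G \<phi> s \<otimes> inv (Evol G \<phi> t)) t {0..1} (\<phi> t c)"
    and Evol_0: "Evol G \<phi> 0 = \<one>"
proof -
  define \<mu> where "\<mu> = (SOME \<mu>. primitive G \<phi> \<mu>)"
  have \<mu>: "primitive G \<phi> \<mu>"
    unfolding \<mu>_def using assms someI_ex[of "primitive G \<phi>"] by (simp add: evol_domain_def)
  have E: "Evol G \<phi> t = \<mu> t \<otimes> inv (\<mu> 0)" for t
    by (simp add: Evol_def \<mu>_def Let_def)
  have "Evol G \<phi> s \<otimes> inv (Evol G \<phi> t) = \<mu> s \<otimes> inv (\<mu> t)" for s t
    by (simp add: E inv_mult_group m_assoc mult_cancel)
  then show "chart_velocity c (\<lambda>s. Evol G \<phi> s \<otimes> inv (Evol G \<phi> t)) t {0..1} (\<phi> t c)" if "t \<in> {0..1}"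
    using primitive_chart_velocity[OF \<mu> that] by simp
  show "Evol G \<phi> 0 = \<one>" by (simp add: E)
qed

lemma Evol_tendsto:
  assumes "\<phi> \<in> evol_domain G" "t \<in> {0..1}"
  shows "(Evol G \<phi> \<longlongrightarrow> Evol G \<phi> t) (at t within {0..1})"
  using chart_velocity_tendsto[OF chart_topological Evol_chart_velocity[OF assms]]
  by (simp add: tendsto_inverse_mult)

lemma Evol_variation_chart_velocity:
  assumes \<phi>: "\<phi> \<in> evol_domain G" and \<phi>h: "(\<lambda>t. \<phi> t + h *\<^sub>R \<psi> t) \<in> evol_domain G" and t: "t \<in> {0..1}"
    and k: "Evol_variation G \<phi> \<psi> h t \<in> fst c"
  shows "chart_velocity c (Evol_variation G \<phi> \<psi> h) t {0..1}
    (h *\<^sub>R rmult_deriv (snd c (Evol_variation G \<phi> \<psi> h t)) (Ad_chart (inv (Evol G \<phi> t)) (\<psi> t c)))"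
proof -
  define \<mu> \<mu>h \<nu> where "\<mu> = Evol G \<phi>" and "\<mu>h = Evol G (\<lambda>t. \<phi> t + h *\<^sub>R \<psi> t)"
    and "\<nu> = Evol_variation G \<phi> \<psi> h"
  have \<nu>: "\<nu> s = inv (\<mu> s) \<otimes> \<mu>h s" for s
    by (simp add: \<nu>_def Evol_variation_def \<mu>_def \<mu>h_def)
  have 1: "chart_velocity c (\<lambda>s. inv (\<mu> s \<otimes> inv (\<mu> t))) t {0..1} (- \<phi> t c)"
    unfolding \<mu>_def by (intro chart_velocity_inv_one Evol_chart_velocity \<phi> t) simp
  have 2: "chart_velocity c (\<lambda>s. \<mu>h s \<otimes> inv (\<mu>h t)) t {0..1} (\<phi> t c + h *\<^sub>R \<psi> t c)"
    using Evol_chart_velocity[OF \<phi>h t] by (simp add: \<mu>h_def scaleR_fun_def)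
  \<comment> \<open>Both inner factors are \<open>\<one>\<close> at \<open>s = t\<close>, where the
    product rule is plain addition; \<open>\<phi>\<close> cancels and the term in
    \<open>\<psi>\<close> remains.\<close>
  have "chart_velocity c (\<lambda>s. inv (\<mu> t) \<otimes> (inv (\<mu> s \<otimes> inv (\<mu> t)) \<otimes> (\<mu>h s \<otimes> inv (\<mu>h t))) \<otimes> inv (inv (\<mu> t)))
      t {0..1} (Ad_chart (inv (\<mu> t)) (- \<phi> t c + (\<phi> t c + h *\<^sub>R \<psi> t c)))"
    by (intro chart_velocity_conjugation chart_velocity_mult_one 1 2) simp_all
  moreover have "inv (\<mu> t) \<otimes> (inv (\<mu> s \<otimes> inv (\<mu> t)) \<otimes> (\<mu>h s \<otimes> inv (\<mu>h t))) \<otimes> inv (inv (\<mu> t)) =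
      \<nu> s \<otimes> inv (\<nu> t)" for s
    by (simp add: \<nu> inv_mult_group m_assoc mult_cancel)
  ultimately have "chart_velocity c (\<lambda>s. \<nu> s \<otimes> inv (\<nu> t)) t {0..1} (h *\<^sub>R Ad_chart (inv (\<mu> t)) (\<psi> t c))"
    by (simp add: Ad_chart_scaleR)
  \<comment> \<open>Right multiplication by \<open>\<nu> t\<close> carries the velocity from the
    unit to \<open>\<nu> t\<close>.\<close>
  then have "chart_velocity c (\<lambda>s. \<nu> s \<otimes> inv (\<nu> t) \<otimes> \<nu> t) t {0..1}
      (rmult_deriv (snd c (\<nu> t)) (h *\<^sub>R Ad_chart (inv (\<mu> t)) (\<psi> t c)))"
    using k by (intro chart_velocity_rmult) (simp_all add: \<nu>_def)
  then show ?thesis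
    using k by (simp add: m_assoc rmult_deriv_scaleR \<nu>_def \<mu>_def)
qed

end


section \<open>Uniform limits of difference quotients\<close>

definition uniformly_vanishing :: "(real \<Rightarrow> real \<Rightarrow> 'a::locally_convex_space) \<Rightarrow> bool"
  where "uniformly_vanishing \<gamma> \<longleftrightarrow>
    (\<forall>p e. continuous_seminorm p \<longrightarrow> e > 0 \<longrightarrow> (\<forall>\<^sub>F h in at 0. \<forall>t\<in>{0..1}. p (\<gamma> h t) \<le> e))"

lemma uniform_limit_at_0_zero_iff:
  fixes \<iota> :: "'a::locally_convex_space \<Rightarrow> 'b::{locally_convex_space, complete_uniform_space}"
  assumes \<iota>: "is_completion UNIV \<iota>"
  shows "uniform_limit_at_0 \<iota> \<gamma> (\<lambda>_. 0) \<longleftrightarrow> uniformly_vanishing \<gamma>"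
proof
  assume L: "uniform_limit_at_0 \<iota> \<gamma> (\<lambda>_. 0)"
  show "uniformly_vanishing \<gamma>"
    unfolding uniformly_vanishing_def
  proof (intro allI impI)
    fix p :: "'a \<Rightarrow> real" and e :: real
    assume p: "continuous_seminorm p" "e > 0"
    show "\<forall>\<^sub>F h in at 0. \<forall>t\<in>{0..1}. p (\<gamma> h t) \<le> e"
      using L[unfolded uniform_limit_at_0_iff[OF \<iota>], rule_format, OF continuous_seminorm_extension[OF \<iota> p(1)] p(2)]
      by (simp add: seminorm_extension_apply[OF \<iota> p(1)])
  qed
next
  assume van: "uniformly_vanishing \<gamma>"
  show "uniform_limit_at_0 \<iota> \<gamma> (\<lambda>_. 0)"
    unfolding uniform_limit_at_0_iff[OF \<iota>]
    using van[unfolded uniformly_vanishing_def, rule_format, OF seminorm_comp_completion[OF \<iota>]] by simp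
qed

text \<open>\<open>E\<close> carries no metric for the Heine-Cantor theorem, so that theorem is
  applied to the real function \<open>p (\<eta> s - \<eta> x)\<close> on the square, which vanishes
  on the diagonal.\<close>

lemma seminorm_uniformly_continuous:
  fixes \<eta> :: "real \<Rightarrow> 'a::topological_real_vector"
  assumes p: "continuous_seminorm p" and \<eta>: "continuous_on {a..b} \<eta>" and "e > 0"
  obtains d where "d > 0" "\<And>s x. s \<in> {a..b} \<Longrightarrow> x \<in> {a..b} \<Longrightarrow> \<bar>s - x\<bar> < d \<Longrightarrow> p (\<eta> s - \<eta> x) \<le> e"
proof -
  define g where "g u = p (\<eta> (fst u) - \<eta> (snd u))" for u
  have "continuous_on ({a..b} \<times> {a..b}) (\<lambda>u. \<eta> (fst u) - \<eta> (snd u))"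
    by (intro continuous_on_diff continuous_on_compose2[OF \<eta>] continuous_intros) auto
  then have "continuous_on ({a..b} \<times> {a..b}) g"
    unfolding g_def by (rule continuous_on_compose2[OF seminorm_continuous[OF p]]) simp
  then have "uniformly_continuous_on ({a..b} \<times> {a..b}) g"
    by (intro compact_uniformly_continuous compact_Times compact_Icc)
  then obtain d where d: "d > 0" "\<And>u v. u \<in> {a..b} \<times> {a..b} \<Longrightarrow> v \<in> {a..b} \<times> {a..b} \<Longrightarrow>
      dist v u < d \<Longrightarrow> dist (g v) (g u) < e"
    using \<open>e > 0\<close> unfolding uniformly_continuous_on_def by metis
  have "p (\<eta> s - \<eta> x) \<le> e" if "s \<in> {a..b}" "x \<in> {a..b}" "\<bar>s - x\<bar> < d" for s x
  proof -
    have "dist (g (s, x)) (g (x, x)) < e"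
      using that by (intro d(2)) (auto simp: dist_Pair_Pair dist_real_def)
    then show ?thesis by (simp add: g_def seminorm_0[OF p] dist_real_def)
  qed
  then show thesis using that d(1) by blast
qed

text \<open>A neighbourhood \<open>A\<close> of 0 that works for all \<open>t\<close> at once is
  found by compactness: near each time one exists, and those of adjacent intervals are intersected.
  Uniform vanishing then puts all \<open>\<gamma> h t\<close> into \<open>A\<close>.\<close>

lemma seminorm_uniform_perturbation:
  fixes \<eta> :: "real \<Rightarrow> 'a::locally_convex_space"
  assumes p: "continuous_seminorm p" and \<eta>: "continuous_on {0..1} \<eta>" and "e > 0"
    and \<omega>: "\<And>v. ((\<lambda>u. \<omega> (fst u) (snd u)) \<longlongrightarrow> v) (nhds 0 \<times>\<^sub>F nhds v)"
    and \<gamma>: "uniformly_vanishing \<gamma>"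
  shows "\<forall>\<^sub>F h in at 0. \<forall>t\<in>{0..1}. p (\<omega> (\<gamma> h t) (\<eta> t) - \<eta> t) \<le> e"
proof -
  \<comment> \<open>Bisection also tests intervals that stick out of \<open>{0..1}\<close>, where
    nothing is known about \<open>\<eta>\<close>; hence the intersection.\<close>
  define P where "P a b \<longleftrightarrow> (\<exists>A. open A \<and> 0 \<in> A \<and>
    (\<forall>t\<in>{a..b} \<inter> {0..1}. \<forall>y\<in>A. p (\<omega> y (\<eta> t) - \<eta> t) \<le> e))" for a b :: real
  have "P 0 1"
  proof (rule Bolzano[where P = P])
    fix a b c assume "P a b" "P b c" "a \<le> b" "b \<le> c"
    then obtain A B where "open A" "0 \<in> A" "\<forall>t\<in>{a..b} \<inter> {0..1}. \<forall>y\<in>A. p (\<omega> y (\<eta> t) - \<eta> t) \<le> e"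
      and "open B" "0 \<in> B" "\<forall>t\<in>{b..c} \<inter> {0..1}. \<forall>y\<in>B. p (\<omega> y (\<eta> t) - \<eta> t) \<le> e"
      unfolding P_def by blast
    then show "P a c"
      unfolding P_def by (intro exI[of _ "A \<inter> B"]) force
  next
    fix x :: real assume "0 \<le> x" "x \<le> 1"
    then have x: "x \<in> {0..1}" by simp
    \<comment> \<open>Subtracting \<open>snd u\<close> instead of \<open>\<eta> x\<close> keeps the
      comparison with \<open>\<eta> t\<close> itself while \<open>t\<close> varies near
      \<open>x\<close>.\<close>
    have "((\<lambda>u. \<omega> (fst u) (snd u) - snd u) \<longlongrightarrow> \<eta> x - \<eta> x) (nhds 0 \<times>\<^sub>F nhds (\<eta> x))"
      by (intro tendsto_diff \<omega> filterlim_snd)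
    from seminorm_tendsto_diff_less[OF p this \<open>e > 0\<close>]
    obtain Q R where Q: "eventually Q (nhds 0)" and R: "eventually R (nhds (\<eta> x))"
      and QR: "\<And>y v. Q y \<Longrightarrow> R v \<Longrightarrow> p (\<omega> y v - v) < e"
      unfolding eventually_prod_filter by auto
    obtain A where A: "open A" "0 \<in> A" "\<And>y. y \<in> A \<Longrightarrow> Q y"
      using Q by (auto simp: eventually_nhds)
    have "(\<eta> \<longlongrightarrow> \<eta> x) (at x within {0..1})" using \<eta> x by (simp add: continuous_on_def)
    then have "\<forall>\<^sub>F t in at x within {0..1}. R (\<eta> t)" by (rule eventually_compose_filterlim[OF R])
    then obtain d where d: "d > 0" "\<And>t. t \<in> {0..1} \<Longrightarrow> t \<noteq> x \<Longrightarrow> dist t x < d \<Longrightarrow> R (\<eta> t)"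
      by (auto simp: eventually_at)
    have "R (\<eta> t)" if "t \<in> {0..1}" "\<bar>t - x\<bar> < d" for t
      using d(2)[OF that(1)] that(2) eventually_nhds_x_imp_x[OF R] by (cases "t = x") (auto simp: dist_real_def)
    then have "P a b" if "a \<le> x" "x \<le> b" "b - a < d" for a b
      unfolding P_def using A QR that by (intro exI[of _ A]) (fastforce intro: less_imp_le)
    then show "\<exists>d>0. \<forall>a b. a \<le> x \<and> x \<le> b \<and> b - a < d \<longrightarrow> P a b"
      using d(1) by blast
  qed simp
  then obtain A where A: "open A" "0 \<in> A" "\<And>t y. t \<in> {0..1} \<Longrightarrow> y \<in> A \<Longrightarrow> p (\<omega> y (\<eta> t) - \<eta> t) \<le> e"
    unfolding P_def by auto
  obtain q where q: "continuous_seminorm q" "\<And>y. q y < 1 \<Longrightarrow> y \<in> A"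
    using seminorm_below_neighbourhood A by blast
  have "\<forall>\<^sub>F h in at 0. \<forall>t\<in>{0..1}. q (\<gamma> h t) \<le> 1 / 2"
    by (rule \<gamma>[unfolded uniformly_vanishing_def, rule_format, OF q(1)]) simp
  then show ?thesis
    by eventually_elim (use A(3) q(2) in fastforce)
qed

text \<open>Tags lie in the interval, so all Riemann sums agree; then so do the two
  \<open>Lim\<close>, whether or not the sums converge.\<close>

lemma riemann_integral_cong:
  assumes "\<And>x. x \<in> {a..b} \<Longrightarrow> f x = g x"
  shows "riemann_integral a b f = riemann_integral a b g"
proof -
  have "\<forall>\<^sub>F D in riemann_filter a b.
      (\<Sum>(x, K)\<in>D. measure lborel K *\<^sub>R f x) = (\<Sum>(x, K)\<in>D. measure lborel K *\<^sub>R g x)"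
    unfolding eventually_riemann_filter
  proof (intro exI[of _ 1] conjI allI impI)
    fix D assume "D tagged_division_of {a..b} \<and> (\<lambda>x. ball x 1) fine D"
    then show "(\<Sum>(x, K)\<in>D. measure lborel K *\<^sub>R f x) = (\<Sum>(x, K)\<in>D. measure lborel K *\<^sub>R g x)"
      by (intro sum.cong) (auto simp: tagged_division_of assms subset_iff)
  qed simp
  from tendsto_cong[OF this] show ?thesis
    by (simp add: riemann_integral_def Topological_Spaces.Lim_def)
qed

text \<open>
  The curves \<open>t \<mapsto> \<gamma> h t / h\<close> start at \<open>0\<close> and have derivative \<open>\<omega> (\<gamma> h t) (\<eta> t)\<close>, which is uniformly close
  to \<open>\<eta> t\<close>.  By the mean value inequality on each interval of a fine division they are uniformly
  close to the Riemann sums of \<open>\<eta>\<close>; this also shows that these sums form a Cauchy filter.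
\<close>

locale perturbed_curves =
  fixes \<omega> :: "'a::locally_convex_space \<Rightarrow> 'a \<Rightarrow> 'a" and \<eta> :: "real \<Rightarrow> 'a" and \<gamma> :: "real \<Rightarrow> real \<Rightarrow> 'a"
  assumes \<omega>: "\<And>v. ((\<lambda>u. \<omega> (fst u) (snd u)) \<longlongrightarrow> v) (nhds 0 \<times>\<^sub>F nhds v)"
    and \<eta>: "continuous_on {0..1} \<eta>"
    and \<gamma>_0: "\<forall>\<^sub>F h in at 0. \<gamma> h 0 = 0"
    and \<gamma>_deriv: "\<forall>\<^sub>F h in at 0. \<forall>t\<in>{0..1}.
      ((\<lambda>s. (1 / (s - t)) *\<^sub>R (\<gamma> h s - \<gamma> h t)) \<longlongrightarrow> h *\<^sub>R \<omega> (\<gamma> h t) (\<eta> t)) (at t within {0..1})"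
begin

text \<open>The gauge \<open>d\<close> is fixed before \<open>h\<close>, and the estimate is uniform
  in \<open>T\<close> and in the division, so that \<open>h\<close> or the division can be varied
  alone. Half of \<open>e\<close> pays for \<open>\<omega>\<close> against \<open>\<eta>\<close>,
  the other half for the oscillation of \<open>\<eta>\<close> over distances below
  \<open>d\<close>.\<close>

lemma riemann_sums_close:
  assumes \<gamma>: "uniformly_vanishing \<gamma>" and p: "continuous_seminorm p" and "e > 0"
  shows "\<exists>d>0. \<forall>\<^sub>F h in at 0. \<forall>T\<in>{0..1}. \<forall>D. D tagged_division_of {0..T} \<and> (\<lambda>x. ball x d) fine D \<longrightarrow>
    p ((1 / h) *\<^sub>R \<gamma> h T - (\<Sum>(x, K)\<in>D. measure lborel K *\<^sub>R \<eta> x)) \<le> e"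
proof -
  obtain d where d: "d > 0" "\<And>s x. s \<in> {0..1} \<Longrightarrow> x \<in> {0..1} \<Longrightarrow> \<bar>s - x\<bar> < d \<Longrightarrow> p (\<eta> s - \<eta> x) \<le> e / 2"
    using seminorm_uniformly_continuous[OF p \<eta>, of "e / 2"] \<open>e > 0\<close> by auto
  have "\<forall>\<^sub>F h in at 0. \<forall>t\<in>{0..1}. p (\<omega> (\<gamma> h t) (\<eta> t) - \<eta> t) \<le> e / 2"
    using \<open>e > 0\<close> by (intro seminorm_uniform_perturbation[OF p \<eta> _ \<omega> \<gamma>]) simp
  moreover have "\<forall>\<^sub>F h in at (0::real). h \<noteq> 0" by (simp add: eventually_at_filter)
  ultimately have "\<forall>\<^sub>F h in at 0. \<forall>T\<in>{0..1}. \<forall>D. D tagged_division_of {0..T} \<and> (\<lambda>x. ball x d) fine D \<longrightarrow>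
    p ((1 / h) *\<^sub>R \<gamma> h T - (\<Sum>(x, K)\<in>D. measure lborel K *\<^sub>R \<eta> x)) \<le> e"
    using \<gamma>_0 \<gamma>_deriv
  proof eventually_elim
    case (elim h)
    show ?case
    proof (intro ballI allI impI)
      fix T :: real and D assume T: "T \<in> {0..1}" and D: "D tagged_division_of {0..T} \<and> (\<lambda>x. ball x d) fine D"
      define f where "f t = (1 / h) *\<^sub>R \<gamma> h t" for t
      have "p (f T - f 0 - (\<Sum>(x, K)\<in>D. measure lborel K *\<^sub>R \<eta> x)) \<le> e * (T - 0)"
      proof (rule riemann_sum_close[OF p, where f' = "\<lambda>t. \<omega> (\<gamma> h t) (\<eta> t)"])
        fix t assume "t \<in> {0..T}"
        then have t: "t \<in> {0..1}" "{0..T} \<subseteq> {0..1}" using T by auto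
        have "((\<lambda>s. (1 / h) *\<^sub>R ((1 / (s - t)) *\<^sub>R (\<gamma> h s - \<gamma> h t))) \<longlongrightarrow> (1 / h) *\<^sub>R (h *\<^sub>R \<omega> (\<gamma> h t) (\<eta> t)))
            (at t within {0..T})"
          using t
          by (intro tendsto_scaleR_tvs[OF tendsto_const tendsto_within_subset[OF elim(4)[rule_format, OF t(1)]]])
        then show "((\<lambda>s. (1 / (s - t)) *\<^sub>R (f s - f t)) \<longlongrightarrow> \<omega> (\<gamma> h t) (\<eta> t)) (at t within {0..T})"
          using elim(2) by (simp add: f_def mult.commute flip: scaleR_diff_right)
      next
        fix s x assume "s \<in> {0..T}" "x \<in> {0..T}" and sx: "\<bar>s - x\<bar> < d"
        then have "s \<in> {0..1}" "x \<in> {0..1}" using T by auto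
        then show "p (\<omega> (\<gamma> h s) (\<eta> s) - \<eta> x) \<le> e"
          using seminorm_diff_triangle[OF p, of "\<omega> (\<gamma> h s) (\<eta> s)" "\<eta> x" "\<eta> s"] d(2)[of s x] sx elim(1)
          by fastforce
      qed (use T D in auto)
      also have "\<dots> \<le> e" using T \<open>e > 0\<close> by (simp add: mult_left_le)
      finally show "p ((1 / h) *\<^sub>R \<gamma> h T - (\<Sum>(x, K)\<in>D. measure lborel K *\<^sub>R \<eta> x)) \<le> e"
        using elim(3) by (simp add: f_def)
    qed
  qed
  then show ?thesis using d(1) by blast
qed

lemma quotient_uniform_limit:
  fixes \<iota> :: "'a \<Rightarrow> 'b::{locally_convex_space, complete_uniform_space}"
  assumes \<gamma>: "uniformly_vanishing \<gamma>" and \<iota>: "is_completion UNIV \<iota>"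
  shows "uniform_limit_at_0 \<iota> (\<lambda>h t. (1 / h) *\<^sub>R \<gamma> h t) (\<lambda>t. riemann_integral 0 t (\<lambda>s. \<iota> (\<eta> s)))"
proof -
  have close: "\<exists>d>0. \<forall>\<^sub>F h in at 0. \<forall>T\<in>{0..1}. \<forall>D. D tagged_division_of {0..T} \<and> (\<lambda>x. ball x d) fine D \<longrightarrow>
      q (\<iota> ((1 / h) *\<^sub>R \<gamma> h T) - (\<Sum>(x, K)\<in>D. measure lborel K *\<^sub>R \<iota> (\<eta> x))) \<le> e"
    if q: "continuous_seminorm q" "e > 0" for q :: "'b \<Rightarrow> real" and e
    using riemann_sums_close[OF \<gamma> seminorm_comp_completion[OF \<iota> q(1)] q(2)]
    by (simp add: completion_diff[OF \<iota>] completion_sum[OF \<iota>] completion_scaleR[OF \<iota>] case_prod_unfold)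
  have lim: "((\<lambda>D. \<Sum>(x, K)\<in>D. measure lborel K *\<^sub>R \<iota> (\<eta> x)) \<longlongrightarrow> riemann_integral 0 T (\<lambda>s. \<iota> (\<eta> s)))
      (riemann_filter 0 T)" if T: "T \<in> {0..1}" for T
  proof (rule riemann_integral_tendsto)
    fix q :: "'b \<Rightarrow> real" and e :: real assume "continuous_seminorm q" "e > 0"
    from close[OF this] obtain d where d: "d > 0" "\<forall>\<^sub>F h in at 0. \<forall>T\<in>{0..1}. \<forall>D.
        D tagged_division_of {0..T} \<and> (\<lambda>x. ball x d) fine D \<longrightarrow>
        q (\<iota> ((1 / h) *\<^sub>R \<gamma> h T) - (\<Sum>(x, K)\<in>D. measure lborel K *\<^sub>R \<iota> (\<eta> x))) \<le> e"
      by blast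
    \<comment> \<open>The quotient at one suitable \<open>h\<close> is the approximate value around
      which all fine Riemann sums cluster.\<close>
    from eventually_happens'[OF trivial_limit_at d(2)] d(1) T
    show "\<exists>y. \<forall>\<^sub>F D in riemann_filter 0 T. q (y - (\<Sum>(x, K)\<in>D. measure lborel K *\<^sub>R \<iota> (\<eta> x))) \<le> e"
      unfolding eventually_riemann_filter by blast
  qed
  show ?thesis
    unfolding uniform_limit_at_0_iff[OF \<iota>]
  proof (intro allI impI)
    fix q :: "'b \<Rightarrow> real" and e :: real assume q: "continuous_seminorm q" "e > 0"
    from close[OF this] obtain d where d: "d > 0" "\<forall>\<^sub>F h in at 0. \<forall>T\<in>{0..1}. \<forall>D.
        D tagged_division_of {0..T} \<and> (\<lambda>x. ball x d) fine D \<longrightarrow>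
        q (\<iota> ((1 / h) *\<^sub>R \<gamma> h T) - (\<Sum>(x, K)\<in>D. measure lborel K *\<^sub>R \<iota> (\<eta> x))) \<le> e"
      by blast
    from d(2) show "\<forall>\<^sub>F h in at 0. \<forall>T\<in>{0..1}.
        q (\<iota> ((1 / h) *\<^sub>R \<gamma> h T) - riemann_integral 0 T (\<lambda>s. \<iota> (\<eta> s))) \<le> e"
    proof eventually_elim
      case (elim h)
      show ?case
      proof
        fix T :: real assume T: "T \<in> {0..1}"
        \<comment> \<open>With \<open>h\<close> fixed the division is refined; the non-strict bound
          survives in the limit.\<close>
        have "((\<lambda>D. q (\<iota> ((1 / h) *\<^sub>R \<gamma> h T) - (\<Sum>(x, K)\<in>D. measure lborel K *\<^sub>R \<iota> (\<eta> x)))) \<longlongrightarrow>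
            q (\<iota> ((1 / h) *\<^sub>R \<gamma> h T) - riemann_integral 0 T (\<lambda>s. \<iota> (\<eta> s)))) (riemann_filter 0 T)"
          by (rule seminorm_tendsto[OF q(1) tendsto_diff[OF tendsto_const lim[OF T]]])
        moreover have "\<forall>\<^sub>F D in riemann_filter 0 T.
            q (\<iota> ((1 / h) *\<^sub>R \<gamma> h T) - (\<Sum>(x, K)\<in>D. measure lborel K *\<^sub>R \<iota> (\<eta> x))) \<le> e"
          unfolding eventually_riemann_filter using elim T d(1) by blast
        ultimately show "q (\<iota> ((1 / h) *\<^sub>R \<gamma> h T) - riemann_integral 0 T (\<lambda>s. \<iota> (\<eta> s))) \<le> e"
          by (rule tendsto_upperbound[OF _ _ riemann_filter_not_bot])
      qed
    qed
  qed
qed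

text \<open>Boundedness of \<open>I\<close> is read off from the convergence: at one parameter
  \<open>k\<close> the quotient curve stays within 1 of \<open>I\<close> and is continuous in
  \<open>t\<close>, hence bounded on the compact interval. Then \<open>\<gamma> h t\<close> is
  \<open>h\<close> times a bounded quantity.\<close>

lemma quotient_limit_imp_vanishing:
  fixes \<iota> :: "'a \<Rightarrow> 'b::{locally_convex_space, complete_uniform_space}"
  assumes \<iota>: "is_completion UNIV \<iota>"
    and lim: "uniform_limit_at_0 \<iota> (\<lambda>h t. (1 / h) *\<^sub>R \<gamma> h t) I"
  shows "uniformly_vanishing \<gamma>"
  unfolding uniformly_vanishing_def
proof (intro allI impI)
  fix p :: "'a \<Rightarrow> real" and e :: real assume p: "continuous_seminorm p" and "e > 0"
  define q where "q = seminorm_extension \<iota> p"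
  have q: "continuous_seminorm q" "\<And>x. q (\<iota> x) = p x"
    using seminorm_extension[OF \<iota> p] by (auto simp: q_def)
  have close: "\<forall>\<^sub>F h in at 0. \<forall>t\<in>{0..1}. q (\<iota> ((1 / h) *\<^sub>R \<gamma> h t) - I t) \<le> 1"
    using lim q(1) unfolding uniform_limit_at_0_iff[OF \<iota>] by simp
  from eventually_happens'[OF trivial_limit_at eventually_conj[OF close \<gamma>_deriv]]
  obtain k where k: "\<And>t. t \<in> {0..1} \<Longrightarrow> q (\<iota> ((1 / k) *\<^sub>R \<gamma> k t) - I t) \<le> 1"
    and k_deriv: "\<And>t. t \<in> {0..1} \<Longrightarrow>
      ((\<lambda>s. (1 / (s - t)) *\<^sub>R (\<gamma> k s - \<gamma> k t)) \<longlongrightarrow> k *\<^sub>R \<omega> (\<gamma> k t) (\<eta> t)) (at t within {0..1})"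
    by blast
  have "continuous_on {0..1} (\<gamma> k)"
    unfolding continuous_on_def
  proof
    fix t :: real assume t: "t \<in> {0..1}"
    have "((\<lambda>s. (s - t) *\<^sub>R ((1 / (s - t)) *\<^sub>R (\<gamma> k s - \<gamma> k t)) + \<gamma> k t) \<longlongrightarrow>
        (t - t) *\<^sub>R (k *\<^sub>R \<omega> (\<gamma> k t) (\<eta> t)) + \<gamma> k t) (at t within {0..1})"
      by (intro tendsto_add tendsto_scaleR_tvs k_deriv[OF t] tendsto_const tendsto_diff tendsto_ident_at)
    then have "((\<lambda>s. (s - t) *\<^sub>R ((1 / (s - t)) *\<^sub>R (\<gamma> k s - \<gamma> k t)) + \<gamma> k t) \<longlongrightarrow> \<gamma> k t) (at t within {0..1})"
      by simp
    then show "(\<gamma> k \<longlongrightarrow> \<gamma> k t) (at t within {0..1})"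
      by (rule Lim_transform_eventually) (auto simp: eventually_at_filter)
  qed
  then have "continuous_on {0..1} (\<lambda>t. (1 / k) *\<^sub>R \<gamma> k t)"
    by (intro continuous_on_scaleR_tvs continuous_on_const)
  then have "continuous_on {0..1} (\<lambda>t. p ((1 / k) *\<^sub>R \<gamma> k t))"
    by (rule continuous_on_compose2[OF seminorm_continuous[OF p]]) simp
  then have "bounded ((\<lambda>t. p ((1 / k) *\<^sub>R \<gamma> k t)) ` {0..1})"
    by (intro compact_imp_bounded compact_continuous_image compact_Icc)
  then obtain M where "\<forall>t\<in>{0..1}. \<bar>p ((1 / k) *\<^sub>R \<gamma> k t)\<bar> \<le> M"
    by (auto simp: bounded_iff)
  then have M: "p ((1 / k) *\<^sub>R \<gamma> k t) \<le> M" if "t \<in> {0..1}" for t using that by fastforce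
  have "M \<ge> 0" using order_trans[OF seminorm_nonneg[OF p] M[of 0]] by simp
  \<comment> \<open>\<open>M\<close> bounds the quotient at \<open>k\<close>, and 1 its distance to
    \<open>I\<close>; a further 1 is spent at general \<open>h\<close>, whence \<open>M + 2\<close>
    below.\<close>
  have I: "q (I t) \<le> M + 1" if t: "t \<in> {0..1}" for t
    using seminorm_diff_le[OF q(1), of "\<iota> ((1 / k) *\<^sub>R \<gamma> k t)" "\<iota> ((1 / k) *\<^sub>R \<gamma> k t) - I t"] k[OF t] M[OF t]
    by (simp add: q(2))
  have "((\<lambda>h::real. \<bar>h\<bar> * (M + 2)) \<longlongrightarrow> \<bar>0\<bar> * (M + 2)) (at 0)"
    by (intro tendsto_intros)
  then have "\<forall>\<^sub>F h::real in at 0. \<bar>h\<bar> * (M + 2) < e"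
    using \<open>e > 0\<close> by (auto dest: order_tendstoD(2))
  moreover have "\<forall>\<^sub>F h in at (0::real). h \<noteq> 0" by (simp add: eventually_at_filter)
  ultimately show "\<forall>\<^sub>F h in at 0. \<forall>t\<in>{0..1}. p (\<gamma> h t) \<le> e"
    using close
  proof eventually_elim
    case (elim h)
    show ?case
    proof
      fix t :: real assume t: "t \<in> {0..1}"
      have "p ((1 / h) *\<^sub>R \<gamma> h t) \<le> M + 2"
        using seminorm_triangle[OF q(1), of "\<iota> ((1 / h) *\<^sub>R \<gamma> h t) - I t" "I t"] elim(3) I[OF t] t
        by (fastforce simp: q(2))
      then have "\<bar>h\<bar> * p ((1 / h) *\<^sub>R \<gamma> h t) \<le> \<bar>h\<bar> * (M + 2)" by (rule mult_left_mono) simp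
      moreover have "\<bar>h\<bar> * p ((1 / h) *\<^sub>R \<gamma> h t) = p (\<gamma> h t)"
        using elim(2) by (simp add: seminorm_scaleR[OF p])
      ultimately show "p (\<gamma> h t) \<le> e" using elim(1) by linarith
    qed
  qed
qed

end


section \<open>Differentiation of the evolution map\<close>

context lie_group_chart
begin

context
  fixes \<phi> \<psi> :: "real \<Rightarrow> ('g, 'e) tangent"
  assumes admissible: "admissible G \<phi> \<psi>"
begin

abbreviation "var \<equiv> Evol_variation G \<phi> \<psi>"
abbreviation "Ad_curve \<equiv> \<lambda>s. Ad G (inv (Evol G \<phi> s)) (\<psi> s)"

lemma eventually_evol_domain: "\<forall>\<^sub>F h in at 0. (\<lambda>t. \<phi> t + h *\<^sub>R \<psi> t) \<in> evol_domain G"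
proof -
  obtain d where "d > 0" "\<forall>h\<in>{-d<..<d}. (\<lambda>t. \<phi> t + h *\<^sub>R \<psi> t) \<in> evol_domain G"
    using admissible by (auto simp: admissible_def)
  moreover have "h \<in> {-d<..<d}" if "dist h 0 < d" for h
    using that by (auto simp: dist_real_def)
  ultimately show ?thesis unfolding eventually_at by blast
qed

lemma admissible_evol_domain: "\<phi> \<in> evol_domain G"
proof -
  obtain d where d: "d > 0" "\<forall>h\<in>{-d<..<d}. (\<lambda>t. \<phi> t + h *\<^sub>R \<psi> t) \<in> evol_domain G"
    using admissible by (auto simp: admissible_def)
  have "(\<lambda>t. \<phi> t + 0 *\<^sub>R \<psi> t) \<in> evol_domain G"
    by (rule bspec[OF d(2)]) (use d(1) in simp)
  then show ?thesis by simp
qed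

lemma admissible_lie_algebra: "t \<in> {0..1} \<Longrightarrow> \<psi> t \<in> lie_algebra G"
  using admissible by (auto simp: admissible_def C0_curves_def)

lemma continuous_Ad_curve: "continuous_on {0..1} (\<lambda>s. Ad_curve s c)"
  unfolding continuous_on_def
proof
  fix t :: real assume t: "t \<in> {0..1}"
  have "continuous_on {0..1} \<psi>" using admissible by (auto simp: admissible_def C0_curves_def)
  then have "continuous_on {0..1} (\<lambda>s. \<psi> s c)" by (rule continuous_on_product_then_coordinatewise)
  then have "((\<lambda>s. \<psi> s c) \<longlongrightarrow> \<psi> t c) (at t within {0..1})" using t by (simp add: continuous_on_def)
  then have "((\<lambda>s. Ad_chart (inv (Evol G \<phi> s)) (\<psi> s c)) \<longlongrightarrow> Ad_chart (inv (Evol G \<phi> t)) (\<psi> t c)) (at t within {0..1})"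
    by (intro tendsto_Ad_chart tendsto_inv Evol_tendsto[OF admissible_evol_domain t])
  then show "((\<lambda>s. Ad_curve s c) \<longlongrightarrow> Ad_curve t c) (at t within {0..1})"
    unfolding Ad_apply[OF admissible_lie_algebra[OF t]]
    by (rule Lim_transform_eventually) (auto simp: eventually_at_filter Ad_apply admissible_lie_algebra)
qed

text \<open>That the variation stays in the chart is part of regularity and equally of the uniform
  limit of the quotients, so it is at hand in both directions of the equivalence.\<close>

lemma variation_perturbed_curves:
  assumes U: "\<forall>\<^sub>F h in at 0. \<forall>t\<in>{0..1}. var h t \<in> fst c"
  shows "perturbed_curves rmult_deriv (\<lambda>s. Ad_curve s c) (\<lambda>h t. snd c (var h t))"
proof
  show "((\<lambda>u. rmult_deriv (fst u) (snd u)) \<longlongrightarrow> v) (nhds 0 \<times>\<^sub>F nhds v)" for v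
    by (rule tendsto_rmult_deriv)
  show "continuous_on {0..1} (\<lambda>s. Ad_curve s c)"
    by (rule continuous_Ad_curve)
  show "\<forall>\<^sub>F h in at 0. snd c (var h 0) = 0"
    using eventually_evol_domain
    by eventually_elim (simp add: Evol_variation_def Evol_0 admissible_evol_domain chart_one)
  show "\<forall>\<^sub>F h in at 0. \<forall>t\<in>{0..1}. ((\<lambda>s. (1 / (s - t)) *\<^sub>R (snd c (var h s) - snd c (var h t))) \<longlongrightarrow>
      h *\<^sub>R rmult_deriv (snd c (var h t)) (Ad_curve t c)) (at t within {0..1})"
    using eventually_evol_domain U
  proof eventually_elim
    case (elim h)
    show ?case
    proof
      fix t :: real assume t: "t \<in> {0..1}"
      then show "((\<lambda>s. (1 / (s - t)) *\<^sub>R (snd c (var h s) - snd c (var h t))) \<longlongrightarrow>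
          h *\<^sub>R rmult_deriv (snd c (var h t)) (Ad_curve t c)) (at t within {0..1})"
        using Evol_variation_chart_velocity[OF admissible_evol_domain elim(1) t] elim(2)
        by (simp add: chart_velocity_def curve_quotient_def[abs_def] Ad_apply admissible_lie_algebra)
    qed
  qed
qed

theorem regular_pair_iff:
  fixes \<iota> :: "'e \<Rightarrow> 'f::{locally_convex_space, complete_uniform_space}"
  assumes \<iota>: "is_completion UNIV \<iota>"
  shows "regular_pair G \<iota> c \<phi> \<psi> \<longleftrightarrow>
    (\<forall>\<^sub>F h in at 0. \<forall>t\<in>{0..1}. var h t \<in> fst c) \<and>
    uniform_limit_at_0 \<iota> (\<lambda>h t. (1 / h) *\<^sub>R snd c (var h t)) (\<lambda>t. riemann_integral 0 t (\<lambda>s. \<iota> (Ad_curve s c)))"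
  unfolding regular_pair_def uniform_limit_at_0_zero_iff[OF \<iota>]
  using admissible perturbed_curves.quotient_uniform_limit[OF variation_perturbed_curves _ \<iota>]
    perturbed_curves.quotient_limit_imp_vanishing[OF variation_perturbed_curves \<iota>]
  by blast

lemma evol_variation: "evol G (\<lambda>s. \<phi> s + h *\<^sub>R \<psi> s) = evol G \<phi> \<otimes> var h 1"
  by (simp add: evol_def Evol_variation_def mult_cancel)

lemma variation_0: "var 0 1 = \<one>"
  by (simp add: Evol_variation_def)

section \<open>Differentiability of the evolution map in the parameter\<close>

context
  fixes \<iota> :: "'e \<Rightarrow> 'f::{locally_convex_space, complete_uniform_space}"
    and \<kappa> :: "('g, 'e) tangent \<Rightarrow> 'k::{locally_convex_space, complete_uniform_space}"
  assumes \<iota>: "is_completion UNIV \<iota>" and \<kappa>: "is_completion (lie_algebra G) \<kappa>"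
    and regular: "regular_pair G \<iota> c \<phi> \<psi>"
begin

abbreviation "lift \<equiv> \<lambda>v. \<kappa> (tangent_of (atlas G) \<one> c v)"
abbreviation "integral_Ad \<equiv> riemann_integral 0 1 (\<lambda>s. \<kappa> (Ad_curve s))"

lemma lift_completion: "is_completion UNIV lift"
  using is_completion_tangent_of[OF smooth_atlas chart_at_one] \<kappa> by (simp add: lie_algebra_def)

lemma lift_coordinate: "X \<in> lie_algebra G \<Longrightarrow> lift (X c) = \<kappa> X"
  using tangent_of_coordinate[OF smooth_atlas chart_at_one] by (simp add: lie_algebra_def)

lemma regular_in_chart: "\<forall>\<^sub>F h in at 0. \<forall>t\<in>{0..1}. var h t \<in> fst c"
  using regular by (simp add: regular_pair_def)

text \<open>The lift turns the coordinate of a Lie algebra vector back into its image under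
  \<open>\<kappa>\<close>, so the limit is the integral of the Lie algebra valued curve
  itself.\<close>

lemma quotient_tendsto: "((\<lambda>h. lift ((1 / h) *\<^sub>R snd c (var h 1))) \<longlongrightarrow> integral_Ad) (at 0)"
proof -
  have van: "uniformly_vanishing (\<lambda>h t. snd c (var h t))"
    using regular by (simp add: regular_pair_def uniform_limit_at_0_zero_iff[OF \<iota>])
  note lim = perturbed_curves.quotient_uniform_limit[OF variation_perturbed_curves[OF regular_in_chart] van lift_completion]
  have "((\<lambda>h. lift ((1 / h) *\<^sub>R snd c (var h 1))) \<longlongrightarrow> riemann_integral 0 1 (\<lambda>s. lift (Ad_curve s c))) (at 0)"
  proof (rule tendsto_seminormI)
    fix q :: "'k \<Rightarrow> real" and e :: real assume "continuous_seminorm q" "e > 0"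
    with lim[unfolded uniform_limit_at_0_iff[OF lift_completion]]
    have "\<forall>\<^sub>F h in at 0. \<forall>t\<in>{0..1}.
        q (lift ((1 / h) *\<^sub>R snd c (var h t)) - riemann_integral 0 t (\<lambda>s. lift (Ad_curve s c))) \<le> e"
      by blast
    then show "\<forall>\<^sub>F h in at 0. q (lift ((1 / h) *\<^sub>R snd c (var h 1)) - riemann_integral 0 1 (\<lambda>s. lift (Ad_curve s c))) \<le> e"
      by eventually_elim simp
  qed
  moreover have "riemann_integral 0 1 (\<lambda>s. lift (Ad_curve s c)) = integral_Ad"
    by (rule riemann_integral_cong) (simp add: lift_coordinate Ad_in_lie_algebra admissible_lie_algebra)
  ultimately show ?thesis by simp
qed

text \<open>One direction is uniqueness of limits in the completion; for the other, convergence of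
  lifted quotients to a lifted vector descends to \<open>E\<close>.\<close>

lemma variation_chart_velocity_iff:
  "chart_velocity c (\<lambda>h. var h 1) 0 UNIV v \<longleftrightarrow> lift v = integral_Ad"
proof -
  have "\<forall>\<^sub>F h in at 0. var h 1 \<in> fst c"
    using regular_in_chart by eventually_elim simp
  then have "chart_velocity c (\<lambda>h. var h 1) 0 UNIV v \<longleftrightarrow> ((\<lambda>h. (1 / h) *\<^sub>R snd c (var h 1)) \<longlongrightarrow> v) (at 0)"
    by (simp add: chart_velocity_def curve_quotient_def[abs_def] variation_0 one_in_chart chart_one)
  also have "\<dots> \<longleftrightarrow> lift v = integral_Ad"
  proof
    assume "((\<lambda>h. (1 / h) *\<^sub>R snd c (var h 1)) \<longlongrightarrow> v) (at 0)"
    from completion_tendsto[OF lift_completion this] quotient_tendsto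
    show "lift v = integral_Ad" using tendsto_unique[OF trivial_limit_at] by blast
  next
    assume "lift v = integral_Ad"
    then show "((\<lambda>h. (1 / h) *\<^sub>R snd c (var h 1)) \<longlongrightarrow> v) (at 0)"
      by (intro completion_tendsto_cancel[OF lift_completion]) (simp only: quotient_tendsto)
  qed
  finally show ?thesis .
qed

text \<open>The perturbed evolution is a left translate of the variation at time 1, which passes
  through the unit at \<open>h = 0\<close>; the chain rule transports its velocity.\<close>

lemma evol_chart_velocity:
  assumes v: "lift v = integral_Ad"
    and d: "d \<in> charts_at (atlas G) (evol G \<phi>)"
    and D: "has_chart_derivative c d (\<lambda>g. evol G \<phi> \<otimes> g) \<one> D"
  shows "chart_velocity d (\<lambda>h. evol G (\<lambda>s. \<phi> s + h *\<^sub>R \<psi> s)) 0 UNIV (D v)"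
  using chart_velocity_compose[where \<mu> = "\<lambda>h. var h 1" and t = 0 and f = "\<lambda>g. evol G \<phi> \<otimes> g",
      OF chart_topological _ _ D[folded variation_0]]
    variation_chart_velocity_iff v d
  by (auto simp: evol_variation dest: charts_atD)

lemma left_mult_derivative:
  assumes "d \<in> charts_at (atlas G) (evol G \<phi>)"
  obtains D where "has_chart_derivative c d (\<lambda>g. evol G \<phi> \<otimes> g) \<one> D"
  using differentiable_left_mult[OF chart_at_one, of "evol G \<phi>"] assms
  by (auto simp: differentiable_in_def)

theorem differentiable_evol_iff:
  "differentiable_at_0 (atlas G) (\<lambda>h. evol G (\<lambda>s. \<phi> s + h *\<^sub>R \<psi> s)) \<longleftrightarrow> integral_Ad \<in> \<kappa> ` lie_algebra G"
proof
  assume "differentiable_at_0 (atlas G) (\<lambda>h. evol G (\<lambda>s. \<phi> s + h *\<^sub>R \<psi> s))"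
  then obtain d l where d: "d \<in> charts_at (atlas G) (evol G \<phi>)"
    and l: "chart_velocity d (\<lambda>h. evol G (\<lambda>s. \<phi> s + h *\<^sub>R \<psi> s)) 0 UNIV l"
    by (auto simp: differentiable_at_0_def chart_velocity_def dest: charts_atD)
  obtain D where D: "has_chart_derivative d c (\<lambda>g. inv (evol G \<phi>) \<otimes> g) (evol G \<phi>) D"
    using differentiable_left_mult[OF d, of "inv (evol G \<phi>)"] chart_at_one by (auto simp: differentiable_in_def)
  \<comment> \<open>Differentiability is given in some chart \<open>d\<close>; left translation by
    the inverse returns the curve to the unit, where the criterion in the chart \<open>c\<close>
    applies.\<close>
  have "chart_velocity c (\<lambda>h. inv (evol G \<phi>) \<otimes> evol G (\<lambda>s. \<phi> s + h *\<^sub>R \<psi> s)) 0 UNIV (D l)"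
    by (rule chart_velocity_compose[OF _ chart_topological l]) (use D d in \<open>auto dest: charts_atD\<close>)
  then have "lift (D l) = integral_Ad"
    by (simp add: evol_variation mult_cancel variation_chart_velocity_iff)
  then show "integral_Ad \<in> \<kappa> ` lie_algebra G"
    by (intro image_eqI[where f = \<kappa> and x = "tangent_of (atlas G) \<one> c (D l)"])
      (simp_all add: lie_algebra_def tangent_of_in_tangent_space[OF smooth_atlas chart_at_one])
next
  assume "integral_Ad \<in> \<kappa> ` lie_algebra G"
  then obtain X where X: "X \<in> lie_algebra G" "integral_Ad = \<kappa> X" by blast
  obtain d where d: "d \<in> charts_at (atlas G) (evol G \<phi>)"
    using charts_at_nonempty[OF smooth_atlas] by blast
  obtain D where D: "has_chart_derivative c d (\<lambda>g. evol G \<phi> \<otimes> g) \<one> D"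
    using left_mult_derivative[OF d] by blast
  have "chart_velocity d (\<lambda>h. evol G (\<lambda>s. \<phi> s + h *\<^sub>R \<psi> s)) 0 UNIV (D (X c))"
    using X by (intro evol_chart_velocity[OF _ d D]) (simp add: lift_coordinate)
  then show "differentiable_at_0 (atlas G) (\<lambda>h. evol G (\<lambda>s. \<phi> s + h *\<^sub>R \<psi> s))"
    using d by (auto simp: differentiable_at_0_def chart_velocity_def)
qed

text \<open>The two tangent vectors are compared coordinate by coordinate; off the charts around the
  point both are 0 by definition.\<close>

theorem velocity_evol:
  assumes X: "X \<in> lie_algebra G" "\<kappa> X = integral_Ad"
  shows "velocity (atlas G) UNIV (\<lambda>h. evol G (\<lambda>s. \<phi> s + h *\<^sub>R \<psi> s)) 0 =
    tangent_map (atlas G) (atlas G) (\<lambda>g. evol G \<phi> \<otimes> g) \<one> X"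
proof
  fix d
  show "velocity (atlas G) UNIV (\<lambda>h. evol G (\<lambda>s. \<phi> s + h *\<^sub>R \<psi> s)) 0 d =
    tangent_map (atlas G) (atlas G) (\<lambda>g. evol G \<phi> \<otimes> g) \<one> X d"
  proof (cases "d \<in> charts_at (atlas G) (evol G \<phi>)")
    case True
    obtain D where D: "has_chart_derivative c d (\<lambda>g. evol G \<phi> \<otimes> g) \<one> D"
      using left_mult_derivative[OF True] by blast
    have "chart_velocity d (\<lambda>h. evol G (\<lambda>s. \<phi> s + h *\<^sub>R \<psi> s)) 0 UNIV (D (X c))"
      using X by (intro evol_chart_velocity[OF _ True D]) (simp add: lift_coordinate)
    then have "velocity (atlas G) UNIV (\<lambda>h. evol G (\<lambda>s. \<phi> s + h *\<^sub>R \<psi> s)) 0 d = D (X c)"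
      using True by (intro velocity_apply) simp_all
    moreover have "tangent_map (atlas G) (atlas G) (\<lambda>g. evol G \<phi> \<otimes> g) \<one> X d = D (X c)"
      using X True by (intro tangent_map_apply[OF smooth_atlas _ chart_at_one _ D]) (simp_all add: lie_algebra_def)
    ultimately show ?thesis by simp
  next
    case False
    then show ?thesis by (simp add: velocity_def tangent_map_def Let_def)
  qed
qed

end

end

end

theorem propositionB:
  fixes G :: "('g::t2_space, 'e::locally_convex_space) lie_group_data"
    and \<iota> :: "'e \<Rightarrow> 'f::{locally_convex_space, complete_uniform_space}"
    and \<kappa> :: "('g, 'e) tangent \<Rightarrow> 'k::{locally_convex_space, complete_uniform_space}"
    and U :: "'g set" and \<Xi> :: "'g \<Rightarrow> 'e"
    and \<phi> \<psi> :: "real \<Rightarrow> ('g, 'e) tangent"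
  assumes "lie_group G"
    and "is_completion UNIV \<iota>"
    and "is_completion (lie_algebra G) \<kappa>"
    and "(U, \<Xi>) \<in> charts (atlas G)" and "\<one>\<^bsub>G\<^esub> \<in> U" and "\<Xi> \<one>\<^bsub>G\<^esub> = 0" and "convex (\<Xi> ` U)"
    and "\<phi> \<in> C0_curves G" and "\<psi> \<in> C0_curves G"
    and "admissible G \<phi> \<psi>"
  shows
    "(regular_pair G \<iota> (U, \<Xi>) \<phi> \<psi> \<longleftrightarrow>
        (\<forall>\<^sub>F h in at 0. \<forall>t\<in>{0..1}. Evol_variation G \<phi> \<psi> h t \<in> U) \<and>
        uniform_limit_at_0 \<iota>
          (\<lambda>h t. (1 / h) *\<^sub>R \<Xi> (Evol_variation G \<phi> \<psi> h t))
          (\<lambda>t. riemann_integral 0 t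
            (\<lambda>s. \<iota> (chart_differential (U, \<Xi>) (Ad G (inv\<^bsub>G\<^esub> (Evol G \<phi> s)) (\<psi> s)))))) \<and>
     (regular_pair G \<iota> (U, \<Xi>) \<phi> \<psi> \<longrightarrow>
        (differentiable_at_0 (atlas G) (\<lambda>h. evol G (\<lambda>s. \<phi> s + h *\<^sub>R \<psi> s)) \<longleftrightarrow>
          riemann_integral 0 1 (\<lambda>s. \<kappa> (Ad G (inv\<^bsub>G\<^esub> (Evol G \<phi> s)) (\<psi> s)))
            \<in> \<kappa> ` lie_algebra G) \<and>
        (\<forall>X\<in>lie_algebra G.
          \<kappa> X = riemann_integral 0 1 (\<lambda>s. \<kappa> (Ad G (inv\<^bsub>G\<^esub> (Evol G \<phi> s)) (\<psi> s))) \<longrightarrow>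
          velocity (atlas G) UNIV (\<lambda>h. evol G (\<lambda>s. \<phi> s + h *\<^sub>R \<psi> s)) 0 =
            tangent_map (atlas G) (atlas G) (\<lambda>g. evol G \<phi> \<otimes>\<^bsub>G\<^esub> g) \<one>\<^bsub>G\<^esub> X))"
proof -
  interpret lie_group_chart G "(U, \<Xi>)"
  proof (intro lie_group_chart.intro lie_group_chart_axioms.intro)
    show "(U, \<Xi>) \<in> charts_at (atlas G) \<one>\<^bsub>G\<^esub>" using assms by (simp add: charts_at_def)
  qed (use assms in simp_all)
  show ?thesis
    using regular_pair_iff[OF assms(10) assms(2)] differentiable_evol_iff[OF assms(10) assms(2) assms(3)]
      velocity_evol[OF assms(10) assms(2) assms(3)]
    by (simp add: chart_differential_def)
qed

end
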